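(* Let $n\ge 1$ and let $k$ be a field such that $\mathrm{char}\,k\ne 2$ and $\mathrm{char}\,k\nmid 1+(-2)^n$. Let $R=k[[x,y]]/(xy(x^n+y^n))$ and $\mathfrak{m}=(x,y)R$. Then $\mathfrak{m}^{n+2}=(x+2y)\mathfrak{m}^{n+1}$ and $$\mathrm{g}\ell\ell(R)=\mathrm{index}(R)=n+2.$$
   Context: The generalized Loewy length $\mathrm{g}\ell\ell(R)$ of the Cohen-Macaulay local ring $(R,\mathfrak{m})$ is the smallest positive integer $n$ for which $\mathfrak{m}^n$ is contained in the ideal generated by some system of parameters of $R$. For a finitely generated $R$-module $M$, Auslander's $\delta$-invariant $\delta_R(M)$ is the smallest non-negative integer $n$ such that there is a surjective $R$-linear map $X\oplus R^n\to M$, where $X$ is a maximal Cohen-Macaulay $R$-module with no free direct summand ($X=0$ is allowed). The index of $R$ is $\mathrm{index}(R)=\inf\{n\ge 1 : \delta_R(R/\mathfrak{m}^n)=1\}$. (Known result of Ding: for a hypersurface ring $R=k[[x_1,\dots,x_n]]/(f)$ with $f\in(x_1,\dots,x_n)^r\setminus(x_1,\dots,x_n)^{r+1}$, the index equals the Hilbert-Samuel multiplicity, $\mathrm{index}(R)=e(R)=r$.) *)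

theory Defs
  imports
    "HOL-Computational_Algebra.Formal_Power_Series"
    "HOL-Algebra.QuotRing"
    "HOL-Algebra.Ideal_Product"
    "HOL-Algebra.Module"
    "HOL-Decision_Procs.Algebra_Aux"
    "HOL-Library.Extended_Nat"
    "HOL-Library.FuncSet"
begin

text \<open>
  The name \<open>module\<close> is also used by the theory \<open>Modules\<close> of \<open>Main\<close>, so the locale of HOL-Algebra is
  written \<open>Module.module\<close> throughout. Of the ring operations of a module record only \<open>zero\<close> and
  \<open>add\<close> are meaningful; \<open>mult\<close> and \<open>one\<close> are left undefined.
\<close>


section \<open>The power series ring in two variables\<close>

text \<open>The ring \<open>k[[x,y]]\<close> is represented as \<open>k[[x]][[y]]\<close>.\<close>

type_synonym 'k power_series2 = "'k fps fps"

definition var_x :: "'k::comm_ring_1 power_series2"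
  where "var_x = fps_const fps_X"

definition var_y :: "'k::comm_ring_1 power_series2"
  where "var_y = fps_X"


section \<open>Ideals, dimension, systems of parameters\<close>

text \<open>Only meant for local rings, where the maximal ideal is unique.\<close>

definition max_ideal :: "'a ring \<Rightarrow> 'a set"
  where "max_ideal R = (THE I. maximalideal I R)"

abbreviation ideal_power :: "'a ring \<Rightarrow> 'a set \<Rightarrow> nat \<Rightarrow> 'a set"
  where "ideal_power R I n \<equiv> I [^]\<^bsub>ideals_set R\<^esub> n"

definition radical :: "'a ring \<Rightarrow> 'a set \<Rightarrow> 'a set"
  where "radical R I = {a \<in> carrier R. \<exists>k::nat. a [^]\<^bsub>R\<^esub> k \<in> I}"

definition krull_dim :: "'a ring \<Rightarrow> enat"
  where "krull_dim R = Sup {enat l |l. \<exists>P :: nat \<Rightarrow> 'a set.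
           (\<forall>i\<le>l. primeideal (P i) R) \<and> (\<forall>i<l. P i \<subset> P (Suc i))}"

definition system_of_parameters :: "'a ring \<Rightarrow> 'a list \<Rightarrow> bool"
  where "system_of_parameters R xs \<longleftrightarrow>
           set xs \<subseteq> carrier R \<and>
           enat (length xs) = krull_dim R \<and>
           radical R (Idl\<^bsub>R\<^esub> (set xs)) = max_ideal R"

definition generalized_loewy_length :: "'a ring \<Rightarrow> nat"
  where "generalized_loewy_length R =
           (LEAST n. n \<ge> 1 \<and>
              (\<exists>xs. system_of_parameters R xs \<and> ideal_power R (max_ideal R) n \<subseteq> Idl\<^bsub>R\<^esub> (set xs)))"


section \<open>Modules\<close>

definition linear_maps :: "'a ring \<Rightarrow> ('a, 'b) module \<Rightarrow> ('a, 'c) module \<Rightarrow> ('b \<Rightarrow> 'c) set"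
  where "linear_maps R M N =
           {h \<in> carrier M \<rightarrow> carrier N.
              (\<forall>v\<in>carrier M. \<forall>w\<in>carrier M. h (v \<oplus>\<^bsub>M\<^esub> w) = h v \<oplus>\<^bsub>N\<^esub> h w) \<and>
              (\<forall>r\<in>carrier R. \<forall>v\<in>carrier M. h (r \<odot>\<^bsub>M\<^esub> v) = r \<odot>\<^bsub>N\<^esub> h v)}"

definition free_module :: "'a ring \<Rightarrow> nat \<Rightarrow> ('a, nat \<Rightarrow> 'a) module"
  where "free_module R n =
           \<lparr>carrier = {..<n} \<rightarrow>\<^sub>E carrier R,
            mult = undefined,
            one = undefined,
            zero = (\<lambda>i\<in>{..<n}. \<zero>\<^bsub>R\<^esub>),
            add = (\<lambda>v w. \<lambda>i\<in>{..<n}. v i \<oplus>\<^bsub>R\<^esub> w i),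
            smult = (\<lambda>r v. \<lambda>i\<in>{..<n}. r \<otimes>\<^bsub>R\<^esub> v i)\<rparr>"

definition regular_module :: "'a ring \<Rightarrow> ('a, 'a) module"
  where "regular_module R =
           \<lparr>carrier = carrier R, mult = undefined, one = undefined,
            zero = \<zero>\<^bsub>R\<^esub>, add = add R, smult = mult R\<rparr>"

definition module_sum :: "('a, 'b) module \<Rightarrow> ('a, 'c) module \<Rightarrow> ('a, 'b \<times> 'c) module"
  where "module_sum M N =
           \<lparr>carrier = carrier M \<times> carrier N,
            mult = undefined,
            one = undefined,
            zero = (\<zero>\<^bsub>M\<^esub>, \<zero>\<^bsub>N\<^esub>),
            add = (\<lambda>(v, v') (w, w'). (v \<oplus>\<^bsub>M\<^esub> w, v' \<oplus>\<^bsub>N\<^esub> w')),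
            smult = (\<lambda>r (v, v'). (r \<odot>\<^bsub>M\<^esub> v, r \<odot>\<^bsub>N\<^esub> v'))\<rparr>"

text \<open>For \<open>v \<in> C\<close> the coset \<open>N + r v\<close> depends only on \<open>r\<close> and the coset \<open>C\<close>, so the union in the
  scalar multiplication is that single coset (compare \<^const>\<open>rcoset_mult\<close>).\<close>

definition quotient_module :: "('a, 'b) module \<Rightarrow> 'b set \<Rightarrow> ('a, 'b set) module"
  where "quotient_module M N =
           \<lparr>carrier = a_rcosets\<^bsub>M\<^esub> N,
            mult = undefined,
            one = undefined,
            zero = N,
            add = set_add M,
            smult = (\<lambda>r C. \<Union>v\<in>C. N +>\<^bsub>M\<^esub> (r \<odot>\<^bsub>M\<^esub> v))\<rparr>"

definition submodule_span :: "'a ring \<Rightarrow> ('a, 'b) module \<Rightarrow> 'b set \<Rightarrow> 'b set"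
  where "submodule_span R M S = \<Inter>{N. submodule N R M \<and> S \<subseteq> N}"

definition finitely_generated :: "'a ring \<Rightarrow> ('a, 'b) module \<Rightarrow> bool"
  where "finitely_generated R M \<longleftrightarrow>
           (\<exists>S. finite S \<and> S \<subseteq> carrier M \<and> submodule_span R M S = carrier M)"

text \<open>The quotient \<open>M / (x\<^sub>1, ..., x\<^sub>r) M\<close>.\<close>

definition quotient_by_elements ::
    "'a ring \<Rightarrow> ('a, 'b) module \<Rightarrow> 'a list \<Rightarrow> ('a, 'b set) module"
  where "quotient_by_elements R M xs =
           quotient_module M (submodule_span R M {r \<odot>\<^bsub>M\<^esub> v |r v. r \<in> set xs \<and> v \<in> carrier M})"

definition regular_sequence :: "'a ring \<Rightarrow> ('a, 'b) module \<Rightarrow> 'a list \<Rightarrow> bool"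
  where "regular_sequence R M xs \<longleftrightarrow>
           (\<forall>i<length xs. let Q = quotient_by_elements R M (take i xs) in
              \<forall>v\<in>carrier Q. (xs ! i) \<odot>\<^bsub>Q\<^esub> v = \<zero>\<^bsub>Q\<^esub> \<longrightarrow> v = \<zero>\<^bsub>Q\<^esub>) \<and>
           (let Q = quotient_by_elements R M xs in carrier Q \<noteq> {\<zero>\<^bsub>Q\<^esub>})"

text \<open>Only meant for nonzero finitely generated modules over Noetherian local rings.\<close>

definition depth :: "'a ring \<Rightarrow> ('a, 'b) module \<Rightarrow> enat"
  where "depth R M =
           Sup {enat (length xs) |xs. set xs \<subseteq> max_ideal R \<and> regular_sequence R M xs}"

text \<open>The zero module counts as maximal Cohen-Macaulay.\<close>

definition maximal_cohen_macaulay :: "'a ring \<Rightarrow> ('a, 'b) module \<Rightarrow> bool"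
  where "maximal_cohen_macaulay R M \<longleftrightarrow>
           Module.module R M \<and> finitely_generated R M \<and>
           (carrier M = {\<zero>\<^bsub>M\<^esub>} \<or> depth R M = krull_dim R)"

definition has_free_summand :: "'a ring \<Rightarrow> ('a, 'b) module \<Rightarrow> bool"
  where "has_free_summand R M \<longleftrightarrow>
           (\<exists>F N. submodule F R M \<and> submodule N R M \<and>
              F \<inter> N = {\<zero>\<^bsub>M\<^esub>} \<and> F <+>\<^bsub>M\<^esub> N = carrier M \<and>
              (\<exists>k\<ge>1. \<exists>h\<in>linear_maps R (free_module R k) (M\<lparr>carrier := F\<rparr>).
                 bij_betw h (carrier (free_module R k)) F))"


section \<open>The delta invariant and the index\<close>

text \<open>
  HOL cannot quantify over all modules at once. No generality is lost by taking the elements of \<open>X\<close>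
  in the type \<^typ>\<open>(nat \<Rightarrow> 'a) set\<close>: a finitely generated module is isomorphic to some
  \<^term>\<open>quotient_module (free_module R m) N\<close>, which has elements of this type.
\<close>

definition delta_invariant :: "'a ring \<Rightarrow> ('a, 'b) module \<Rightarrow> nat"
  where "delta_invariant R M =
           (LEAST n. \<exists>X :: ('a, (nat \<Rightarrow> 'a) set) module.
              maximal_cohen_macaulay R X \<and> \<not> has_free_summand R X \<and>
              (\<exists>h\<in>linear_maps R (module_sum X (free_module R n)) M.
                 h ` carrier (module_sum X (free_module R n)) = carrier M))"

definition index :: "'a ring \<Rightarrow> enat"
  where "index R =
           Inf {enat n |n. n \<ge> 1 \<and>
              delta_invariant R
                (quotient_module (regular_module R) (ideal_power R (max_ideal R) n)) = 1}"

end

theory Submission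
  imports Defs
begin

text \<open>
  Let f be the form \<open>x y (x^n + y^n)\<close> of degree \<open>d = n + 2\<close>, and let \<open>z = x + 2 y\<close>. The conditions on the
  characteristic say exactly that z does not divide f, because \<open>f(-2, 1) = -2 (1 + (-2)^n)\<close>. The argument
  is carried out for any form f of degree \<open>d \<ge> 2\<close> with the factor x and any linear form \<open>z = x + a y\<close> that
  does not divide f; let \<open>R = k[[x, y]] / (f)\<close>. After the coordinate change that makes
  z a variable, f is regular of order d in y and Weierstrass division shows that R is generated by
  \<open>1, y, ..., y^(d - 1)\<close> over \<open>A = k[[z]]\<close>.

  Modulo z the form f is a unit times \<open>y^d\<close>. This gives \<open>m^d = z m^(d - 1)\<close> for the maximal ideal m of R, and
  with Krull dimension 1, which follows from algebraic relations over A (\<open>z_power_relation\<close>), z is a system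
  of parameters whose ideal contains \<open>m^d\<close>. No parameter ideal contains \<open>m^(d - 1)\<close>: since
  \<open>f = x g + y h\<close> with g and h of order \<open>d - 1\<close>, a generator w of such an ideal would divide f by Nakayama's
  lemma, and then it would divide both \<open>x^(d - 1)\<close> and \<open>y^(d - 1)\<close> (\<open>no_short_power\<close>). So the generalized
  Loewy length is d.

  A cyclic module has delta invariant 0 or 1, and it is 0 if a maximal Cohen-Macaulay module X without
  free summand maps onto it (\<open>delta_invariant_cyclic\<close>). For \<open>R / m^i\<close> with \<open>i < d\<close> such an X comes from
  the factorization \<open>f = x g + y h\<close>: the cokernel of the matrix with rows \<open>(g, h)\<close> and \<open>(-y, x)\<close> maps onto
  \<open>R / (g, h)\<close> by the first coordinate, and g and h lie in \<open>m^(d - 1)\<close> (\<open>covered_mpow\<close>). For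
  \<open>R / m^d\<close> there is none. A maximal Cohen-Macaulay module X is free over A, and R-linear functionals on X
  correspond to A-linear ones, by an explicit formula with the Horner polynomials of f
  (\<open>linear_functional\<close>). Hence X has a free summand as soon as \<open>y^(d - 1) X\<close> is not contained in \<open>z X\<close>
  (\<open>free_summand_criterion\<close>). This is the case if X maps onto \<open>R / m^d\<close>, since \<open>y^(d - 1)\<close> is not
  in \<open>(z) + m^d\<close> (\<open>not_covered_mpow_d\<close>). So the index is d as well.
\<close>

section \<open>Powers of the maximal ideal of k[[x,y]]\<close>

unbundle fps_syntax

text \<open>The ideal \<open>(x, y)^k\<close>. The outer index of a coefficient is the exponent of y.\<close>

definition order_ideal :: "nat \<Rightarrow> 'k::comm_ring_1 power_series2 set"
  where "order_ideal k = {u. \<forall>i j. i + j < k \<longrightarrow> u $ i $ j = 0}"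

definition scalar :: "'k::comm_ring_1 \<Rightarrow> 'k power_series2"
  where "scalar c = fps_const (fps_const c)"

lemma var_x_nth [simp]: "var_x $ i = (if i = 0 then fps_X else 0)"
  and var_y_nth [simp]: "var_y $ i = (if i = 1 then 1 else 0)"
  by (simp_all add: var_x_def var_y_def)

declare fps_mult_nth_0 [simp del]

lemma var_x_mult_nth:
  "(var_x * u) $ i $ j = (if j = 0 then 0 else u $ i $ (j - 1))"
  by (simp add: var_x_def)

lemma var_y_mult_nth:
  "(var_y * u) $ i = (if i = 0 then 0 else u $ (i - 1))"
  by (simp add: var_y_def)

lemma scalar_mult_nth: "(scalar c * u) $ i $ j = c * u $ i $ j"
  by (simp add: scalar_def)

text \<open>Induction on the order rests on this splitting: what is known modulo \<open>(x, y)^k\<close> for \<open>v\<close> and \<open>w\<close>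
  carries over to \<open>u\<close> modulo \<open>(x, y)^(k + 1)\<close>.\<close>

lemma power_series2_split:
  fixes u :: "'k::comm_ring_1 power_series2"
  obtains v w where "u = scalar (u $ 0 $ 0) + var_x * v + var_y * w"
    and "\<And>k. u \<in> order_ideal (Suc k) \<Longrightarrow> v \<in> order_ideal k \<and> w \<in> order_ideal k"
proof
  define v where "v = fps_const (fps_shift 1 (u $ 0))"
  define w where "w = fps_shift 1 u"
  show "u = scalar (u $ 0 $ 0) + var_x * v + var_y * w"
  proof (intro fps_ext)
    fix i j
    show "u $ i $ j = (scalar (u $ 0 $ 0) + var_x * v + var_y * w) $ i $ j"
      by (cases i; cases j)
        (simp_all add: var_x_mult_nth var_y_mult_nth scalar_def v_def w_def del: fps_mult_nth_0)
  qed
  show "v \<in> order_ideal k \<and> w \<in> order_ideal k" if "u \<in> order_ideal (Suc k)" for k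
    using that by (auto simp: order_ideal_def v_def w_def)
qed

lemma order_ideal_0 [simp]: "order_ideal 0 = UNIV"
  by (simp add: order_ideal_def)

lemma zero_in_order_ideal [simp]: "0 \<in> order_ideal k"
  by (simp add: order_ideal_def)

lemma order_ideal_add: "u \<in> order_ideal k \<Longrightarrow> v \<in> order_ideal k \<Longrightarrow> u + v \<in> order_ideal k"
  by (simp add: order_ideal_def)

lemma order_ideal_diff: "u \<in> order_ideal k \<Longrightarrow> v \<in> order_ideal k \<Longrightarrow> u - v \<in> order_ideal k"
  by (simp add: order_ideal_def)

lemma order_ideal_mono: "u \<in> order_ideal l \<Longrightarrow> k \<le> l \<Longrightarrow> u \<in> order_ideal k"
  by (simp add: order_ideal_def)

lemma order_ideal_mult:
  assumes "u \<in> order_ideal k" "v \<in> order_ideal l"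
  shows "u * v \<in> order_ideal (k + l)"
proof -
  have "u $ a $ c * v $ (i - a) $ (j - c) = 0" if "i + j < k + l" "a \<le> i" "c \<le> j" for i j a c
  proof (cases "a + c < k")
    case True
    then show ?thesis using assms(1) by (simp add: order_ideal_def)
  next
    case False
    then have "(i - a) + (j - c) < l" using that by linarith
    then show ?thesis using assms(2) by (simp add: order_ideal_def)
  qed
  then show ?thesis
    by (simp add: order_ideal_def fps_mult_nth fps_sum_nth)
qed

lemma order_ideal_lmult: "v \<in> order_ideal l \<Longrightarrow> u * v \<in> order_ideal l"
  using order_ideal_mult[of u 0 v l] by simp

lemma order_ideal_rmult: "v \<in> order_ideal l \<Longrightarrow> v * u \<in> order_ideal l"
  using order_ideal_mult[of v l u 0] by simp

lemma var_x_in_order_ideal: "var_x \<in> order_ideal 1"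
  and var_y_in_order_ideal: "var_y \<in> order_ideal 1"
  by (simp_all add: order_ideal_def var_x_def var_y_def)

lemma power_in_order_ideal: "u \<in> order_ideal 1 \<Longrightarrow> u ^ k \<in> order_ideal k"
proof (induction k)
  case (Suc k)
  then show ?case using order_ideal_mult[of u 1 "u ^ k" k] by simp
qed simp

lemma order_ideal_Suc_iff:
  "u \<in> order_ideal (Suc k) \<longleftrightarrow>
     (\<exists>v\<in>order_ideal k. \<exists>w\<in>order_ideal k. u = var_x * v + var_y * w)"
proof
  assume u: "u \<in> order_ideal (Suc k)"
  obtain v w where vw: "u = scalar (u $ 0 $ 0) + var_x * v + var_y * w"
    "\<And>k. u \<in> order_ideal (Suc k) \<Longrightarrow> v \<in> order_ideal k \<and> w \<in> order_ideal k"
    using power_series2_split[of u] by blast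
  have "u $ 0 $ 0 = 0" using u by (simp add: order_ideal_def)
  then show "\<exists>v\<in>order_ideal k. \<exists>w\<in>order_ideal k. u = var_x * v + var_y * w"
    using vw u by (intro bexI[of _ v] bexI[of _ w]) (auto simp: scalar_def)
next
  assume "\<exists>v\<in>order_ideal k. \<exists>w\<in>order_ideal k. u = var_x * v + var_y * w"
  then show "u \<in> order_ideal (Suc k)"
    using order_ideal_mult[OF var_x_in_order_ideal] order_ideal_mult[OF var_y_in_order_ideal]
    by (auto intro!: order_ideal_add)
qed

lemma order_ideal_separated:
  assumes "\<And>k. u \<in> order_ideal k"
  shows "u = 0"
proof (intro fps_ext)
  fix i j
  show "u $ i $ j = 0 $ i $ j"
    using assms[of "Suc (i + j)"] by (simp add: order_ideal_def)
qed

lemma unit_power_series2: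
  fixes u :: "'k::field power_series2"
  assumes "u \<notin> order_ideal 1"
  shows "u dvd 1"
proof -
  have "u $ 0 $ 0 \<noteq> 0"
    using assms by (simp add: order_ideal_def)
  then have "u $ 0 * inverse (u $ 0) = 1"
    by (simp add: inverse_mult_eq_1')
  then have "u * fps_right_inverse u (inverse (u $ 0)) = 1"
    by (rule fps_right_inverse)
  then show ?thesis by (metis dvd_triv_left)
qed

lemma not_unit_order_ideal:
  fixes u :: "'k::field power_series2"
  assumes "u \<in> order_ideal 1"
  shows "\<not> u dvd 1"
proof
  assume "u dvd 1"
  then obtain v where "1 = u * v" by (rule dvdE)
  then have "(1::'k power_series2) \<in> order_ideal 1" using assms order_ideal_rmult by metis
  then show False by (simp add: order_ideal_def)
qed

section \<open>Reduction modulo x\<close>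

text \<open>The image of a power series in \<open>k[[x, y]] / (x) = k[[y]]\<close>.\<close>

definition mod_x :: "'k::comm_ring_1 power_series2 \<Rightarrow> 'k fps"
  where "mod_x u = Abs_fps (\<lambda>i. u $ i $ 0)"

lemma mod_x_nth [simp]: "mod_x u $ i = u $ i $ 0"
  by (simp add: mod_x_def)

lemma mod_x_add: "mod_x (u + v) = mod_x u + mod_x v"
  and mod_x_diff: "mod_x (u - v) = mod_x u - mod_x v"
  by (simp_all add: fps_eq_iff)

lemma mod_x_mult: "mod_x (u * v) = mod_x u * mod_x v"
  by (simp add: fps_eq_iff fps_mult_nth fps_sum_nth)

lemma mod_x_1 [simp]: "mod_x 1 = 1"
  by (simp add: fps_eq_iff)

lemma mod_x_power: "mod_x (u ^ n) = mod_x u ^ n"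
  by (induction n) (simp_all add: mod_x_mult)

lemma mod_x_var_x [simp]: "mod_x var_x = 0" and mod_x_var_y [simp]: "mod_x var_y = fps_X"
  by (simp_all add: fps_eq_iff var_x_def var_y_def fps_X_def)

lemma mod_x_scalar [simp]: "mod_x (scalar c) = fps_const c"
  by (simp add: fps_eq_iff scalar_def)

lemma mod_x_eq_0_iff: "mod_x u = 0 \<longleftrightarrow> var_x dvd u"
proof
  assume mod_x: "mod_x u = 0"
  have "u = var_x * Abs_fps (\<lambda>i. fps_shift 1 (u $ i))"
  proof (intro fps_ext)
    fix i j
    have "u $ i $ 0 = 0" using mod_x by (metis mod_x_nth fps_zero_nth)
    then show "u $ i $ j = (var_x * Abs_fps (\<lambda>i. fps_shift 1 (u $ i))) $ i $ j"
      by (simp add: var_x_mult_nth)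
  qed
  then show "var_x dvd u" by (metis dvd_triv_left)
qed (auto simp: mod_x_mult elim!: dvdE)

lemma prime_elem_var_x: "prime_elem (var_x :: 'k::field power_series2)"
proof (rule prime_elemI)
  show "var_x \<noteq> (0 :: 'k power_series2)" by (simp add: var_x_def)
  show "\<not> var_x dvd (1 :: 'k power_series2)"
    by (rule not_unit_order_ideal) (rule var_x_in_order_ideal)
  show "var_x dvd a \<or> var_x dvd b" if "var_x dvd a * b" for a b :: "'k power_series2"
    using that by (simp flip: mod_x_eq_0_iff add: mod_x_mult)
qed

text \<open>As x is prime, a divisor of \<open>x^a\<close> is a unit times a power of x, and x does not divide \<open>y^b\<close>.\<close>

lemma not_both_powers:
  fixes w :: "'k::field power_series2"
  assumes "w dvd var_x ^ a" "w dvd var_y ^ b"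
  shows "w dvd 1"
  using assms(1)
proof (induction a)
  case 0
  then show ?case by simp
next
  case (Suc a)
  obtain p where p: "var_x ^ Suc a = w * p" using Suc.prems by (rule dvdE)
  have "\<not> var_x dvd w"
  proof
    assume "var_x dvd w"
    then have "var_x dvd (var_y :: 'k power_series2) ^ b" using assms(2) dvd_trans by blast
    then show False
      using mod_x_eq_0_iff[of "var_y ^ b :: 'k power_series2"] by (simp add: mod_x_power)
  qed
  moreover have "var_x dvd w * p" by (simp flip: p)
  ultimately have "var_x dvd p"
    using prime_elem_var_x prime_elem_dvd_multD by blast
  then obtain p' where "p = var_x * p'" by (rule dvdE)
  then have "var_x * var_x ^ a = var_x * (w * p')" using p by (simp add: ac_simps)
  then have "var_x ^ a = w * p'"
    by (subst (asm) mult_left_cancel) (simp_all add: prime_elem_not_zeroI[OF prime_elem_var_x])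
  then show ?case by (intro Suc.IH) simp
qed

section \<open>The coordinate change x to x + a y\<close>

text \<open>The substitution of \<open>x + a y\<close> for x, in terms of coefficients. Composition of power series in the
  outer variable does not cover it: over \<open>k[[x]]\<close> the series \<open>x + a y\<close> has the nonzero constant
  term x.\<close>

definition shear :: "'k::comm_ring_1 \<Rightarrow> 'k power_series2 \<Rightarrow> 'k power_series2"
  where "shear a u = Abs_fps (\<lambda>j. Abs_fps (\<lambda>i.
           \<Sum>l\<le>j. u $ l $ (i + j - l) * of_nat ((i + j - l) choose (j - l)) * a ^ (j - l)))"

lemma shear_nth:
  "shear a u $ j $ i = (\<Sum>l\<le>j. u $ l $ (i + j - l) * of_nat ((i + j - l) choose (j - l)) * a ^ (j - l))"
  by (simp add: shear_def)

lemma shear_add: "shear a (u + v) = shear a u + shear a v"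
  by (simp add: fps_eq_iff shear_nth sum.distrib ring_distribs)

lemma shear_diff: "shear a (u - v) = shear a u - shear a v"
  by (simp add: fps_eq_iff shear_nth sum_subtractf ring_distribs)

lemma shear_0 [simp]: "shear a 0 = 0"
  by (simp add: fps_eq_iff shear_nth)

lemma shear_scalar_mult: "shear a (scalar c * u) = scalar c * shear a u"
  by (simp add: fps_eq_iff shear_nth scalar_mult_nth sum_distrib_left mult.assoc)

lemma shear_scalar: "shear a (scalar c) = scalar c"
proof (intro fps_ext)
  fix j i
  have "scalar c $ l $ (i + j - l) * of_nat ((i + j - l) choose (j - l)) * a ^ (j - l) =
      (if l = 0 then (if i = 0 \<and> j = 0 then c else 0) else 0)" if "l \<le> j" for l
    using that by (auto simp: scalar_def)
  then show "shear a (scalar c) $ j $ i = scalar c $ j $ i"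
    by (auto simp: shear_nth scalar_def)
qed

lemma shear_1 [simp]: "shear a 1 = 1"
  using shear_scalar[of a 1] by (simp add: scalar_def)

lemma shear_var_y_mult: "shear a (var_y * u) = var_y * shear a u"
proof (intro fps_ext)
  fix j i
  show "shear a (var_y * u) $ j $ i = (var_y * shear a u) $ j $ i"
    by (cases j) (simp_all add: shear_nth var_y_mult_nth sum.atMost_Suc_shift del: sum.atMost_Suc)
qed

lemma shear_var_x_mult: "shear a (var_x * u) = (var_x + scalar a * var_y) * shear a u"
proof (intro fps_ext)
  fix j i
  let ?B = "\<lambda>i j l. u $ l $ (i + j - l) * of_nat ((i + j - l) choose (j - l)) * a ^ (j - l)"
  have R: "((var_x + scalar a * var_y) * shear a u) $ j $ i =
      (if i = 0 then 0 else shear a u $ j $ (i - 1)) + a * (if j = 0 then 0 else shear a u $ (j - 1) $ i)"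
    by (simp add: ring_distribs var_x_mult_nth mult.assoc scalar_mult_nth var_y_mult_nth)
  show "shear a (var_x * u) $ j $ i = ((var_x + scalar a * var_y) * shear a u) $ j $ i"
  proof (cases j)
    case 0
    then show ?thesis unfolding R by (simp add: shear_nth var_x_mult_nth)
  next
    case (Suc j')
    have "(var_x * u) $ l $ (i + j - l) * of_nat ((i + j - l) choose (j - l)) * a ^ (j - l) =
      (if i = 0 then 0 else ?B (i - 1) j l) + a * ?B i j' l" if l: "l \<le> j'" for l
    proof -
      obtain t where t: "j' = l + t" using l le_Suc_ex by blast
      show ?thesis
        by (cases i) (simp_all add: t Suc var_x_mult_nth ring_distribs ac_simps)
    qed
    moreover have "(var_x * u) $ j $ (i + j - j) * of_nat ((i + j - j) choose (j - j)) * a ^ (j - j)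
        = (if i = 0 then 0 else ?B (i - 1) j j)"
      by (simp add: var_x_mult_nth)
    moreover have "shear a (var_x * u) $ j $ i =
       (\<Sum>l\<le>j'. (var_x * u) $ l $ (i + j - l) * of_nat ((i + j - l) choose (j - l)) * a ^ (j - l))
       + (var_x * u) $ j $ (i + j - j) * of_nat ((i + j - j) choose (j - j)) * a ^ (j - j)"
      by (simp add: shear_nth Suc)
    moreover have "(if i = 0 then 0 else shear a u $ j $ (i - 1)) =
       (\<Sum>l\<le>j'. if i = 0 then 0 else ?B (i - 1) j l) + (if i = 0 then 0 else ?B (i - 1) j j)"
      by (simp add: shear_nth Suc)
    moreover have "(if j = 0 then 0 else shear a u $ (j - 1) $ i) = (\<Sum>l\<le>j'. ?B i j' l)"
      by (simp add: shear_nth Suc)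
    ultimately show ?thesis
      unfolding R by (simp add: sum.distrib sum_distrib_left)
  qed
qed

lemma shear_in_order_ideal: "u \<in> order_ideal k \<Longrightarrow> shear a u \<in> order_ideal k"
  by (simp add: order_ideal_def shear_nth)

text \<open>Up to scalars, the difference of the two sides for \<open>x p + y q\<close> is a combination of the differences for
  p and q with coefficients x and y. So it lies in every power of \<open>(x, y)\<close>.\<close>

lemma shear_mult: "shear a (u * v) = shear a u * shear a v"
proof -
  have "shear a (u * v) - shear a u * shear a v \<in> order_ideal k" for k
  proof (induction k arbitrary: u)
    case (Suc k)
    obtain p q where u: "u = scalar (u $ 0 $ 0) + var_x * p + var_y * q"
      using power_series2_split[of u] by blast
    let ?D = "\<lambda>u. shear a (u * v) - shear a u * shear a v"
    have "?D (scalar c + var_x * p + var_y * q) =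
        var_x * (?D p) + var_y * (scalar a * ?D p + ?D q)" for c
      by (simp add: shear_add shear_var_x_mult shear_var_y_mult shear_scalar_mult shear_scalar
          ring_distribs mult.assoc)
    from this[of "u $ 0 $ 0"] have "?D u = var_x * (?D p) + var_y * (scalar a * ?D p + ?D q)"
      by (simp only: u[symmetric])
    moreover have "scalar a * ?D p + ?D q \<in> order_ideal k"
      using Suc[of p] Suc[of q] by (intro order_ideal_add order_ideal_lmult)
    ultimately show ?case
      using Suc[of p] unfolding order_ideal_Suc_iff by blast
  qed simp
  then show ?thesis using order_ideal_separated eq_iff_diff_eq_0 by blast
qed

lemma shear_var_y [simp]: "shear a var_y = var_y"
  using shear_var_y_mult[of a 1] by simp

lemma shear_var_x: "shear a var_x = var_x + scalar a * var_y"
  using shear_var_x_mult[of a 1] by simp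

lemma shear_power: "shear a (u ^ n) = shear a u ^ n"
  by (induction n) (simp_all add: shear_mult)

lemma shear_inverse: "shear a (shear (- a) u) = u"
proof -
  have "shear a (shear (- a) u) - u \<in> order_ideal k" for k
  proof (induction k arbitrary: u)
    case (Suc k)
    obtain p q where u: "u = scalar (u $ 0 $ 0) + var_x * p + var_y * q"
      using power_series2_split[of u] by blast
    let ?D = "\<lambda>u. shear a (shear (- a) u) - u"
    have sc: "scalar (- a) = - scalar a" by (simp add: scalar_def flip: fps_const_neg)
    have "shear a (scalar (- a) * var_y) = scalar (- a) * var_y"
      by (simp only: shear_scalar_mult shear_var_y)
    then have "shear a (var_x + scalar (- a) * var_y) = var_x"
      by (simp only: shear_add shear_var_x) (simp add: sc)
    then have "shear a (shear (- a) (var_x * p)) = var_x * shear a (shear (- a) p)"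
      by (subst shear_var_x_mult) (simp only: shear_mult)
    then have "?D (scalar c + var_x * p + var_y * q) = var_x * ?D p + var_y * ?D q" for c
      by (simp add: shear_add shear_var_y_mult shear_scalar right_diff_distrib)
    from this[of "u $ 0 $ 0"] have "?D u = var_x * ?D p + var_y * ?D q"
      by (simp only: u[symmetric])
    with Suc[of p] Suc[of q] show ?case
      unfolding order_ideal_Suc_iff by blast
  qed simp
  then show ?thesis using order_ideal_separated eq_iff_diff_eq_0 by blast
qed

section \<open>Weierstrass division\<close>

text \<open>Homogeneous of degree \<open>d\<close>.\<close>

definition form :: "nat \<Rightarrow> 'k::comm_ring_1 power_series2 \<Rightarrow> bool"
  where "form d u \<longleftrightarrow> (\<forall>i j. i + j \<noteq> d \<longrightarrow> u $ i $ j = 0)"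

lemma form_add: "form d u \<Longrightarrow> form d v \<Longrightarrow> form d (u + v)"
  by (simp add: form_def)

lemma form_mult:
  assumes "form d u" "form d' v"
  shows "form (d + d') (u * v)"
proof -
  have "u $ a $ c * v $ (i - a) $ (j - c) = 0" if "i + j \<noteq> d + d'" "a \<le> i" "c \<le> j" for i j a c
  proof (cases "a + c = d")
    case True
    then have "(i - a) + (j - c) \<noteq> d'" using that by linarith
    then show ?thesis using assms(2) by (simp add: form_def)
  qed (use assms(1) in \<open>simp add: form_def\<close>)
  then show ?thesis
    by (simp add: form_def fps_mult_nth fps_sum_nth)
qed

lemma form_var_x: "form 1 var_x" and form_var_y: "form 1 var_y"
  and form_scalar: "form 0 (scalar c)"
  by (auto simp: form_def scalar_def)

lemma form_power: "form 1 u \<Longrightarrow> form k (u ^ k)"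
proof (induction k)
  case 0
  then show ?case using form_scalar[of 1] by (simp add: scalar_def)
next
  case (Suc k)
  then show ?case using form_mult[of 1 u k "u ^ k"] by simp
qed

lemma form_order_ideal: "form d u \<Longrightarrow> u \<in> order_ideal d"
  by (simp add: form_def order_ideal_def)

lemma form_nth: "form d F \<Longrightarrow> F $ j = fps_const (F $ j $ (d - j)) * fps_X ^ (d - j)"
  if "j \<le> d"
  using that by (auto simp: form_def fps_eq_iff fps_X_power_iff) 

lemma form_nth_0: "form d F \<Longrightarrow> j > d \<Longrightarrow> F $ j = 0"
  by (simp add: form_def fps_eq_iff)

lemma form_expansion:
  assumes "form d F"
  shows "F = (\<Sum>j\<le>d. fps_const (F $ j) * var_y ^ j)"
proof (rule fps_ext)
  fix m
  have "(\<Sum>j\<le>d. fps_const (F $ j) * var_y ^ j) $ m = (\<Sum>j\<le>d. if j = m then F $ j else 0)"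
    unfolding fps_sum_nth var_y_def by (intro sum.cong) (auto simp: fps_X_power_iff)
  then show "F $ m = (\<Sum>j\<le>d. fps_const (F $ j) * var_y ^ j) $ m"
    using form_nth_0[OF assms, of m] by (cases "m \<le> d") (simp_all add: sum.delta)
qed

text \<open>The coefficient of \<open>x^l y^m\<close> in the quotient of u by F. Comparing the coefficients of
  \<open>x^l y^(m + d)\<close> in u and in F times the quotient determines it from coefficients with a smaller
  exponent of x, because all terms of the form F except that in \<open>y^d\<close> contain x.\<close>

function weierstrass_coeff :: "nat \<Rightarrow> 'k::field power_series2 \<Rightarrow> 'k power_series2 \<Rightarrow> nat \<Rightarrow> nat \<Rightarrow> 'k"
  where "weierstrass_coeff d F u m l = (u $ (m + d) $ l -
     (\<Sum>j\<in>{j. j < d \<and> d - j \<le> l}. F $ j $ (d - j) * weierstrass_coeff d F u (m + d - j) (l - (d - j)))) / F $ d $ 0"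
  by pat_completeness auto
termination
  by (relation "measure (\<lambda>(d, F, u, m, l). l)") auto

declare weierstrass_coeff.simps [simp del]

lemma weierstrass_division:
  fixes F u :: "'k::field power_series2"
  assumes F: "form d F" and lead: "F $ d $ 0 \<noteq> 0"
  obtains q c where "u = F * q + (\<Sum>i<d. fps_const (c i) * var_y ^ i)"
proof -
  define q where "q = Abs_fps (\<lambda>m. Abs_fps (weierstrass_coeff d F u m))"
  have Fm: "(F * q) $ (m + d) = u $ (m + d)" for m
  proof (rule fps_ext)
    fix l
    have "(F * q) $ (m + d) = (\<Sum>j\<le>m + d. F $ j * q $ (m + d - j))"
      by (simp add: fps_mult_nth atLeast0AtMost)
    also have "\<dots> = (\<Sum>j\<le>d. F $ j * q $ (m + d - j))"
      using form_nth_0[OF F] by (intro sum.mono_neutral_right) auto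
    also have "\<dots> = (\<Sum>j\<le>d. fps_const (F $ j $ (d - j)) * (fps_X ^ (d - j) * q $ (m + d - j)))"
      using form_nth[OF _ F] by (intro sum.cong) (simp_all flip: mult.assoc)
    finally have "(F * q) $ (m + d) $ l =
        (\<Sum>j\<le>d. F $ j $ (d - j) * (if l < d - j then 0 else q $ (m + d - j) $ (l - (d - j))))"
      by (simp add: fps_sum_nth fps_X_power_mult_nth)
    also have "\<dots> = (\<Sum>j<d. F $ j $ (d - j) * (if l < d - j then 0 else q $ (m + d - j) $ (l - (d - j))))
        + F $ d $ 0 * q $ m $ l"
      by (simp add: lessThan_Suc_atMost[symmetric])
    also have "(\<Sum>j<d. F $ j $ (d - j) * (if l < d - j then 0 else q $ (m + d - j) $ (l - (d - j)))) =
       (\<Sum>j\<in>{j. j < d \<and> d - j \<le> l}. F $ j $ (d - j) * weierstrass_coeff d F u (m + d - j) (l - (d - j)))"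
      by (intro sum.mono_neutral_cong_right) (auto simp: q_def)
    also have "F $ d $ 0 * q $ m $ l = u $ (m + d) $ l -
       (\<Sum>j\<in>{j. j < d \<and> d - j \<le> l}. F $ j $ (d - j) * weierstrass_coeff d F u (m + d - j) (l - (d - j)))"
      using lead by (simp add: q_def weierstrass_coeff.simps[of d F u m l])
    finally show "(F * q) $ (m + d) $ l = u $ (m + d) $ l" by simp
  qed
  have "u - F * q = (\<Sum>i<d. fps_const ((u - F * q) $ i) * var_y ^ i)"
  proof (rule fps_ext)
    fix m
    have "(\<Sum>i<d. fps_const ((u - F * q) $ i) * var_y ^ i) $ m = (\<Sum>i<d. if i = m then (u - F * q) $ i else 0)"
      unfolding fps_sum_nth var_y_def by (intro sum.cong) (auto simp: fps_X_power_iff)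
    moreover have "(u - F * q) $ m = 0" if "m \<ge> d"
      using Fm[of "m - d"] that by simp
    ultimately show "(u - F * q) $ m = (\<Sum>i<d. fps_const ((u - F * q) $ i) * var_y ^ i) $ m"
      by (cases "m < d") simp_all
  qed
  then have "u = F * q + (\<Sum>i<d. fps_const ((u - F * q) $ i) * var_y ^ i)"
    by (metis add.commute diff_add_cancel)
  then show ?thesis by (rule that)
qed

section \<open>Algebraic relations over k[[x]]\<close>

text \<open>Elimination with a pivot \<open>v p d\<close>, without division: the vectors \<open>v p d * v j - v j d * v p\<close> have last
  coordinate 0.\<close>

lemma linear_dependence:
  fixes v :: "nat \<Rightarrow> nat \<Rightarrow> 'a::idom"
  shows "\<exists>c. (\<exists>j\<le>d. c j \<noteq> 0) \<and> (\<forall>i<d. (\<Sum>j\<le>d. c j * v j i) = 0)"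
proof (induction d arbitrary: v)
  case 0
  show ?case by (rule exI[of _ "\<lambda>_. 1"]) simp
next
  case (Suc d)
  show ?case
  proof (cases "\<exists>p\<le>Suc d. v p d \<noteq> 0")
    case False
    obtain c where c: "\<exists>j\<le>d. c j \<noteq> 0" "\<forall>i<d. (\<Sum>j\<le>d. c j * v j i) = 0"
      using Suc.IH[of v] by blast
    let ?c = "\<lambda>j. if j \<le> d then c j else 0"
    have "(\<Sum>j\<le>Suc d. ?c j * v j i) = 0" if "i < Suc d" for i
    proof (cases "i = d")
      case True
      then show ?thesis using False by (intro sum.neutral) auto
    next
      case neq: False
      then have "i < d" using that by simp
      have "(\<Sum>j\<le>Suc d. ?c j * v j i) = (\<Sum>j\<le>d. ?c j * v j i)" by simp
      also have "\<dots> = (\<Sum>j\<le>d. c j * v j i)" by (intro sum.cong) auto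
      finally show ?thesis using c(2) \<open>i < d\<close> by simp
    qed
    moreover have "\<exists>j\<le>Suc d. ?c j \<noteq> 0" using c(1) le_Suc_eq by auto
    ultimately show ?thesis by (intro exI[of _ ?c]) blast
  next
    case True
    then obtain p where p: "p \<le> Suc d" "v p d \<noteq> 0" by blast
    let ?s = "\<lambda>j. if j < p then j else Suc j"
    have bij: "bij_betw ?s {..d} ({..Suc d} - {p})"
      using p(1) by (intro bij_betw_byWitness[of _ "\<lambda>j. if j < p then j else j - 1"]) auto
    obtain c where c: "\<exists>j\<le>d. c j \<noteq> 0"
      "\<forall>i<d. (\<Sum>j\<le>d. c j * (v p d * v (?s j) i - v (?s j) d * v p i)) = 0"
      using Suc.IH[of "\<lambda>j i. v p d * v (?s j) i - v (?s j) d * v p i"] by blast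
    define b where "b = (\<lambda>j. if j = p then - (\<Sum>j\<le>d. c j * v (?s j) d)
        else v p d * c (if j < p then j else j - 1))"
    have b_s: "b (?s j) = v p d * c j" for j by (auto simp: b_def)
    have split: "(\<Sum>j\<le>Suc d. b j * v j i) = b p * v p i + (\<Sum>j\<le>d. b (?s j) * v (?s j) i)" for i
    proof -
      have "(\<Sum>j\<le>Suc d. b j * v j i) = b p * v p i + (\<Sum>j\<in>{..Suc d} - {p}. b j * v j i)"
        using p(1) by (intro sum.remove) auto
      also have "(\<Sum>j\<in>{..Suc d} - {p}. b j * v j i) = (\<Sum>j\<le>d. b (?s j) * v (?s j) i)"
        by (rule sum.reindex_bij_betw[OF bij, symmetric])
      finally show ?thesis .
    qed
    have "(\<Sum>j\<le>Suc d. b j * v j i) = 0" if "i < Suc d" for i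
    proof -
      have "(\<Sum>j\<le>Suc d. b j * v j i) =
          (\<Sum>j\<le>d. c j * (v p d * v (?s j) i - v (?s j) d * v p i))"
        unfolding split b_s
        by (simp add: b_def right_diff_distrib sum_subtractf sum_distrib_left sum_distrib_right
            mult.assoc mult.left_commute[of "v p d"] mult.commute[of "v p i"])
      then show ?thesis
        using c(2) that by (cases "i = d") (auto simp: less_Suc_eq)
    qed
    moreover have "\<exists>j\<le>Suc d. b j \<noteq> 0"
    proof -
      obtain j where j: "j \<le> d" "c j \<noteq> 0" using c(1) by blast
      then have "b (?s j) \<noteq> 0" "?s j \<le> Suc d" using p(2) b_s by auto
      then show ?thesis by blast
    qed
    ultimately show ?thesis by blast
  qed
qed

lemma fps_const_sum: "fps_const (\<Sum>i\<in>A. g i) = (\<Sum>i\<in>A. fps_const (g i))"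
  by (simp add: fps_eq_iff fps_sum_nth sum.neutral)

lemma fps_divides_power:
  fixes c :: "'k::field fps"
  assumes "c \<noteq> 0"
  obtains b N where "c * b = fps_X ^ N"
proof
  let ?u = "fps_shift (subdegree c) c"
  have "?u $ 0 \<noteq> 0" using assms by simp
  then have "?u * inverse ?u = 1" by (simp add: inverse_mult_eq_1')
  moreover have "c = ?u * fps_X ^ subdegree c" by (rule subdegree_decompose)
  moreover have "?u * fps_X ^ subdegree c * inverse ?u = ?u * inverse ?u * fps_X ^ subdegree c"
    by (rule mult.commute[THEN trans]) (simp add: ac_simps)
  ultimately show "c * inverse ?u = fps_X ^ subdegree c"
    by simp
qed

lemma fps_const_X_power: "fps_const (fps_X ^ N) = var_x ^ N"
  by (simp add: var_x_def)

text \<open>Modulo F the ring is spanned by d elements over \<open>k[[x]]\<close>, so the powers \<open>1, u, ..., u^d\<close> are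
  linearly dependent, and the lowest nonzero coefficient of a relation is a unit times a power of x. This
  relation takes the place of dimension theory: whenever u is regular, a power of x is a multiple
  of u modulo F.\<close>

lemma power_relation:
  fixes F u :: "'k::field power_series2"
  assumes F: "form d F" and lead: "F $ d $ 0 \<noteq> 0"
  shows "\<exists>i N r. F dvd u ^ i * (var_x ^ N + u * r)"
proof -
  have "\<exists>q c. u ^ j = F * q + (\<Sum>i<d. fps_const (c i) * var_y ^ i)" for j
    by (rule weierstrass_division[OF F lead, of "u ^ j"]) blast
  then obtain q c where qc: "\<And>j. u ^ j = F * q j + (\<Sum>i<d. fps_const (c j i) * var_y ^ i)"
    by metis
  obtain b where b: "\<exists>j\<le>d. b j \<noteq> 0" "\<forall>i<d. (\<Sum>j\<le>d. b j * c j i) = 0"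
    using linear_dependence[of d c] by blast
  have "(\<Sum>j\<le>d. fps_const (b j) * u ^ j) = F * (\<Sum>j\<le>d. fps_const (b j) * q j)"
  proof -
    have "fps_const (b j) * u ^ j = F * (fps_const (b j) * q j) +
        (\<Sum>i<d. fps_const (b j * c j i) * var_y ^ i)" for j
    proof -
      have "fps_const (b j) * u ^ j =
          fps_const (b j) * (F * q j) + (\<Sum>i<d. fps_const (b j) * (fps_const (c j i) * var_y ^ i))"
        unfolding qc[of j] by (simp only: distrib_left sum_distrib_left)
      then show ?thesis by (simp only: mult.assoc[symmetric] fps_const_mult mult.commute[of "fps_const (b j)" F])
    qed
    then have "(\<Sum>j\<le>d. fps_const (b j) * u ^ j) = (\<Sum>j\<le>d. F * (fps_const (b j) * q j)) +
        (\<Sum>j\<le>d. \<Sum>i<d. fps_const (b j * c j i) * var_y ^ i)"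
      by (simp only: sum.distrib)
    also have "(\<Sum>j\<le>d. \<Sum>i<d. fps_const (b j * c j i) * var_y ^ i) =
        (\<Sum>i<d. fps_const (\<Sum>j\<le>d. b j * c j i) * var_y ^ i)"
      by (subst sum.swap) (simp only: sum_distrib_right fps_const_sum)
    finally show ?thesis using b(2) by (simp add: sum_distrib_left)
  qed
  then have dvd: "F dvd (\<Sum>j\<le>d. fps_const (b j) * u ^ j)" by simp
  define l where "l = (LEAST j. b j \<noteq> 0)"
  have l: "l \<le> d" "b l \<noteq> 0" "\<And>j. j < l \<Longrightarrow> b j = 0"
    using b(1) LeastI[of "\<lambda>j. b j \<noteq> 0"] Least_le[of "\<lambda>j. b j \<noteq> 0"] not_less_Least[of _ "\<lambda>j. b j \<noteq> 0"]
    unfolding l_def by (blast intro: order_trans)+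
  define r where "r = (\<Sum>j\<in>{l<..d}. fps_const (b j) * u ^ (j - l - 1))"
  have "(\<Sum>j\<le>d. fps_const (b j) * u ^ j) = (\<Sum>j\<in>{l..d}. fps_const (b j) * u ^ j)"
    using l(3) by (intro sum.mono_neutral_right) auto
  also have "\<dots> = fps_const (b l) * u ^ l + (\<Sum>j\<in>{l<..d}. fps_const (b j) * u ^ j)"
    using l(1) by (simp add: sum.head)
  also have "(\<Sum>j\<in>{l<..d}. fps_const (b j) * u ^ j) = u ^ l * (u * r)"
    unfolding r_def sum_distrib_left
  proof (rule sum.cong)
    fix j assume "j \<in> {l<..d}"
    then have "j = l + Suc (j - l - 1)" by simp
    then have "u ^ j = u ^ (l + Suc (j - l - 1))" by simp
    then have "u ^ j = u ^ l * (u * u ^ (j - l - 1))" by (simp only: power_add power_Suc)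
    then show "fps_const (b j) * u ^ j = u ^ l * (u * (fps_const (b j) * u ^ (j - l - 1)))"
      by (simp add: ac_simps)
  qed simp
  finally have dvd': "F dvd u ^ l * (fps_const (b l) + u * r)"
    using dvd by (simp add: ring_distribs ac_simps)
  obtain b' N where b': "b l * b' = fps_X ^ N" using fps_divides_power[OF l(2)] .
  have "u ^ l * (fps_const (b l) + u * r) * fps_const b' = u ^ l * (var_x ^ N + u * (r * fps_const b'))"
    by (simp add: ring_distribs mult.assoc b' fps_const_X_power)
  then have "F dvd u ^ l * (var_x ^ N + u * (r * fps_const b'))"
    using dvd_mult2[OF dvd', of "fps_const b'"] by (simp only:)
  then show ?thesis by blast
qed

section \<open>Hypersurfaces defined by a form\<close>

text \<open>The last condition says that \<open>f(-a, 1)\<close> is not 0, in other words that the linear form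
  \<open>x + a y\<close> does not divide f.\<close>

locale hypersurface =
  fixes f :: "'k::field power_series2" and d :: nat and a :: 'k
  assumes form_f: "form d f" and d_ge_2: "d \<ge> 2"
    and lead: "shear (- a) f $ d $ 0 \<noteq> 0"
begin

definition z :: "'k power_series2" where "z = var_x + scalar a * var_y"

abbreviation F :: "'k power_series2" where "F \<equiv> shear (- a) f"

lemma form_shear: "form k u \<Longrightarrow> form k (shear b u)"
  by (auto simp: form_def shear_nth)

lemma form_F: "form d F" by (rule form_shear) (rule form_f)

lemma shear_F: "shear a F = f" by (rule shear_inverse)

lemma shear_x: "shear a var_x = z" by (simp add: z_def shear_var_x)

lemma shear_inverse': "shear (- a) (shear a u) = u"
  using shear_inverse[of "- a"] by simp

lemma shear_z: "shear (- a) z = var_x"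
  unfolding shear_x[symmetric] by (rule shear_inverse')

lemma shear_dvd: "F dvd shear (- a) u \<longleftrightarrow> f dvd u"
proof
  assume "F dvd shear (- a) u"
  then obtain q where "shear (- a) u = F * q" by (rule dvdE)
  from arg_cong[OF this, of "shear a"] have "u = f * shear a q"
    by (simp only: shear_mult shear_inverse)
  then show "f dvd u" by (rule dvdI)
qed (auto simp: shear_mult elim: dvdE)

lemma z_in_order_ideal: "z \<in> order_ideal 1"
  unfolding z_def
  by (intro order_ideal_add order_ideal_lmult var_x_in_order_ideal var_y_in_order_ideal)

lemma f_in_order_ideal: "f \<in> order_ideal d"
  using form_f by (rule form_order_ideal)

lemma f_nonzero: "f \<noteq> 0" using lead by auto

lemma mod_x_F: "mod_x F = fps_const (F $ d $ 0) * fps_X ^ d"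
  using form_F by (auto simp: fps_eq_iff form_def fps_X_power_iff)

lemma z_power_relation: "\<exists>i N r. f dvd u ^ i * (z ^ N + u * r)"
proof -
  obtain i N r where "F dvd shear (- a) u ^ i * (var_x ^ N + shear (- a) u * r)"
    using power_relation[OF form_F lead] by blast
  then obtain k where "shear (- a) u ^ i * (var_x ^ N + shear (- a) u * r) = F * k" by (rule dvdE)
  from arg_cong[OF this, of "shear a"]
  have "u ^ i * (z ^ N + u * shear a r) = f * shear a k"
    by (simp add: shear_mult shear_add shear_power shear_inverse shear_x)
  then have "f dvd u ^ i * (z ^ N + u * shear a r)" by (rule dvdI)
  then show ?thesis by blast
qed

text \<open>Modulo \<open>(f, z)\<close> the ring becomes \<open>k[y] / (y^d)\<close>. After the coordinate change a multiple of F
  removes from u all terms without x.\<close>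

lemma order_ideal_reduction:
  assumes "u \<in> order_ideal d"
  obtains v where "v \<in> order_ideal (d - 1)" "f dvd u - z * v"
proof -
  let ?u = "shear (- a) u"
  have u: "?u \<in> order_ideal d" using assms by (rule shear_in_order_ideal)
  define v where "v = Abs_fps (\<lambda>j. fps_const (?u $ (j + d) $ 0 / F $ d $ 0))"
  have "mod_x (?u - F * v) = 0"
  proof (rule fps_ext)
    fix j
    have "mod_x (F * v) $ j = (if j < d then 0 else ?u $ j $ 0)"
      using lead by (simp add: mod_x_mult mod_x_F mult.assoc fps_X_power_mult_nth v_def)
    then show "mod_x (?u - F * v) $ j = 0 $ j"
      using u by (simp add: mod_x_diff order_ideal_def)
  qed
  then obtain w where w: "?u - F * v = var_x * w" by (auto simp: mod_x_eq_0_iff elim: dvdE)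
  have "var_x * w \<in> order_ideal d"
    unfolding w[symmetric] using u form_order_ideal[OF form_F]
    by (intro order_ideal_diff order_ideal_rmult)
  then have "w $ i $ j = 0" if "i + j < d - 1" for i j
  proof -
    have "i + Suc j < d" using that by linarith
    then have "(var_x * w) $ i $ Suc j = 0"
      using \<open>var_x * w \<in> order_ideal d\<close> by (simp only: order_ideal_def mem_Collect_eq)
    then show ?thesis by (simp add: var_x_mult_nth)
  qed
  then have "w \<in> order_ideal (d - 1)" by (simp add: order_ideal_def)
  then have "shear a w \<in> order_ideal (d - 1)" by (rule shear_in_order_ideal)
  moreover
  have "u - z * shear a w = f * shear a v"
    using arg_cong[OF w, of "shear a"]
    by (simp add: shear_diff shear_mult shear_inverse shear_x algebra_simps)
  then have "f dvd u - z * shear a w" by (rule dvdI)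
  ultimately show ?thesis by (rule that)
qed

lemma z_regular:
  assumes "f dvd z * u"
  shows "f dvd u"
proof -
  have "F dvd shear (- a) (z * u)" using assms by (simp only: shear_dvd)
  then obtain q where q: "var_x * shear (- a) u = F * q" by (auto simp: shear_mult shear_z elim: dvdE)
  have "\<not> var_x dvd F"
    using lead by (simp flip: mod_x_eq_0_iff add: mod_x_F)
  moreover have "var_x dvd F * q" by (simp flip: q)
  ultimately have "var_x dvd q"
    using prime_elem_var_x prime_elem_dvd_multD by blast
  then obtain q' where "q = var_x * q'" by (rule dvdE)
  then have "var_x * shear (- a) u = var_x * (F * q')" using q by (simp add: ac_simps)
  then have "shear (- a) u = F * q'"
    by (subst (asm) mult_left_cancel) (simp_all add: prime_elem_not_zeroI[OF prime_elem_var_x])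
  then have "F dvd shear (- a) u" by simp
  then show ?thesis by (simp only: shear_dvd)
qed

lemma partials:
  obtains g h where "g \<in> order_ideal (d - 1)" "h \<in> order_ideal (d - 1)"
    "f = var_x * g + var_y * h"
proof -
  have "f \<in> order_ideal (Suc (d - 1))" using f_in_order_ideal d_ge_2 by simp
  then obtain g h where "g \<in> order_ideal (d - 1)" "h \<in> order_ideal (d - 1)"
    "f = var_x * g + var_y * h"
    by (auto simp only: order_ideal_Suc_iff)
  then show ?thesis by (rule that)
qed

text \<open>If \<open>(x, y)^(d - 1)\<close> were contained in \<open>(w, f)\<close>, then \<open>f = x g + y h\<close> with g and h of order
  \<open>d - 1\<close> would lie in \<open>(w) + (x, y) f\<close>. By Nakayama's lemma w would divide f, and then both
  \<open>x^(d - 1)\<close> and \<open>y^(d - 1)\<close>.\<close>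

lemma no_short_power:
  assumes w: "w \<in> order_ideal 1"
    and sub: "\<And>u. u \<in> order_ideal (d - 1) \<Longrightarrow> \<exists>p. f dvd u - w * p"
  shows False
proof -
  have dec: "\<exists>p s. u = w * p + f * s" if u: "u \<in> order_ideal (d - 1)" for u
  proof -
    obtain p where "f dvd u - w * p" using sub[OF u] by blast
    then obtain s where "u - w * p = f * s" by (rule dvdE)
    then have "u = w * p + f * s" by (simp add: diff_eq_eq add.commute)
    then show ?thesis by blast
  qed
  obtain g h where gh: "g \<in> order_ideal (d - 1)" "h \<in> order_ideal (d - 1)"
    and f: "f = var_x * g + var_y * h" by (rule partials)
  obtain p s where g: "g = w * p + f * s" using dec[OF gh(1)] by blast
  obtain q t where h: "h = w * q + f * t" using dec[OF gh(2)] by blast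
  (* The unit in Nakayama's lemma. *)
  let ?e = "1 - (var_x * s + var_y * t)"
  have "f * ?e = w * (var_x * p + var_y * q)"
  proof -
    have "f = w * (var_x * p + var_y * q) + f * (var_x * s + var_y * t)"
      by (subst f, subst g, subst h) (simp add: algebra_simps)
    then show ?thesis by (simp add: right_diff_distrib diff_eq_eq)
  qed
  then have "w dvd f * ?e" by (rule dvdI)
  moreover have "?e \<notin> order_ideal 1"
    by (simp add: order_ideal_def fps_mult_nth_0)
  then have "?e dvd 1" by (rule unit_power_series2)
  then obtain e' where "1 = ?e * e'" by (rule dvdE)
  then have "f = f * ?e * e'" by (metis mult.assoc mult_1_right)
  ultimately have "w dvd f"
    using dvd_mult2 by metis
  have dvd: "w dvd u" if u: "u \<in> order_ideal (d - 1)" for u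
  proof -
    obtain p s where "u = w * p + f * s" using dec[OF u] by blast
    then show ?thesis using \<open>w dvd f\<close> by simp
  qed
  have "w dvd var_x ^ (d - 1)" "w dvd var_y ^ (d - 1)"
    by (intro dvd power_in_order_ideal var_x_in_order_ideal var_y_in_order_ideal)+
  then have "w dvd 1" by (rule not_both_powers)
  then show False using not_unit_order_ideal[OF w] by blast
qed

text \<open>After the coordinate change, and modulo x, both f and r become multiples of \<open>y^d\<close>.\<close>

lemma y_power_not_in_ideal:
  assumes "r \<in> order_ideal d"
  shows "\<not> f dvd var_y ^ (d - 1) - z * p - r"
proof
  assume "f dvd var_y ^ (d - 1) - z * p - r"
  then obtain q where q: "var_y ^ (d - 1) - z * p - r = f * q" by (rule dvdE)
  have "shear (- a) (var_y ^ (d - 1) - z * p - r) =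
      var_y ^ (d - 1) - var_x * shear (- a) p - shear (- a) r"
    by (simp only: shear_diff shear_mult shear_z shear_power shear_var_y)
  moreover have "mod_x (shear (- a) r) $ (d - 1) = 0"
    using shear_in_order_ideal[OF assms, of "- a"] d_ge_2 by (simp add: order_ideal_def)
  ultimately have "mod_x (shear (- a) (var_y ^ (d - 1) - z * p - r)) $ (d - 1) = 1"
    by (simp add: mod_x_diff mod_x_mult mod_x_power del: mod_x_nth)
  moreover have "mod_x (shear (- a) (f * q)) $ (d - 1) = 0"
    using d_ge_2 by (simp add: shear_mult mod_x_mult mod_x_F mult.assoc fps_X_power_mult_nth del: mod_x_nth)
  ultimately show False unfolding q by simp
qed

end

section \<open>Quotient modules\<close>

locale plain_module = Module.module R M
  for R :: "'a ring" (structure) and M :: "('a, 'b) module" (structure)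
begin

lemma submodule_abelian_subgroup: "submodule N R M \<Longrightarrow> abelian_subgroup N M"
  by (intro abelian_subgroupI3 additive_subgroup.intro submodule.axioms(1) M.abelian_group_axioms)

lemma submodule_diff: "submodule N R M \<Longrightarrow> v \<in> N \<Longrightarrow> w \<in> N \<Longrightarrow> v \<ominus>\<^bsub>M\<^esub> w \<in> N"
  using submoduleE(3,5) by (simp add: a_minus_def)

lemma submodule_zero: "submodule N R M \<Longrightarrow> \<zero>\<^bsub>M\<^esub> \<in> N"
  using additive_subgroup.zero_closed abelian_subgroup.axioms(1) submodule_abelian_subgroup by blast

lemma coset_eq_iff:
  assumes "submodule N R M" "v \<in> carrier M" "w \<in> carrier M"
  shows "N +>\<^bsub>M\<^esub> v = N +>\<^bsub>M\<^esub> w \<longleftrightarrow> v \<ominus>\<^bsub>M\<^esub> w \<in> N"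
proof -
  interpret N: abelian_subgroup N M using assms(1) by (rule submodule_abelian_subgroup)
  have sub: "subgroup N (add_monoid M)" using assms(1) by (rule submodule.axioms(1))
  show ?thesis
  proof
    assume "N +>\<^bsub>M\<^esub> v = N +>\<^bsub>M\<^esub> w"
    then have "N +>\<^bsub>M\<^esub> (v \<ominus>\<^bsub>M\<^esub> w) = N"
      using M.a_coset_add_inv2[of N v w] assms N.a_subset by (simp add: a_minus_def)
    then show "v \<ominus>\<^bsub>M\<^esub> w \<in> N"
      using M.a_coset_join1[of N "v \<ominus>\<^bsub>M\<^esub> w"] sub assms by simp
  next
    assume "v \<ominus>\<^bsub>M\<^esub> w \<in> N"
    then have "N +>\<^bsub>M\<^esub> (v \<ominus>\<^bsub>M\<^esub> w) = N"
      by (rule N.a_rcos_const)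
    then show "N +>\<^bsub>M\<^esub> v = N +>\<^bsub>M\<^esub> w"
      using M.a_coset_add_inv1[of N v w] assms N.a_subset by (simp add: a_minus_def)
  qed
qed

lemma coset_eq_self_iff:
  assumes "submodule N R M" "v \<in> carrier M"
  shows "N +>\<^bsub>M\<^esub> v = N \<longleftrightarrow> v \<in> N"
proof -
  have "N \<subseteq> carrier M" using submoduleE(1)[OF assms(1)] .
  then have "N +>\<^bsub>M\<^esub> \<zero>\<^bsub>M\<^esub> = N" by simp
  moreover have m: "\<ominus>\<^bsub>M\<^esub> \<zero>\<^bsub>M\<^esub> = \<zero>\<^bsub>M\<^esub>"
    using M.l_neg[of "\<zero>\<^bsub>M\<^esub>"] by simp
  have "v \<ominus>\<^bsub>M\<^esub> \<zero>\<^bsub>M\<^esub> = v"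
    unfolding a_minus_def m using assms(2) by simp
  ultimately show ?thesis using coset_eq_iff[OF assms M.zero_closed] by simp
qed

lemma quotient_carrier: "carrier (quotient_module M N) = (\<lambda>v. N +>\<^bsub>M\<^esub> v) ` carrier M"
  by (auto simp: quotient_module_def A_RCOSETS_def')

lemma quotient_zero: "\<zero>\<^bsub>quotient_module M N\<^esub> = N"
  by (simp add: quotient_module_def)

lemma quotient_add:
  assumes "submodule N R M" "v \<in> carrier M" "w \<in> carrier M"
  shows "(N +>\<^bsub>M\<^esub> v) \<oplus>\<^bsub>quotient_module M N\<^esub> (N +>\<^bsub>M\<^esub> w) = N +>\<^bsub>M\<^esub> (v \<oplus>\<^bsub>M\<^esub> w)"
  using abelian_subgroup.a_rcos_sum[OF submodule_abelian_subgroup[OF assms(1)]] assms(2,3)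
  by (simp add: quotient_module_def)

lemma quotient_smult:
  assumes N: "submodule N R M" and r: "r \<in> carrier R" and v: "v \<in> carrier M"
  shows "r \<odot>\<^bsub>quotient_module M N\<^esub> (N +>\<^bsub>M\<^esub> v) = N +>\<^bsub>M\<^esub> (r \<odot>\<^bsub>M\<^esub> v)"
proof -
  interpret N: abelian_subgroup N M using N by (rule submodule_abelian_subgroup)
  have "N +>\<^bsub>M\<^esub> (r \<odot>\<^bsub>M\<^esub> w) = N +>\<^bsub>M\<^esub> (r \<odot>\<^bsub>M\<^esub> v)" if w: "w \<in> N +>\<^bsub>M\<^esub> v" for w
  proof -
    obtain t where t: "t \<in> N" "w = t \<oplus>\<^bsub>M\<^esub> v" using w by (auto simp: a_r_coset_def')
    have tc: "t \<in> carrier M" using t(1) N.a_subset by blast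
    have "r \<odot>\<^bsub>M\<^esub> w \<ominus>\<^bsub>M\<^esub> r \<odot>\<^bsub>M\<^esub> v = r \<odot>\<^bsub>M\<^esub> t"
      using tc v r by (simp add: t(2) smult_r_distr a_minus_def M.a_assoc M.r_neg)
    then show ?thesis
      using coset_eq_iff[OF N] tc v r t submoduleE(4)[OF N r t(1)] by simp
  qed
  then have "\<forall>w\<in>N +>\<^bsub>M\<^esub> v. N +>\<^bsub>M\<^esub> (r \<odot>\<^bsub>M\<^esub> w) = N +>\<^bsub>M\<^esub> (r \<odot>\<^bsub>M\<^esub> v)"
    by (rule ballI)
  with N.a_rcos_self[OF v]
  have "(\<Union>w\<in>N +>\<^bsub>M\<^esub> v. N +>\<^bsub>M\<^esub> (r \<odot>\<^bsub>M\<^esub> w)) = N +>\<^bsub>M\<^esub> (r \<odot>\<^bsub>M\<^esub> v)"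
    by (rule UN_constant_eq)
  then show ?thesis by (simp add: quotient_module_def)
qed

lemma quotient_is_module:
  assumes N: "submodule N R M"
  shows "Module.module R (quotient_module M N)"
proof (rule moduleI)
  have "N +>\<^bsub>M\<^esub> \<zero>\<^bsub>M\<^esub> = N"
    using submodule_zero[OF N] by (simp add: coset_eq_self_iff[OF N])
  then have zero: "\<zero>\<^bsub>quotient_module M N\<^esub> = N +>\<^bsub>M\<^esub> \<zero>\<^bsub>M\<^esub>" by (simp add: quotient_zero)
  show "abelian_group (quotient_module M N)"
  proof (rule abelian_groupI)
    show "\<exists>y\<in>carrier (quotient_module M N). y \<oplus>\<^bsub>quotient_module M N\<^esub> x = \<zero>\<^bsub>quotient_module M N\<^esub>"
      if x: "x \<in> carrier (quotient_module M N)" for x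
    proof -
      obtain v where v: "v \<in> carrier M" "x = N +>\<^bsub>M\<^esub> v" using x by (auto simp: quotient_carrier)
      then have "(N +>\<^bsub>M\<^esub> \<ominus>\<^bsub>M\<^esub> v) \<oplus>\<^bsub>quotient_module M N\<^esub> x = \<zero>\<^bsub>quotient_module M N\<^esub>"
        by (simp add: quotient_add[OF N] zero M.l_neg)
      then show ?thesis using v(1) by (auto simp: quotient_carrier)
    qed
    show "\<zero>\<^bsub>quotient_module M N\<^esub> \<in> carrier (quotient_module M N)"
      unfolding zero quotient_carrier by blast
    show "\<zero>\<^bsub>quotient_module M N\<^esub> \<oplus>\<^bsub>quotient_module M N\<^esub> x = x"
      if "x \<in> carrier (quotient_module M N)" for x
      using that unfolding zero by (auto simp: quotient_carrier quotient_add[OF N])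
  qed (auto simp: quotient_carrier quotient_add[OF N] M.a_ac)
qed (auto simp: quotient_carrier quotient_add quotient_smult N R.is_cring
    smult_l_distr smult_r_distr smult_assoc1)

end

section \<open>Regular sequences and depth\<close>

context plain_module
begin

definition scaled :: "'a \<Rightarrow> 'b set" where "scaled u = (\<lambda>v. u \<odot>\<^bsub>M\<^esub> v) ` carrier M"

lemma scaled_submodule:
  assumes u: "u \<in> carrier R"
  shows "submodule (scaled u) R M"
proof (rule submoduleI)
  show "scaled u \<subseteq> carrier M" using u by (auto simp: scaled_def)
  show "\<zero>\<^bsub>M\<^esub> \<in> scaled u" using u by (force simp: scaled_def)
  show "\<ominus>\<^bsub>M\<^esub> v \<in> scaled u" if "v \<in> scaled u" for v
    using that u by (auto simp: scaled_def simp flip: smult_r_minus)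
  show "v \<oplus>\<^bsub>M\<^esub> w \<in> scaled u" if "v \<in> scaled u" "w \<in> scaled u" for v w
    using that u by (auto simp: scaled_def simp flip: smult_r_distr)
  show "r \<odot>\<^bsub>M\<^esub> v \<in> scaled u" if r: "r \<in> carrier R" and v: "v \<in> scaled u" for r v
  proof -
    obtain w where w: "w \<in> carrier M" "v = u \<odot>\<^bsub>M\<^esub> w" using v by (auto simp: scaled_def)
    have "r \<odot>\<^bsub>M\<^esub> v = u \<odot>\<^bsub>M\<^esub> (r \<odot>\<^bsub>M\<^esub> w)"
      using r u w by (simp add: R.m_comm flip: smult_assoc1)
    then show ?thesis using r w by (auto simp: scaled_def)
  qed
qed

lemma zero_submodule: "submodule {\<zero>\<^bsub>M\<^esub>} R M"
  by (rule submoduleI) auto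

lemma span_submodule:
  assumes "S \<subseteq> carrier M"
  shows "submodule (submodule_span R M S) R M"
proof (rule submoduleI)
  let ?A = "{N. submodule N R M \<and> S \<subseteq> N}"
  have "carrier M \<in> ?A" using assms carrier_is_submodule by blast
  then show "submodule_span R M S \<subseteq> carrier M" by (auto simp: submodule_span_def)
qed (auto simp: submodule_span_def submodule_zero submoduleE)

lemma span_minimal: "submodule N R M \<Longrightarrow> S \<subseteq> N \<Longrightarrow> submodule_span R M S \<subseteq> N"
  by (auto simp: submodule_span_def)

lemma span_superset: "S \<subseteq> submodule_span R M S"
  by (auto simp: submodule_span_def)

abbreviation multiples :: "'a list \<Rightarrow> 'b set"
  where "multiples xs \<equiv> submodule_span R M {r \<odot>\<^bsub>M\<^esub> v |r v. r \<in> set xs \<and> v \<in> carrier M}"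

lemma multiples_submodule: "set xs \<subseteq> carrier R \<Longrightarrow> submodule (multiples xs) R M"
  by (rule span_submodule) auto

lemma span_empty: "submodule_span R M {} = {\<zero>\<^bsub>M\<^esub>}"
  using span_minimal[OF zero_submodule, of "{}"] submodule_zero[OF span_submodule[of "{}"]]
  by auto

lemma span_multiples: "u \<in> carrier R \<Longrightarrow> submodule_span R M {u \<odot>\<^bsub>M\<^esub> v |v. v \<in> carrier M} = scaled u"
  using span_minimal[OF scaled_submodule, of u "scaled u"] span_superset[of "scaled u"]
  by (auto simp: scaled_def Setcompr_eq_image)

lemma scaled_subset_multiples: "scaled u \<subseteq> multiples (u # xs)"
  by (rule order_trans[OF _ span_superset]) (auto simp: scaled_def)

text \<open>The conditions on the quotient modules are expressed by elements of the module itself.\<close>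

lemma regular_sequence_iff:
  assumes xs: "set xs \<subseteq> carrier R"
  shows "regular_sequence R M xs \<longleftrightarrow>
    (\<forall>i<length xs. \<forall>v\<in>carrier M.
       xs ! i \<odot>\<^bsub>M\<^esub> v \<in> multiples (take i xs) \<longrightarrow> v \<in> multiples (take i xs)) \<and>
    multiples xs \<noteq> carrier M"
proof -
  have sub: "submodule (multiples (take i xs)) R M" for i
    using xs set_take_subset[of i xs] by (intro multiples_submodule) blast
  have "(\<forall>C\<in>carrier (quotient_by_elements R M (take i xs)).
      xs ! i \<odot>\<^bsub>quotient_by_elements R M (take i xs)\<^esub> C = \<zero>\<^bsub>quotient_by_elements R M (take i xs)\<^esub> \<longrightarrow>
      C = \<zero>\<^bsub>quotient_by_elements R M (take i xs)\<^esub>) \<longleftrightarrow>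
    (\<forall>v\<in>carrier M. xs ! i \<odot>\<^bsub>M\<^esub> v \<in> multiples (take i xs) \<longrightarrow> v \<in> multiples (take i xs))"
    if i: "i < length xs" for i
  proof -
    have "xs ! i \<in> carrier R" using xs i nth_mem by blast
    then show ?thesis
      unfolding quotient_by_elements_def quotient_carrier quotient_zero
      by (simp add: quotient_smult[OF sub] coset_eq_self_iff[OF sub])
  qed
  moreover have "carrier (quotient_by_elements R M xs) = {\<zero>\<^bsub>quotient_by_elements R M xs\<^esub>} \<longleftrightarrow>
      multiples xs = carrier M"
  proof -
    have s: "submodule (multiples xs) R M" using xs by (rule multiples_submodule)
    have "carrier (quotient_module M (multiples xs)) = {multiples xs} \<longleftrightarrow>
        (\<forall>v\<in>carrier M. multiples xs +>\<^bsub>M\<^esub> v = multiples xs)"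
      unfolding quotient_carrier using M.zero_closed by blast
    also have "\<dots> \<longleftrightarrow> carrier M \<subseteq> multiples xs"
      using coset_eq_self_iff[OF s] by blast
    finally show ?thesis
      using submoduleE(1)[OF s] unfolding quotient_by_elements_def quotient_zero by blast
  qed
  ultimately show ?thesis
    unfolding regular_sequence_def Let_def by simp
qed

lemma regular_sequence_single:
  assumes "u \<in> carrier R" "\<And>v. v \<in> carrier M \<Longrightarrow> u \<odot>\<^bsub>M\<^esub> v = \<zero>\<^bsub>M\<^esub> \<Longrightarrow> v = \<zero>\<^bsub>M\<^esub>"
    "scaled u \<noteq> carrier M"
  shows "regular_sequence R M [u]"
  using assms by (subst regular_sequence_iff) (simp_all add: span_empty span_multiples)

lemma regular_sequence_ConsD:
  assumes "regular_sequence R M (u # xs)" "set (u # xs) \<subseteq> carrier R"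
  shows "v \<in> carrier M \<Longrightarrow> u \<odot>\<^bsub>M\<^esub> v = \<zero>\<^bsub>M\<^esub> \<Longrightarrow> v = \<zero>\<^bsub>M\<^esub>" and "scaled u \<noteq> carrier M"
proof -
  have reg: "(\<forall>i<length (u # xs). \<forall>v\<in>carrier M.
       (u # xs) ! i \<odot>\<^bsub>M\<^esub> v \<in> multiples (take i (u # xs)) \<longrightarrow> v \<in> multiples (take i (u # xs))) \<and>
    multiples (u # xs) \<noteq> carrier M"
    using assms(1) unfolding regular_sequence_iff[OF assms(2)] .
  show "v \<in> carrier M \<Longrightarrow> u \<odot>\<^bsub>M\<^esub> v = \<zero>\<^bsub>M\<^esub> \<Longrightarrow> v = \<zero>\<^bsub>M\<^esub>"
    using spec[OF conjunct1[OF reg], of 0] by (simp add: span_empty)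
  have "multiples (u # xs) \<subseteq> carrier M"
    using submoduleE(1)[OF multiples_submodule[OF assms(2)]] .
  then show "scaled u \<noteq> carrier M"
    using scaled_subset_multiples[of u xs] conjunct2[OF reg] by blast
qed

lemma regular_sequence_Cons_ConsD:
  assumes "regular_sequence R M (u # w # xs)" "set (u # w # xs) \<subseteq> carrier R"
    and "v \<in> carrier M" "w \<odot>\<^bsub>M\<^esub> v \<in> scaled u"
  shows "v \<in> scaled u"
proof -
  have "\<forall>i<length (u # w # xs). \<forall>v\<in>carrier M. (u # w # xs) ! i \<odot>\<^bsub>M\<^esub> v \<in>
      multiples (take i (u # w # xs)) \<longrightarrow> v \<in> multiples (take i (u # w # xs))"
    using assms(1) unfolding regular_sequence_iff[OF assms(2)] by (rule conjunct1)
  from this[rule_format, of 1 v]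
  show ?thesis using assms(2-4) span_multiples[of u] by simp
qed

end

lemma (in plain_module) depth_eq_1I:
  assumes max: "max_ideal R \<subseteq> carrier R"
    and u: "u \<in> max_ideal R" "\<And>v. v \<in> carrier M \<Longrightarrow> u \<odot>\<^bsub>M\<^esub> v = \<zero>\<^bsub>M\<^esub> \<Longrightarrow> v = \<zero>\<^bsub>M\<^esub>"
      "scaled u \<noteq> carrier M"
    and bound: "\<And>u w xs. set (u # w # xs) \<subseteq> max_ideal R \<Longrightarrow> \<not> regular_sequence R M (u # w # xs)"
  shows "depth R M = 1"
proof -
  let ?D = "{enat (length xs) |xs. set xs \<subseteq> max_ideal R \<and> regular_sequence R M xs}"
  have "regular_sequence R M [u]" using u max by (intro regular_sequence_single) auto
  then have "enat (length [u]) \<in> ?D" using u(1) by (intro CollectI exI[of _ "[u]"]) simp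
  then have "enat (length [u]) \<le> Sup ?D" by (rule Sup_upper)
  moreover have "enat (length [u]) = 1" by (simp add: one_enat_def)
  ultimately have "1 \<le> Sup ?D" by (simp only:)
  moreover have "Sup ?D \<le> 1"
  proof (rule Sup_least)
    fix e assume "e \<in> ?D"
    then obtain xs where xs: "e = enat (length xs)" "set xs \<subseteq> max_ideal R" "regular_sequence R M xs"
      by blast
    have "length xs \<le> 1"
    proof (rule ccontr)
      assume "\<not> length xs \<le> 1"
      then have "Suc (Suc 0) \<le> length xs" by simp
      then obtain u w ys where ys: "xs = u # w # ys"
        unfolding Suc_le_length_iff by blast
      have "\<not> regular_sequence R M (u # w # ys)" using xs(2) unfolding ys by (rule bound)
      then show False using xs(3) unfolding ys by (rule notE)
    qed
    then have "enat (length xs) \<le> enat 1" by (simp only: enat_ord_simps)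
    then show "e \<le> 1" by (simp only: xs(1) one_enat_def)
  qed
  ultimately have "Sup ?D = 1" by order
  then show ?thesis by (rule trans[OF depth_def])
qed

lemma (in plain_module) depth_eq_1D:
  assumes max: "max_ideal R \<subseteq> carrier R" and depth: "depth R M = 1"
  obtains u where "u \<in> max_ideal R"
    "\<And>v. v \<in> carrier M \<Longrightarrow> u \<odot>\<^bsub>M\<^esub> v = \<zero>\<^bsub>M\<^esub> \<Longrightarrow> v = \<zero>\<^bsub>M\<^esub>"
proof -
  let ?D = "{enat (length xs) |xs. set xs \<subseteq> max_ideal R \<and> regular_sequence R M xs}"
  obtain xs where xs: "enat (length xs) \<noteq> 0" "set xs \<subseteq> max_ideal R" "regular_sequence R M xs"
  proof (rule ccontr)
    assume *: "\<not> thesis"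
    have "Sup ?D \<le> 0"
    proof (rule Sup_least)
      fix e assume e: "e \<in> ?D"
      obtain xs where xs: "e = enat (length xs)" "set xs \<subseteq> max_ideal R" "regular_sequence R M xs"
        using e by blast
      have "enat (length xs) = 0"
      proof (rule ccontr)
        assume "enat (length xs) \<noteq> 0"
        from this xs(2,3) have thesis by (rule that)
        with * show False by contradiction
      qed
      then show "e \<le> 0" using xs(1) by simp
    qed
    moreover have "Sup ?D = 1" by (rule trans[OF depth_def[symmetric] depth])
    ultimately have "(1::enat) \<le> 0" by (simp only:)
    then show False by simp
  qed
  have "xs \<noteq> []"
  proof
    assume "xs = []"
    with xs(1) show False by (simp add: enat_0)
  qed
  then have u: "xs = hd xs # tl xs" by simp
  have sub: "set (hd xs # tl xs) \<subseteq> carrier R"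
    using order_trans[OF xs(2) max] u by simp
  have "regular_sequence R M (hd xs # tl xs)" using xs(3) u by simp
  note reg = regular_sequence_ConsD(1)[OF this sub]
  have "hd xs \<in> max_ideal R" using xs(2) \<open>xs \<noteq> []\<close> by auto
  then show ?thesis using reg by (rule that)
qed

section \<open>Torsion-free modules over k[[x]]\<close>

text \<open>Abelian groups with an action of \<open>k[[x, y]]\<close>. The action is a separate parameter because it will be the
  scalar multiplication of a given module twisted by a coordinate change.\<close>

locale series_module = abelian_group X
  for X (structure) and act :: "'k::field power_series2 \<Rightarrow> 'b \<Rightarrow> 'b" +
  assumes act_closed [simp, intro]: "v \<in> carrier X \<Longrightarrow> act u v \<in> carrier X"
    and act_plus: "v \<in> carrier X \<Longrightarrow> act (u + u') v = act u v \<oplus> act u' v"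
    and act_add: "v \<in> carrier X \<Longrightarrow> w \<in> carrier X \<Longrightarrow> act u (v \<oplus> w) = act u v \<oplus> act u w"
    and act_mult: "v \<in> carrier X \<Longrightarrow> act (u * u') v = act u (act u' v)"
    and act_one [simp]: "v \<in> carrier X \<Longrightarrow> act 1 v = v"
begin

lemma act_zero_left [simp]: "v \<in> carrier X \<Longrightarrow> act 0 v = \<zero>"
  using act_plus[of v 0 0] add.r_cancel_one'[of "act 0 v" "act 0 v"] by simp

lemma act_zero_right [simp]: "act u \<zero> = \<zero>"
  using act_mult[of \<zero> u 0] by simp

definition comb :: "'b set \<Rightarrow> ('b \<Rightarrow> 'k fps) \<Rightarrow> 'b"
  where "comb W c = (\<Oplus>w\<in>W. act (fps_const (c w)) w)"

lemma comb_closed [simp]: "W \<subseteq> carrier X \<Longrightarrow> comb W c \<in> carrier X"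
  unfolding comb_def by (intro finsum_closed) auto

lemma comb_cong: "W \<subseteq> carrier X \<Longrightarrow> (\<And>w. w \<in> W \<Longrightarrow> c w = c' w) \<Longrightarrow> comb W c = comb W c'"
  unfolding comb_def by (intro finsum_cong') auto

lemma comb_add:
  assumes "W \<subseteq> carrier X"
  shows "comb W (\<lambda>w. c w + c' w) = comb W c \<oplus> comb W c'"
proof -
  have "comb W (\<lambda>w. c w + c' w) =
      (\<Oplus>w\<in>W. act (fps_const (c w)) w \<oplus> act (fps_const (c' w)) w)"
    unfolding comb_def using assms
    by (intro finsum_cong') (auto simp flip: fps_const_add simp: act_plus)
  also have "\<dots> = comb W c \<oplus> comb W c'"
    unfolding comb_def by (rule finsum_addf) (use assms in auto)
  finally show ?thesis .
qed

lemma act_finsum: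
  assumes "finite A" "g \<in> A \<rightarrow> carrier X"
  shows "act u (\<Oplus>i\<in>A. g i) = (\<Oplus>i\<in>A. act u (g i))"
  using assms
proof (induction A rule: finite_induct)
  case (insert i A)
  then show ?case
    using finsum_closed[of g A] by (simp add: act_add Pi_def)
qed simp

lemma comb_scale:
  assumes "finite W" "W \<subseteq> carrier X"
  shows "act (fps_const s) (comb W c) = comb W (\<lambda>w. s * c w)"
proof -
  have "act (fps_const s) (comb W c) = (\<Oplus>w\<in>W. act (fps_const s) (act (fps_const (c w)) w))"
    unfolding comb_def using assms by (intro act_finsum) auto
  also have "\<dots> = comb W (\<lambda>w. s * c w)"
    unfolding comb_def using assms
    by (intro finsum_cong') (auto simp flip: fps_const_mult act_mult)
  finally show ?thesis .
qed

lemma comb_drop: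
  assumes "finite W" "W \<subseteq> carrier X" "w0 \<in> W" "c w0 = 0"
  shows "comb W c = comb (W - {w0}) c"
proof -
  have "finsum X (\<lambda>w. act (fps_const (c w)) w) (insert w0 (W - {w0})) =
      act (fps_const (c w0)) w0 \<oplus> finsum X (\<lambda>w. act (fps_const (c w)) w) (W - {w0})"
    using assms by (intro finsum_insert) auto
  moreover have "insert w0 (W - {w0}) = W" using assms(3) by auto
  ultimately show ?thesis
    using assms comb_closed[of "W - {w0}" c] by (simp add: comb_def subset_iff)
qed

lemma comb_zero:
  assumes "W \<subseteq> carrier X" "\<And>w. w \<in> W \<Longrightarrow> c w = 0"
  shows "comb W c = \<zero>"
proof -
  have "comb W c = (\<Oplus>w\<in>W. \<zero>)"
    unfolding comb_def using assms by (intro finsum_cong') auto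
  then show ?thesis by simp
qed

lemma comb_single:
  assumes "finite W" "W \<subseteq> carrier X" "w0 \<in> W"
  shows "comb W (\<lambda>w. if w = w0 then s else 0) = act (fps_const s) w0"
proof -
  let ?g = "\<lambda>w. act (fps_const (if w = w0 then s else 0)) w"
  have "finsum X ?g (insert w0 (W - {w0})) = ?g w0 \<oplus> finsum X ?g (W - {w0})"
    using assms by (intro finsum_insert) auto
  moreover have "finsum X ?g (W - {w0}) = \<zero>"
    using comb_zero[of "W - {w0}" "\<lambda>w. if w = w0 then s else 0"] assms(2)
    by (auto simp: comb_def)
  moreover have "insert w0 (W - {w0}) = W" using assms(3) by auto
  ultimately show ?thesis
    using assms by (auto simp: comb_def)
qed

definition spans :: "'b set \<Rightarrow> bool"
  where "spans W \<longleftrightarrow> (\<forall>v\<in>carrier X. \<exists>c. v = comb W c)"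

end

locale series_module_regular = series_module X act
  for X (structure) and act :: "'k::field power_series2 \<Rightarrow> 'b \<Rightarrow> 'b" +
  assumes var_x_regular: "v \<in> carrier X \<Longrightarrow> act var_x v = \<zero> \<Longrightarrow> v = \<zero>"
begin

lemma var_x_power_regular: "v \<in> carrier X \<Longrightarrow> act (var_x ^ N) v = \<zero> \<Longrightarrow> v = \<zero>"
proof (induction N)
  case (Suc N)
  have "act var_x (act (var_x ^ N) v) = \<zero>"
    using Suc.prems by (simp add: act_mult)
  then show ?case
    using Suc var_x_regular by blast
qed simp

text \<open>A common power of x cancels from a nontrivial relation since x acts injectively. Then some coefficient
  is a unit, and the corresponding generator is superfluous.\<close>

lemma minimal_spanning_independent:
  assumes W: "finite W" "W \<subseteq> carrier X" "spans W"
    and min: "\<And>w. w \<in> W \<Longrightarrow> \<not> spans (W - {w})"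
    and zero: "comb W c = \<zero>" and w1: "w1 \<in> W"
  shows "c w1 = 0"
proof (rule ccontr)
  assume nz: "c w1 \<noteq> 0"
  (* The largest power of x that divides all coefficients. *)
  define N where "N = Min ((\<lambda>w. subdegree (c w)) ` {w\<in>W. c w \<noteq> 0})"
  have fin: "finite ((\<lambda>w. subdegree (c w)) ` {w\<in>W. c w \<noteq> 0})"
    and ne: "(\<lambda>w. subdegree (c w)) ` {w\<in>W. c w \<noteq> 0} \<noteq> {}"
    using W(1) w1 nz by auto
  obtain w0 where w0: "w0 \<in> W" "c w0 \<noteq> 0" "subdegree (c w0) = N"
    using Min_in[OF fin ne] unfolding N_def by auto
  have le: "N \<le> subdegree (c w)" if "w \<in> W" "c w \<noteq> 0" for w
    unfolding N_def using fin that by (intro Min_le) auto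
  define c' where "c' = (\<lambda>w. fps_shift N (c w))"
  have c': "c w = fps_X ^ N * c' w" if "w \<in> W" for w
  proof (cases "c w = 0")
    case False
    then show ?thesis
      using fps_shift_times_fps_X_power[OF le[OF that False]] by (simp add: c'_def mult.commute)
  qed (simp add: c'_def)
  have "comb W c = act (var_x ^ N) (comb W c')"
    using comb_scale[OF W(1,2), of "fps_X ^ N" c'] comb_cong[OF W(2) c'] 
    by (simp add: fps_const_X_power)
  then have zero': "comb W c' = \<zero>"
    using zero var_x_power_regular W(2) by simp
  have unit: "c' w0 * inverse (c' w0) = 1"
    using w0 by (intro inverse_mult_eq_1') (auto simp: c'_def)
  have "spans (W - {w0})"
    unfolding spans_def
  proof
    fix v assume "v \<in> carrier X"
    then obtain b where v: "v = comb W b" using W(3) unfolding spans_def by blast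
    define t where "t = - (b w0 * inverse (c' w0))"
    have "comb W (\<lambda>w. b w + t * c' w) = comb W b \<oplus> act (fps_const t) (comb W c')"
      using W by (simp add: comb_add comb_scale)
    then have "v = comb W (\<lambda>w. b w + t * c' w)"
      using v zero' W(2) by simp
    also have "\<dots> = comb (W - {w0}) (\<lambda>w. b w + t * c' w)"
      using W w0(1) unit by (intro comb_drop) (auto simp: t_def mult.assoc mult.commute[of "inverse (c' w0)"])
    finally show "\<exists>c. v = comb (W - {w0}) c" by blast
  qed
  then show False using min w0(1) by blast
qed

text \<open>A minimal spanning set is a basis over \<open>k[[x]]\<close>, and an element outside \<open>x X\<close> has a coordinate that
  is a unit.\<close>

lemma coordinate_functional:
  assumes W: "finite W" "W \<subseteq> carrier X" "spans W"
    and s: "s \<in> carrier X" "s \<notin> act var_x ` carrier X"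
  obtains \<psi> where "\<And>v w. v \<in> carrier X \<Longrightarrow> w \<in> carrier X \<Longrightarrow> \<psi> (v \<oplus> w) = \<psi> v + \<psi> w"
    and "\<And>t v. v \<in> carrier X \<Longrightarrow> \<psi> (act (fps_const t) v) = t * \<psi> v"
    and "\<psi> s $ 0 \<noteq> 0"
proof -
  let ?P = "\<lambda>U. U \<subseteq> W \<and> spans U"
  define U where "U = arg_min card ?P"
  have U: "U \<subseteq> W" "spans U"
    using arg_min_natI[of ?P W card] W(3) unfolding U_def by auto
  have U': "finite U" "U \<subseteq> carrier X" using U(1) W finite_subset by auto
  have min: "\<not> spans (U - {w})" if "w \<in> U" for w
  proof
    assume "spans (U - {w})"
    then have "card U \<le> card (U - {w})"
      using U(1) arg_min_nat_le[of ?P "U - {w}" card] unfolding U_def by blast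
    then show False using that U'(1) card_Diff1_less[of U w] by simp
  qed
  define coord where "coord = (\<lambda>v. SOME c. v = comb U c)"
  have coord: "v = comb U (coord v)" if "v \<in> carrier X" for v
    using U(2) that unfolding spans_def coord_def by (metis (mono_tags) someI_ex)
  have unique: "c w = coord (comb U c) w" if "w \<in> U" for c w
  proof -
    have "comb U (\<lambda>w. c w + (-1) * coord (comb U c) w) =
        comb U c \<oplus> act (fps_const (-1)) (comb U (coord (comb U c)))"
      using U' by (simp only: comb_add comb_scale)
    also have "comb U (coord (comb U c)) = comb U c" using coord U'(2) by simp
    also have "comb U c \<oplus> act (fps_const (-1)) (comb U c) = act (1 + fps_const (-1)) (comb U c)"
      using U'(2) by (simp only: act_plus comb_closed act_one)
    also have "\<dots> = \<zero>"
      using U'(2) by (simp flip: fps_const_neg)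
    finally have "c w + (-1) * coord (comb U c) w = 0"
      using minimal_spanning_independent[OF U' U(2) min] that by blast
    then show ?thesis by simp
  qed
  have "\<exists>w0\<in>U. coord s w0 $ 0 \<noteq> 0"
  proof (rule ccontr)
    assume "\<not> ?thesis"
    then have "coord s w = fps_X * fps_shift 1 (coord s w)" if "w \<in> U" for w
      using that by (auto simp: fps_eq_iff)
    then have "comb U (coord s) = comb U (\<lambda>w. fps_X * fps_shift 1 (coord s w))"
      by (rule comb_cong[OF U'(2)])
    also have "\<dots> = act (fps_const fps_X) (comb U (\<lambda>w. fps_shift 1 (coord s w)))"
      by (rule comb_scale[OF U', symmetric])
    finally have "s = act var_x (comb U (\<lambda>w. fps_shift 1 (coord s w)))"
      using coord[OF s(1)] by (simp add: var_x_def)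
    then show False using s(2) U'(2) by auto
  qed
  then obtain w0 where w0: "w0 \<in> U" "coord s w0 $ 0 \<noteq> 0" by blast
  show ?thesis
  proof (rule that[of "\<lambda>v. coord v w0"])
    show "coord (v \<oplus> w) w0 = coord v w0 + coord w w0" if "v \<in> carrier X" "w \<in> carrier X" for v w
    proof -
      have "v \<oplus> w = comb U (\<lambda>x. coord v x + coord w x)"
        using comb_add[OF U'(2)] coord that by simp
      then show ?thesis using unique[OF w0(1), of "\<lambda>x. coord v x + coord w x"] by simp
    qed
    show "coord (act (fps_const t) v) w0 = t * coord v w0" if "v \<in> carrier X" for t v
    proof -
      have "act (fps_const t) v = comb U (\<lambda>x. t * coord v x)"
        using comb_scale[OF U', of t "coord v"] coord[OF that] by simp
      then show ?thesis using unique[OF w0(1), of "\<lambda>x. t * coord v x"] by simp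
    qed
    show "coord s w0 $ 0 \<noteq> 0" by (rule w0(2))
  qed
qed

end

section \<open>Duality over k[[x]]\<close>

locale weierstrass_module = series_module_regular X act
  for X (structure) and act :: "'k::field power_series2 \<Rightarrow> 'b \<Rightarrow> 'b" +
  fixes F :: "'k power_series2" and d :: nat
  assumes form_F: "form d F" and d_pos: "d > 0" and lead: "F $ d $ 0 \<noteq> 0"
    and act_F: "v \<in> carrier X \<Longrightarrow> act F v = \<zero>"
begin

lemma act_F_mult: "v \<in> carrier X \<Longrightarrow> act (F * q) v = \<zero>"
  by (simp add: act_mult act_F)

text \<open>By Weierstrass division \<open>1, y, ..., y^(d - 1)\<close> span the power series ring modulo F over \<open>k[[x]]\<close>.\<close>

lemma finite_spanning_set:
  assumes S: "finite S" "S \<subseteq> carrier X"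
    and gen: "\<And>N. S \<subseteq> N \<Longrightarrow> N \<subseteq> carrier X \<Longrightarrow> \<zero> \<in> N \<Longrightarrow> (\<And>v w. v \<in> N \<Longrightarrow> w \<in> N \<Longrightarrow> v \<oplus> w \<in> N)
      \<Longrightarrow> (\<And>u v. v \<in> N \<Longrightarrow> act u v \<in> N) \<Longrightarrow> N = carrier X"
  obtains W where "finite W" "W \<subseteq> carrier X" "spans W"
proof -
  define W where "W = (\<lambda>(i, s). act (var_y ^ i) s) ` ({..<d} \<times> S)"
  have W: "finite W" "W \<subseteq> carrier X" using S by (auto simp: W_def)
  define N where "N = range (comb W)"
  have N_zero: "\<zero> \<in> N"
    using comb_zero[OF W(2), of "\<lambda>_. 0"] by (auto simp: N_def intro: sym)
  have N_add: "v \<oplus> w \<in> N" if "v \<in> N" "w \<in> N" for v w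
    using that by (auto simp: N_def simp flip: comb_add[OF W(2)])
  have N_carrier: "N \<subseteq> carrier X" using W by (auto simp: N_def)
  have N_gen: "act u s \<in> N" if s: "s \<in> S" for u s
  proof -
    have sc: "s \<in> carrier X" using s S by auto
    obtain q c where u: "u = F * q + (\<Sum>i<d. fps_const (c i) * var_y ^ i)"
      by (rule weierstrass_division[OF form_F lead])
    have "act (\<Sum>i<k. fps_const (c i) * var_y ^ i) s \<in> N" if "k \<le> d" for k
      using that
    proof (induction k)
      case 0
      then show ?case using N_zero sc by simp
    next
      case (Suc k)
      then have "act (var_y ^ k) s \<in> W" using s by (auto simp: W_def)
      then have "act (fps_const (c k) * var_y ^ k) s \<in> N"
        using comb_single[OF W, of "act (var_y ^ k) s" "c k"] sc
        by (auto simp: N_def act_mult intro: sym)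
      then show ?case using Suc N_add sc by (simp add: act_plus)
    qed
    then have "act (\<Sum>i<d. fps_const (c i) * var_y ^ i) s \<in> N" by blast
    then show ?thesis unfolding u using sc by (simp add: act_plus act_F_mult)
  qed
  have "N = carrier X"
  proof (rule gen)
    show "S \<subseteq> N"
    proof
      fix s assume s: "s \<in> S"
      then show "s \<in> N" using N_gen[OF s, of 1] S(2) by auto
    qed
    show "act u v \<in> N" if v: "v \<in> N" for u v
    proof -
      obtain c where c: "v = comb W c" using v by (auto simp: N_def)
      have summand: "act u (act (fps_const (c w)) w) \<in> N" if w: "w \<in> W" for w
      proof -
        obtain i s where i: "w = act (var_y ^ i) s" "s \<in> S" using w by (auto simp: W_def)
        then have "act u (act (fps_const (c w)) w) = act (u * fps_const (c w) * var_y ^ i) s"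
          using S(2) by (simp add: act_mult subset_iff)
        then show ?thesis using N_gen[OF i(2)] by simp
      qed
      have fin: "(\<Oplus>w\<in>A. g w) \<in> N" if "finite A" "\<And>w. w \<in> A \<Longrightarrow> g w \<in> N" for A and g :: "'b \<Rightarrow> 'b"
        using that
      proof (induction A rule: finite_induct)
        case (insert w A)
        then have "(\<Oplus>w\<in>insert w A. g w) = g w \<oplus> (\<Oplus>w\<in>A. g w)"
          using N_carrier by (intro finsum_insert) auto
        then show ?case using insert N_add by simp
      qed (simp add: N_zero)
      have "act u v = (\<Oplus>w\<in>W. act u (act (fps_const (c w)) w))"
        unfolding c comb_def using W by (intro act_finsum) auto
      then show ?thesis using fin[OF W(1)] summand by simp
    qed
  qed (use N_carrier N_zero N_add in auto)
  then have "spans W" by (auto simp: spans_def N_def)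
  then show ?thesis using W that by blast
qed

text \<open>The Horner polynomials \<open>h_i\<close> of F as a polynomial in y; they satisfy
  \<open>(F(Y) - F(y)) / (Y - y) = (\<Sum>i<d. h_i(y) * Y^i)\<close>.\<close>

definition horner :: "nat \<Rightarrow> 'k power_series2"
  where "horner i = (\<Sum>j\<in>{i<..d}. fps_const (F $ j) * var_y ^ (j - Suc i))"

lemma horner_Suc: "i < d \<Longrightarrow> var_y * horner (Suc i) = horner i - fps_const (F $ Suc i)"
proof -
  assume i: "i < d"
  have "{i<..d} = insert (Suc i) {Suc i<..d}" using i by auto
  then have "horner i = fps_const (F $ Suc i) + (\<Sum>j\<in>{Suc i<..d}. fps_const (F $ j) * var_y ^ (j - Suc i))"
    by (simp add: horner_def)
  also have "(\<Sum>j\<in>{Suc i<..d}. fps_const (F $ j) * var_y ^ (j - Suc i)) = var_y * horner (Suc i)"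
    unfolding horner_def sum_distrib_left
  proof (rule sum.cong)
    fix j assume "j \<in> {Suc i<..d}"
    then have "j - Suc i = Suc (j - Suc (Suc i))" by auto
    then show "fps_const (F $ j) * var_y ^ (j - Suc i) = var_y * (fps_const (F $ j) * var_y ^ (j - Suc (Suc i)))"
      by (simp only: power_Suc mult.left_commute)
  qed simp
  finally show ?thesis by simp
qed

lemma horner_0: "var_y * horner 0 = F - fps_const (F $ 0)"
proof -
  have "F = fps_const (F $ 0) + (\<Sum>j\<in>{0<..d}. fps_const (F $ j) * var_y ^ j)"
    using form_expansion[OF form_F] by (simp add: atMost_atLeast0 sum.head)
  also have "(\<Sum>j\<in>{0<..d}. fps_const (F $ j) * var_y ^ j) = var_y * horner 0"
    unfolding horner_def sum_distrib_left
  proof (rule sum.cong)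
    fix j assume "j \<in> {0<..d}"
    then have "j = Suc (j - Suc 0)" by auto
    then have "(var_y :: 'k power_series2) ^ j = var_y * var_y ^ (j - Suc 0)" by (metis power_Suc)
    then show "fps_const (F $ j) * var_y ^ j = var_y * (fps_const (F $ j) * var_y ^ (j - Suc 0))"
      by (simp only: mult.left_commute)
  qed simp
  finally show ?thesis by (simp add: algebra_simps)
qed

lemma horner_last: "horner (d - 1) = fps_const (F $ d)"
proof -
  have "{d - 1<..d} = {d}" using d_pos by auto
  then show ?thesis using d_pos by (simp add: horner_def)
qed

text \<open>The isomorphism between \<open>Hom(X, A)\<close> over \<open>A = k[[x]]\<close> and the dual of X over the power series ring
  modulo F, in one direction and by a formula. Multiplication by y shifts the Horner polynomials, and the
  defect of linearity telescopes to \<open>F * \<psi> v\<close>. The constant term of \<open>\<phi> v\<close> comes from \<open>h_0\<close> alone,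
  in which only the leading coefficient of F is not divisible by x.\<close>

lemma linear_functional:
  fixes \<psi> :: "'b \<Rightarrow> 'k fps"
  assumes psi_add: "\<And>v w. v \<in> carrier X \<Longrightarrow> w \<in> carrier X \<Longrightarrow> \<psi> (v \<oplus> w) = \<psi> v + \<psi> w"
    and psi_scale: "\<And>t v. v \<in> carrier X \<Longrightarrow> \<psi> (act (fps_const t) v) = t * \<psi> v"
  defines "\<phi> \<equiv> \<lambda>v. \<Sum>i<d. fps_const (\<psi> (act (horner i) v)) * var_y ^ i"
  shows "\<And>v w. v \<in> carrier X \<Longrightarrow> w \<in> carrier X \<Longrightarrow> \<phi> (v \<oplus> w) = \<phi> v + \<phi> w"
    and "\<And>u v. v \<in> carrier X \<Longrightarrow> F dvd \<phi> (act u v) - u * \<phi> v"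
    and "\<And>v. v \<in> carrier X \<Longrightarrow> \<phi> v $ 0 $ 0 = F $ d $ 0 * \<psi> (act (var_y ^ (d - 1)) v) $ 0"
proof -
  have psi_act_add: "\<psi> (act (u + u') v) = \<psi> (act u v) + \<psi> (act u' v)" if "v \<in> carrier X" for u u' v
    using that by (simp add: act_plus psi_add)
  have psi_zero: "\<psi> \<zero> = 0" using psi_scale[of \<zero> 0] by simp
  have psi_act_diff: "\<psi> (act (u - u') v) = \<psi> (act u v) - \<psi> (act u' v)" if "v \<in> carrier X" for u u' v
    using psi_act_add[OF that, of "u - u'" u'] by simp
  have psi_act_scale: "\<psi> (act (fps_const t * u) v) = t * \<psi> (act u v)" if "v \<in> carrier X" for t u v
    using that by (simp add: act_mult psi_scale)
  show add: "\<phi> (v \<oplus> w) = \<phi> v + \<phi> w" if "v \<in> carrier X" "w \<in> carrier X" for v w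
  proof -
    have "fps_const (\<psi> (act (horner i) (v \<oplus> w))) =
        fps_const (\<psi> (act (horner i) v)) + fps_const (\<psi> (act (horner i) w))" for i
      using that by (simp add: act_add psi_add)
    then show ?thesis unfolding \<phi>_def by (simp only: distrib_right sum.distrib)
  qed
  have y: "var_y * \<phi> v - \<phi> (act var_y v) = F * fps_const (\<psi> v)" if v: "v \<in> carrier X" for v
  proof -
    obtain e where e: "d = Suc e" using d_pos by (cases d) auto
    have sum_first: "(\<Sum>i<d. g i) = g 0 + (\<Sum>i<e. g (Suc i))"
      and sum_last: "(\<Sum>i<d. g i) = (\<Sum>i<e. g i) + g e" for g :: "nat \<Rightarrow> 'k power_series2"
      by (simp only: e sum.lessThan_Suc_shift, simp only: e sum.lessThan_Suc)
    have sum_both: "(\<Sum>i\<le>d. g i) = g 0 + (\<Sum>i<e. g (Suc i)) + g d" for g :: "nat \<Rightarrow> 'k power_series2"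
      by (simp only: lessThan_Suc_atMost[symmetric] sum.lessThan_Suc sum_first)
    let ?h = "\<lambda>i. \<psi> (act (horner i) v)"
    have shift: "act (horner i) (act var_y v) = act (var_y * horner i) v" for i
      using v by (simp only: act_mult[symmetric] mult.commute)
    have h0: "\<psi> (act (horner 0) (act var_y v)) = - (F $ 0 * \<psi> v)"
      unfolding shift horner_0 using v
      by (simp add: psi_act_diff psi_scale act_F psi_zero)
    have hS: "\<psi> (act (horner (Suc i)) (act var_y v)) = ?h i - F $ Suc i * \<psi> v" if "i < e" for i
    proof -
      have "i < d" using that e by simp
      then show ?thesis
        unfolding shift using v by (simp add: horner_Suc psi_act_diff psi_scale)
    qed
    have "\<phi> (act var_y v) = fps_const (- (F $ 0 * \<psi> v)) +
        (\<Sum>i<e. fps_const (?h i - F $ Suc i * \<psi> v) * var_y ^ Suc i)"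
      unfolding \<phi>_def sum_first by (simp add: h0 hS)
    also have "(\<Sum>i<e. fps_const (?h i - F $ Suc i * \<psi> v) * var_y ^ Suc i) =
        (\<Sum>i<e. fps_const (?h i) * var_y ^ Suc i) - (\<Sum>i<e. fps_const (F $ Suc i) * var_y ^ Suc i) * fps_const (\<psi> v)"
      unfolding sum_distrib_right sum_subtractf[symmetric]
      by (simp only: fps_const_sub[symmetric] fps_const_mult[symmetric] left_diff_distrib right_diff_distrib mult_ac)
    also have "fps_const (- (F $ 0 * \<psi> v)) = - (fps_const (F $ 0) * fps_const (\<psi> v))"
      by simp
    finally have 1: "\<phi> (act var_y v) = - (fps_const (F $ 0) * fps_const (\<psi> v)) +
        ((\<Sum>i<e. fps_const (?h i) * var_y ^ Suc i) -
        (\<Sum>i<e. fps_const (F $ Suc i) * var_y ^ Suc i) * fps_const (\<psi> v))" .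
    have "?h e = F $ d * \<psi> v"
      using horner_last psi_scale[OF v] by (simp add: e)
    then have "var_y * (fps_const (?h e) * var_y ^ e) = fps_const (F $ d) * var_y ^ d * fps_const (\<psi> v)"
      by (simp only: e power_Suc fps_const_mult[symmetric] mult_ac)
    then have 2: "var_y * \<phi> v = (\<Sum>i<e. fps_const (?h i) * var_y ^ Suc i) +
        fps_const (F $ d) * var_y ^ d * fps_const (\<psi> v)"
      unfolding \<phi>_def sum_last distrib_left sum_distrib_left
      by (simp only: power_Suc mult_ac)
    have 3: "F = fps_const (F $ 0) * var_y ^ 0 + (\<Sum>i<e. fps_const (F $ Suc i) * var_y ^ Suc i) +
        fps_const (F $ d) * var_y ^ d"
      by (rule trans[OF form_expansion[OF form_F] sum_both])
    have ring: "(A + L * p) - (- (c * p) + (A - B * p)) = (c * 1 + B + L) * p"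
      for A B L p c :: "'k power_series2"
      by (simp add: algebra_simps)
    show ?thesis
      unfolding 1 2 ring by (subst 3) simp
  qed
  define P where "P = {u. \<forall>v\<in>carrier X. F dvd \<phi> (act u v) - u * \<phi> v}"
  have P_const: "fps_const t \<in> P" for t
  proof -
    have "\<phi> (act (fps_const t) v) = fps_const t * \<phi> v" if v: "v \<in> carrier X" for v
    proof -
      have "act (horner i) (act (fps_const t) v) = act (fps_const t * horner i) v" for i
        using v by (simp only: act_mult[symmetric] mult.commute)
      then show ?thesis
        unfolding \<phi>_def using v
        by (simp add: psi_act_scale sum_distrib_left mult.assoc flip: fps_const_mult)
    qed
    then show ?thesis by (simp add: P_def)
  qed
  have P_y: "var_y \<in> P"
    unfolding P_def
  proof (intro CollectI ballI)
    fix v assume "v \<in> carrier X"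
    from y[OF this] have "F dvd var_y * \<phi> v - \<phi> (act var_y v)" by simp
    then have "F dvd - (var_y * \<phi> v - \<phi> (act var_y v))" by (simp only: dvd_minus_iff)
    then show "F dvd \<phi> (act var_y v) - var_y * \<phi> v" by (simp only: minus_diff_eq)
  qed
  have P_mult: "u * u' \<in> P" if "u \<in> P" "u' \<in> P" for u u'
    unfolding P_def
  proof (intro CollectI ballI)
    fix v assume v: "v \<in> carrier X"
    have "F dvd (\<phi> (act u (act u' v)) - u * \<phi> (act u' v)) + u * (\<phi> (act u' v) - u' * \<phi> v)"
      using that v by (intro dvd_add dvd_mult) (auto simp: P_def)
    then show "F dvd \<phi> (act (u * u') v) - u * u' * \<phi> v"
      using v by (simp add: act_mult right_diff_distrib mult.assoc)
  qed
  have P_add: "u + u' \<in> P" if "u \<in> P" "u' \<in> P" for u u'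
    unfolding P_def
  proof (intro CollectI ballI)
    fix v assume v: "v \<in> carrier X"
    have "F dvd (\<phi> (act u v) - u * \<phi> v) + (\<phi> (act u' v) - u' * \<phi> v)"
      using that v by (intro dvd_add) (auto simp: P_def)
    then show "F dvd \<phi> (act (u + u') v) - (u + u') * \<phi> v"
      using v by (simp add: act_plus add algebra_simps)
  qed
  have P_F: "F * q \<in> P" for q
  proof -
    have "\<phi> \<zero> = 0" unfolding \<phi>_def by (simp add: psi_zero)
    then show ?thesis by (simp add: P_def act_F_mult mult.assoc)
  qed
  have P_power: "var_y ^ i \<in> P" for i
    using P_const[of 1] P_y P_mult by (induction i) auto
  have P_sum: "(\<Sum>i<k. fps_const (c i) * var_y ^ i) \<in> P" for k c
    using P_const[of 0] P_add P_mult[OF P_const P_power] by (induction k) auto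
  show "F dvd \<phi> (act u v) - u * \<phi> v" if "v \<in> carrier X" for u v
  proof -
    obtain q c where "u = F * q + (\<Sum>i<d. fps_const (c i) * var_y ^ i)"
      by (rule weierstrass_division[OF form_F lead])
    then have "u \<in> P" using P_add[OF P_F P_sum] by simp
    then show ?thesis using that by (simp add: P_def)
  qed
  show "\<phi> v $ 0 $ 0 = F $ d $ 0 * \<psi> (act (var_y ^ (d - 1)) v) $ 0" if v: "v \<in> carrier X" for v
  proof -
    have psi_sum: "\<psi> (act (\<Sum>j\<in>A. fps_const (c j) * g j) v) = (\<Sum>j\<in>A. c j * \<psi> (act (g j) v))"
      if "finite A" for A :: "nat set" and c g
      using that v
      by (induction A rule: finite_induct) (simp_all add: psi_zero psi_act_add psi_act_scale)
    have "\<phi> v $ 0 = \<psi> (act (horner 0) v)"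
    proof -
      obtain e where e: "d = Suc e" using d_pos by (cases d) auto
      show ?thesis
        unfolding \<phi>_def e sum.lessThan_Suc_shift
        by (simp add: fps_sum_nth var_y_mult_nth mult.left_commute)
    qed
    also have "\<dots> = (\<Sum>j\<in>{0<..d}. F $ j * \<psi> (act (var_y ^ (j - Suc 0)) v))"
      unfolding horner_def by (rule psi_sum) simp
    finally have "\<phi> v $ 0 $ 0 = (\<Sum>j\<in>{0<..d}. F $ j $ 0 * \<psi> (act (var_y ^ (j - Suc 0)) v) $ 0)"
      by (simp add: fps_sum_nth fps_mult_nth_0)
    also have "\<dots> = (\<Sum>j\<in>{d}. F $ j $ 0 * \<psi> (act (var_y ^ (j - Suc 0)) v) $ 0)"
      using form_F d_pos by (intro sum.mono_neutral_right) (auto simp: form_def)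
    finally show ?thesis by simp
  qed
qed

end

section \<open>The hypersurface ring and its generalized Loewy length\<close>

text \<open>The factor x of f provides a prime ideal of the hypersurface ring below the maximal one.\<close>

locale hypersurface_ring = hypersurface f d a for f :: "'k::field power_series2" and d a +
  assumes x_dvd_f: "var_x dvd f"
begin

definition S :: "'k power_series2 ring" where "S = cring_class_ops"
definition I :: "'k power_series2 set" where "I = PIdl\<^bsub>S\<^esub> f"
definition R :: "'k power_series2 set ring" where "R = S Quot I"
definition proj :: "'k power_series2 \<Rightarrow> 'k power_series2 set" where "proj u = I +>\<^bsub>S\<^esub> u"

lemma S_simps [simp]: "carrier S = UNIV" "u \<otimes>\<^bsub>S\<^esub> v = u * v" "u \<oplus>\<^bsub>S\<^esub> v = u + v"
  "\<one>\<^bsub>S\<^esub> = 1" "\<zero>\<^bsub>S\<^esub> = 0" "u \<ominus>\<^bsub>S\<^esub> v = u - v"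
  by (simp_all add: S_def class_simps) (simp add: cring_class_ops_def)

lemma cring_S: "cring S" unfolding S_def by (rule cring_class)

lemma I_iff: "u \<in> I \<longleftrightarrow> f dvd u"
  by (auto simp: I_def cgenideal_def dvd_def mult.commute)

lemma ideal_I: "ideal I S"
  unfolding I_def by (rule cring.cgenideal_ideal[OF cring_S]) simp

lemma cring_R: "cring R"
  unfolding R_def by (rule ideal.quotient_is_cring[OF ideal_I cring_S])

lemma proj_eq_iff: "proj u = proj v \<longleftrightarrow> f dvd u - v"
  using ring.quotient_eq_iff_same_a_r_cos[OF cring.axioms(1)[OF cring_S] ideal_I, of u v]
  by (simp add: proj_def I_iff)

lemma carrier_R: "carrier R = range proj"
  by (auto simp: R_def FactRing_def A_RCOSETS_def' proj_def)

lemma proj_carrier [simp]: "proj u \<in> carrier R" by (simp add: carrier_R)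

lemma proj_simps: "proj u \<otimes>\<^bsub>R\<^esub> proj v = proj (u * v)" "proj u \<oplus>\<^bsub>R\<^esub> proj v = proj (u + v)"
  "\<one>\<^bsub>R\<^esub> = proj 1" "\<zero>\<^bsub>R\<^esub> = proj 0"
  using ring_hom_mult[OF ideal.rcos_ring_hom[OF ideal_I], of u v]
    ring_hom_add[OF ideal.rcos_ring_hom[OF ideal_I], of u v]
    ring_hom_one[OF ideal.rcos_ring_hom[OF ideal_I]]
    ring_hom_zero[OF ideal.rcos_ring_hom[OF ideal_I] cring.axioms(1)[OF cring_S] cring.axioms(1)[OF cring_R[unfolded R_def]]]
  by (simp_all add: proj_def R_def)

lemma proj_uminus: "\<ominus>\<^bsub>R\<^esub> proj u = proj (- u)"
proof -
  interpret R: cring R by (rule cring_R)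
  show ?thesis by (rule R.minus_equality) (simp_all add: proj_simps)
qed

lemma proj_power: "proj u [^]\<^bsub>R\<^esub> (k::nat) = proj (u ^ k)"
proof -
  interpret R: cring R by (rule cring_R)
  show ?thesis by (induction k) (simp_all add: proj_simps mult.commute)
qed

lemma proj_eq_zero_iff: "proj u = proj 0 \<longleftrightarrow> f dvd u"
  by (simp add: proj_eq_iff)

lemma R_cases: assumes "r \<in> carrier R" obtains u where "r = proj u"
  using assms by (auto simp: carrier_R)

lemma ideal_projI:
  assumes "0 \<in> J" "\<And>u v. u \<in> J \<Longrightarrow> v \<in> J \<Longrightarrow> u + v \<in> J" "\<And>u v. v \<in> J \<Longrightarrow> u * v \<in> J"
  shows "ideal (proj ` J) R"
proof (rule idealI)
  interpret R: cring R by (rule cring_R)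
  show "ring R" by (rule R.ring_axioms)
  show "subgroup (proj ` J) (add_monoid R)"
  proof (rule R.add.subgroupI)
    show "\<ominus>\<^bsub>R\<^esub> r \<in> proj ` J" if "r \<in> proj ` J" for r
      using that assms(3)[of _ "- 1"] by (auto simp: proj_uminus)
  qed (use assms(1,2) in \<open>auto simp: proj_simps\<close>)
  show "s \<otimes>\<^bsub>R\<^esub> r \<in> proj ` J" "r \<otimes>\<^bsub>R\<^esub> s \<in> proj ` J"
    if "r \<in> proj ` J" "s \<in> carrier R" for r s
    using that assms(3) by (auto simp: carrier_R proj_simps mult.commute)
qed

definition mpow :: "nat \<Rightarrow> 'k power_series2 set set" where "mpow k = proj ` order_ideal k"

lemma ideal_mpow: "ideal (mpow k) R"
  unfolding mpow_def by (rule ideal_projI) (auto intro: order_ideal_add order_ideal_lmult)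

lemma proj_in_mpow: "u \<in> order_ideal k \<Longrightarrow> proj u \<in> mpow k"
  by (simp add: mpow_def)

lemma proj_in_mpow_iff:
  assumes "k \<le> d"
  shows "proj u \<in> mpow k \<longleftrightarrow> u \<in> order_ideal k"
proof
  assume "proj u \<in> mpow k"
  then obtain v where v: "v \<in> order_ideal k" "proj u = proj v" by (auto simp: mpow_def)
  then obtain q where "u - v = f * q" by (auto simp: proj_eq_iff elim: dvdE)
  then have "u = v + f * q" by (simp add: algebra_simps)
  then show "u \<in> order_ideal k"
    using v(1) order_ideal_mono[OF f_in_order_ideal assms] by (simp add: order_ideal_add order_ideal_rmult)
qed (rule proj_in_mpow)

lemma mpow_0: "mpow 0 = carrier R"
  by (simp add: mpow_def carrier_R)

lemma mpow_Suc: "ideal_prod R (mpow k) (mpow 1) = mpow (Suc k)"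
proof
  show "ideal_prod R (mpow k) (mpow 1) \<subseteq> mpow (Suc k)"
  proof
    fix r assume "r \<in> ideal_prod R (mpow k) (mpow 1)"
    then show "r \<in> mpow (Suc k)"
    proof induction
      case (prod i j)
      then obtain u v where uv: "i = proj u" "j = proj v" "u \<in> order_ideal k" "v \<in> order_ideal 1"
        by (auto simp only: mpow_def)
      show ?case
        using order_ideal_mult[OF uv(3,4)] by (simp add: uv(1,2) proj_simps proj_in_mpow)
    next
      case (sum s1 s2)
      then show ?case
        using additive_subgroup.a_closed[OF ideal.axioms(1)[OF ideal_mpow]] by blast
    qed
  qed
  show "mpow (Suc k) \<subseteq> ideal_prod R (mpow k) (mpow 1)"
  proof
    fix r assume "r \<in> mpow (Suc k)"
    then obtain u where u: "r = proj u" "u \<in> order_ideal (Suc k)" by (auto simp: mpow_def)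
    obtain v w where vw: "v \<in> order_ideal k" "w \<in> order_ideal k" "u = var_x * v + var_y * w"
      using u(2) unfolding order_ideal_Suc_iff by auto
    have "r = proj v \<otimes>\<^bsub>R\<^esub> proj var_x \<oplus>\<^bsub>R\<^esub> proj w \<otimes>\<^bsub>R\<^esub> proj var_y"
      by (simp add: u(1) vw(3) proj_simps mult.commute)
    also have "\<dots> \<in> ideal_prod R (mpow k) (mpow 1)"
      by (intro ideal_prod.sum ideal_prod.prod proj_in_mpow vw(1,2) var_x_in_order_ideal var_y_in_order_ideal)
    finally show "r \<in> ideal_prod R (mpow k) (mpow 1)" .
  qed
qed

lemma ideal_power_mpow: "ideal_power R (mpow 1) k = mpow k"
proof (induction k)
  case 0
  show ?case by (simp add: nat_pow_def ideals_set_def mpow_0)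
next
  case (Suc k)
  then show ?case using mpow_Suc[of k] by (simp add: nat_pow_def ideals_set_def)
qed

lemma mpow_1_eq: "mpow 1 = Idl\<^bsub>R\<^esub> {proj var_x, proj var_y}"
proof
  interpret R: cring R by (rule cring_R)
  show "Idl\<^bsub>R\<^esub> {proj var_x, proj var_y} \<subseteq> mpow 1"
    by (rule R.genideal_minimal[OF ideal_mpow])
      (use proj_in_mpow[OF var_x_in_order_ideal] proj_in_mpow[OF var_y_in_order_ideal] in blast)
  interpret J: ideal "Idl\<^bsub>R\<^esub> {proj var_x, proj var_y}" R by (rule R.genideal_ideal) simp
  have gen: "proj var_x \<in> Idl\<^bsub>R\<^esub> {proj var_x, proj var_y}" "proj var_y \<in> Idl\<^bsub>R\<^esub> {proj var_x, proj var_y}"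
    using R.genideal_self[of "{proj var_x, proj var_y}"] by simp_all
  show "mpow 1 \<subseteq> Idl\<^bsub>R\<^esub> {proj var_x, proj var_y}"
  proof
    fix r assume "r \<in> mpow 1"
    then obtain u where u: "r = proj u" "u \<in> order_ideal (Suc 0)" by (auto simp: mpow_def)
    obtain v w where "u = var_x * v + var_y * w"
      using u(2) unfolding order_ideal_Suc_iff by auto
    then have "r = proj var_x \<otimes>\<^bsub>R\<^esub> proj v \<oplus>\<^bsub>R\<^esub> proj var_y \<otimes>\<^bsub>R\<^esub> proj w"
      by (simp add: u(1) proj_simps)
    then show "r \<in> Idl\<^bsub>R\<^esub> {proj var_x, proj var_y}"
      using J.I_r_closed[OF gen(1), of "proj v"] J.I_r_closed[OF gen(2), of "proj w"] by simp
  qed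
qed

lemma mpow_d: "ideal_prod R (PIdl\<^bsub>R\<^esub> (proj z)) (mpow (d - 1)) = mpow d"
proof
  show "ideal_prod R (PIdl\<^bsub>R\<^esub> (proj z)) (mpow (d - 1)) \<subseteq> mpow d"
  proof
    fix r assume "r \<in> ideal_prod R (PIdl\<^bsub>R\<^esub> (proj z)) (mpow (d - 1))"
    then show "r \<in> mpow d"
    proof induction
      case (prod i j)
      then obtain t v where tv: "i = proj t \<otimes>\<^bsub>R\<^esub> proj z" "j = proj v" "v \<in> order_ideal (d - 1)"
        by (auto simp: mpow_def cgenideal_def carrier_R)
      have "t * z * v \<in> order_ideal (1 + (d - 1))"
        using tv(3) z_in_order_ideal by (intro order_ideal_mult order_ideal_lmult)
      then show ?case using d_ge_2 by (simp add: tv(1,2) proj_simps proj_in_mpow)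
    next
      case (sum s1 s2)
      then show ?case
        using additive_subgroup.a_closed[OF ideal.axioms(1)[OF ideal_mpow]] by blast
    qed
  qed
  show "mpow d \<subseteq> ideal_prod R (PIdl\<^bsub>R\<^esub> (proj z)) (mpow (d - 1))"
  proof
    fix r assume "r \<in> mpow d"
    then obtain u where u: "r = proj u" "u \<in> order_ideal d" by (auto simp: mpow_def)
    obtain v where v: "v \<in> order_ideal (d - 1)" "f dvd u - z * v"
      using u(2) by (rule order_ideal_reduction)
    have "r = proj z \<otimes>\<^bsub>R\<^esub> proj v" using v(2) by (simp add: u(1) proj_simps proj_eq_iff)
    also have "\<dots> \<in> ideal_prod R (PIdl\<^bsub>R\<^esub> (proj z)) (mpow (d - 1))"
      using ring.cgenideal_self[OF cring.axioms(1)[OF cring_R], of "proj z"] v(1)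
      by (intro ideal_prod.prod) (simp_all add: proj_in_mpow)
    finally show "r \<in> ideal_prod R (PIdl\<^bsub>R\<^esub> (proj z)) (mpow (d - 1))" .
  qed
qed

lemma one_notin_mpow: "\<one>\<^bsub>R\<^esub> \<notin> mpow 1"
proof -
  have "(1 :: 'k power_series2) \<notin> order_ideal 1" by (simp add: order_ideal_def)
  then show ?thesis using proj_in_mpow_iff[of 1 1] d_ge_2 by (simp add: proj_simps)
qed

lemma mpow_proper: "mpow 1 \<noteq> carrier R"
proof
  assume "mpow 1 = carrier R"
  moreover have "\<one>\<^bsub>R\<^esub> \<in> carrier R" unfolding proj_simps(3) by (rule proj_carrier)
  ultimately show False using one_notin_mpow by simp
qed

lemma ideal_not_subset_mpow:
  assumes J: "ideal J R" "\<not> J \<subseteq> mpow 1"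
  shows "J = carrier R"
proof -
  interpret J: ideal J R by (rule J(1))
  obtain u where u: "proj u \<in> J" "proj u \<notin> mpow 1" using J(2) J.a_subset by (auto simp: carrier_R)
  then have "u \<notin> order_ideal 1" using proj_in_mpow by blast
  then have "u dvd 1" by (rule unit_power_series2)
  then obtain v where "1 = u * v" by (rule dvdE)
  then have "u * v = 1" by (rule sym)
  then have "proj u \<otimes>\<^bsub>R\<^esub> proj v = \<one>\<^bsub>R\<^esub>" by (simp add: proj_simps)
  then have "\<one>\<^bsub>R\<^esub> \<in> J" using J.I_r_closed[OF u(1), of "proj v"] by simp
  then show ?thesis by (rule J.one_imp_carrier)
qed

lemma mpow_subset: "mpow k \<subseteq> carrier R" by (auto simp: mpow_def)

lemma maximalideal_mpow: "maximalideal (mpow 1) R"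
proof (rule maximalidealI[OF ideal_mpow])
  show "carrier R \<noteq> mpow 1" using mpow_proper by (rule not_sym)
  show "J = mpow 1 \<or> J = carrier R" if "ideal J R" "mpow 1 \<subseteq> J" "J \<subseteq> carrier R" for J
    using ideal_not_subset_mpow[OF that(1)] that(2) by blast
qed

lemma max_ideal_R: "max_ideal R = mpow 1"
  unfolding max_ideal_def
proof (rule the_equality)
  show "maximalideal (mpow 1) R" by (rule maximalideal_mpow)
  fix J assume "maximalideal J R"
  then interpret J: maximalideal J R .
  have "J \<subseteq> mpow 1"
    using ideal_not_subset_mpow[OF J.is_ideal] J.I_notcarr by blast
  then have "mpow 1 = J \<or> mpow 1 = carrier R"
    using J.I_maximal[OF ideal_mpow] mpow_subset by blast
  then show "J = mpow 1" using mpow_proper by simp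
qed

lemma Idl_proj_iff: "proj u \<in> Idl\<^bsub>R\<^esub> {proj w} \<longleftrightarrow> (\<exists>p. f dvd u - w * p)"
proof -
  have "Idl\<^bsub>R\<^esub> {proj w} = PIdl\<^bsub>R\<^esub> (proj w)"
    by (rule cring.cgenideal_eq_genideal[OF cring_R, symmetric]) simp
  moreover have "PIdl\<^bsub>R\<^esub> (proj w) = {proj (w * p) |p. True}"
  proof
    show "PIdl\<^bsub>R\<^esub> (proj w) \<subseteq> {proj (w * p) |p. True}"
      by (auto simp: cgenideal_def carrier_R proj_simps mult.commute)
    have "proj (w * p) = proj p \<otimes>\<^bsub>R\<^esub> proj w" for p by (simp add: proj_simps mult.commute)
    then show "{proj (w * p) |p. True} \<subseteq> PIdl\<^bsub>R\<^esub> (proj w)"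
      unfolding cgenideal_def using proj_carrier by blast
  qed
  ultimately show ?thesis by (auto simp: proj_eq_iff)
qed

lemma mpow_d_subset_Idl: "mpow d \<subseteq> Idl\<^bsub>R\<^esub> {proj z}"
proof
  fix r assume "r \<in> mpow d"
  then obtain u where u: "r = proj u" "u \<in> order_ideal d" by (auto simp: mpow_def)
  then show "r \<in> Idl\<^bsub>R\<^esub> {proj z}"
    using order_ideal_reduction[OF u(2)] by (auto simp: Idl_proj_iff)
qed

lemma power_multiple_of_z:
  assumes "u \<in> order_ideal 1"
  obtains p where "f dvd u ^ d - z * p"
  using order_ideal_reduction[OF power_in_order_ideal[OF assms, of d]] by blast

lemma Idl_z_subset: "Idl\<^bsub>R\<^esub> {proj z} \<subseteq> mpow 1"
  by (rule ring.genideal_minimal[OF cring.axioms(1)[OF cring_R] ideal_mpow])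
    (use proj_in_mpow[OF z_in_order_ideal] in blast)

lemma prime_power_mem:
  assumes P: "primeideal P R" and u: "proj (u ^ k) \<in> P"
  shows "proj u \<in> P"
proof -
  interpret P: primeideal P R by (rule P)
  show ?thesis using u
  proof (induction k)
    case 0
    then have "\<one>\<^bsub>R\<^esub> \<in> P" by (simp add: proj_simps)
    then show ?case using P.one_imp_carrier P.I_notcarr by blast
  next
    case (Suc k)
    then have "proj u \<otimes>\<^bsub>R\<^esub> proj (u ^ k) \<in> P" by (simp add: proj_simps)
    then show ?case using P.I_prime[of "proj u" "proj (u ^ k)"] Suc.IH by auto
  qed
qed

lemma prime_containing_z:
  assumes P: "primeideal P R" and z: "proj z \<in> P"
  shows "P = mpow 1"
proof
  interpret P: primeideal P R by (rule P)
  show "P \<subseteq> mpow 1"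
    using ideal_not_subset_mpow[OF P.is_ideal] P.I_notcarr by blast
  show "mpow 1 \<subseteq> P"
  proof
    fix r assume "r \<in> mpow 1"
    then obtain u where u: "r = proj u" "u \<in> order_ideal 1" by (auto simp: mpow_def)
    obtain p where "f dvd u ^ d - z * p" using u(2) by (rule power_multiple_of_z)
    then have "proj (u ^ d) = proj z \<otimes>\<^bsub>R\<^esub> proj p" by (simp add: proj_simps proj_eq_iff)
    then have "proj (u ^ d) \<in> P" using P.I_r_closed[OF z, of "proj p"] by simp
    then show "r \<in> P" unfolding u(1) by (rule prime_power_mem[OF P])
  qed
qed

text \<open>For u in Q but not in P, the relation \<open>u^i (z^N + u r) = 0\<close> puts \<open>z^N + u r\<close> into P, hence z into Q.
  A prime ideal that contains z is maximal. Consequently the Krull dimension is at most 1.\<close>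

lemma nonminimal_prime:
  assumes P: "primeideal P R" and Q: "primeideal Q R" and less: "P \<subset> Q"
  shows "Q = mpow 1"
proof -
  interpret P: primeideal P R by (rule P)
  interpret Q: primeideal Q R by (rule Q)
  obtain u where u: "proj u \<in> Q" "proj u \<notin> P" using less Q.a_subset by (auto simp: carrier_R)
  obtain i N r where "f dvd u ^ i * (z ^ N + u * r)" using z_power_relation[of u] by blast
  then have "proj (u ^ i) \<otimes>\<^bsub>R\<^esub> proj (z ^ N + u * r) = \<zero>\<^bsub>R\<^esub>"
    by (simp add: proj_simps proj_eq_zero_iff)
  then have "proj (u ^ i) \<otimes>\<^bsub>R\<^esub> proj (z ^ N + u * r) \<in> P" by simp
  from P.I_prime[OF proj_carrier proj_carrier this]
  have "proj (u ^ i) \<in> P \<or> proj (z ^ N + u * r) \<in> P" .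
  moreover have "proj (u ^ i) \<notin> P"
    using u(2) prime_power_mem[OF P, of u i] by blast
  ultimately have "proj (z ^ N + u * r) \<in> Q"
    using less by blast
  moreover have "proj (u * (- r)) \<in> Q"
    using Q.I_r_closed[OF u(1), of "proj (- r)"] by (simp add: proj_simps)
  ultimately have "proj (z ^ N + u * r) \<oplus>\<^bsub>R\<^esub> proj (u * (- r)) \<in> Q"
    by (rule Q.a_closed)
  then have "proj (z ^ N) \<in> Q" by (simp add: proj_simps)
  then have "proj z \<in> Q" by (rule prime_power_mem[OF Q])
  then show ?thesis by (rule prime_containing_z[OF Q])
qed

lemma exists_nonmaximal_prime: "\<exists>P. primeideal P R \<and> P \<subset> mpow 1"
proof -
  define P where "P = proj ` {u. var_x dvd u}"
  have mem: "proj u \<in> P \<longleftrightarrow> var_x dvd u" for u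
  proof
    assume "proj u \<in> P"
    then obtain v where v: "var_x dvd v" "proj u = proj v" unfolding P_def by blast
    from v(2) have "f dvd u - v" by (simp only: proj_eq_iff)
    then have "var_x dvd (u - v) + v" using dvd_trans[OF x_dvd_f] v(1) by (intro dvd_add)
    then show "var_x dvd u" by simp
  next
    assume "var_x dvd u"
    then show "proj u \<in> P" unfolding P_def by (intro imageI CollectI)
  qed
  have id: "ideal P R"
    unfolding P_def by (rule ideal_projI) simp_all
  have "primeideal P R"
  proof (rule primeidealI[OF id cring_R])
    have "proj 1 \<notin> P"
      unfolding mem by (rule prime_elem_not_unit[OF prime_elem_var_x])
    then show "carrier R \<noteq> P" using proj_carrier[of 1] by metis
    show "a \<in> P \<or> b \<in> P" if ab: "a \<in> carrier R" "b \<in> carrier R" "a \<otimes>\<^bsub>R\<^esub> b \<in> P" for a b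
    proof -
      obtain u where u: "a = proj u" using ab(1) by (rule R_cases)
      obtain v where v: "b = proj v" using ab(2) by (rule R_cases)
      have "var_x dvd u * v" using ab(3) by (simp only: u v proj_simps mem)
      then show ?thesis
        unfolding u v mem by (rule prime_elem_dvd_multD[OF prime_elem_var_x])
    qed
  qed
  moreover have "P \<subset> mpow 1"
  proof
    show "P \<subseteq> mpow 1"
    proof
      fix r assume "r \<in> P"
      then obtain v where v: "var_x dvd v" "r = proj v" unfolding P_def by blast
      from v(1) obtain w where "v = var_x * w" by (rule dvdE)
      then have "v \<in> order_ideal 1" using order_ideal_rmult[OF var_x_in_order_ideal] by simp
      then show "r \<in> mpow 1" unfolding v(2) by (rule proj_in_mpow)
    qed
    have "\<not> var_x dvd (var_y :: 'k power_series2)" by (simp flip: mod_x_eq_0_iff)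
    then have "proj var_y \<notin> P" unfolding mem .
    then show "P \<noteq> mpow 1" using proj_in_mpow[OF var_y_in_order_ideal] by metis
  qed
  ultimately show ?thesis by blast
qed

lemma krull_dim_R: "krull_dim R = 1"
proof -
  let ?C = "\<lambda>l P. (\<forall>i\<le>l. primeideal (P i) R) \<and> (\<forall>i<l. P i \<subset> P (Suc i))"
  let ?D = "{enat l |l. \<exists>P :: nat \<Rightarrow> 'k power_series2 set set. ?C l P}"
  obtain P0 where P0: "primeideal P0 R" "P0 \<subset> mpow 1" using exists_nonmaximal_prime by blast
  let ?P = "\<lambda>i::nat. if i = 0 then P0 else mpow 1"
  have "?C 1 ?P"
    using P0 cring.maximalideal_prime[OF cring_R maximalideal_mpow] by simp
  then have "\<exists>P. ?C 1 P" by (rule exI[of _ ?P])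
  then have "enat 1 \<in> ?D" by blast
  then have "enat 1 \<le> Sup ?D" by (rule Sup_upper)
  moreover have "Sup ?D \<le> enat 1"
  proof (rule Sup_least)
    fix e assume "e \<in> ?D"
    then obtain l P where e: "e = enat l" and P: "?C l P" by blast
    have "l \<le> 1"
    proof (rule ccontr)
      assume "\<not> l \<le> 1"
      then have l: "0 < l" "1 < l" "0 \<le> l" "1 \<le> l" "2 \<le> l" by auto
      have less: "P 0 \<subset> P 1" "P 1 \<subset> P 2" using P l(1,2) by (auto simp: numeral_2_eq_2)
      have "P 1 = mpow 1" by (rule nonminimal_prime[OF _ _ less(1)]) (use P l in auto)
      moreover have "P 2 = mpow 1" by (rule nonminimal_prime[OF _ _ less(2)]) (use P l in auto)
      ultimately show False using less(2) by simp
    qed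
    then show "e \<le> enat 1" unfolding e enat_ord_simps(1) .
  qed
  ultimately have "Sup ?D = enat 1" by (rule order_antisym[rotated])
  then show ?thesis unfolding one_enat_def by (rule trans[OF krull_dim_def])
qed

lemma system_of_parameters_z: "system_of_parameters R [proj z]"
proof -
  have "radical R (Idl\<^bsub>R\<^esub> {proj z}) = mpow 1"
  proof
    show "mpow 1 \<subseteq> radical R (Idl\<^bsub>R\<^esub> {proj z})"
    proof
      fix r assume "r \<in> mpow 1"
      then obtain u where u: "r = proj u" "u \<in> order_ideal 1" by (auto simp: mpow_def)
      obtain p where "f dvd u ^ d - z * p" using u(2) by (rule power_multiple_of_z)
      then have "r [^]\<^bsub>R\<^esub> d \<in> Idl\<^bsub>R\<^esub> {proj z}"
        by (auto simp: u(1) proj_power Idl_proj_iff)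
      then show "r \<in> radical R (Idl\<^bsub>R\<^esub> {proj z})" by (auto simp: radical_def u(1))
    qed
    show "radical R (Idl\<^bsub>R\<^esub> {proj z}) \<subseteq> mpow 1"
    proof
      fix r assume "r \<in> radical R (Idl\<^bsub>R\<^esub> {proj z})"
      then obtain u k where u: "r = proj u" "proj (u ^ k) \<in> Idl\<^bsub>R\<^esub> {proj z}"
        by (auto simp: radical_def carrier_R proj_power)
      then have "proj (u ^ k) \<in> mpow 1" using Idl_z_subset by blast
      then show "r \<in> mpow 1"
        unfolding u(1) by (rule prime_power_mem[OF cring.maximalideal_prime[OF cring_R maximalideal_mpow]])
    qed
  qed
  moreover have "enat (length [proj z]) = krull_dim R"
    unfolding krull_dim_R by (simp add: enat_1_iff)
  ultimately show ?thesis
    unfolding system_of_parameters_def max_ideal_R by simp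
qed

theorem generalized_loewy_length_R: "generalized_loewy_length R = d"
  unfolding generalized_loewy_length_def
proof (rule Least_equality)
  show "1 \<le> d \<and> (\<exists>xs. system_of_parameters R xs \<and> ideal_power R (max_ideal R) d \<subseteq> Idl\<^bsub>R\<^esub> (set xs))"
  proof (intro conjI exI)
    show "1 \<le> d" using d_ge_2 by simp
    show "system_of_parameters R [proj z]" by (rule system_of_parameters_z)
    show "ideal_power R (max_ideal R) d \<subseteq> Idl\<^bsub>R\<^esub> (set [proj z])"
      unfolding max_ideal_R ideal_power_mpow using mpow_d_subset_Idl by simp
  qed
next
  fix l assume "1 \<le> l \<and> (\<exists>xs. system_of_parameters R xs \<and> ideal_power R (max_ideal R) l \<subseteq> Idl\<^bsub>R\<^esub> (set xs))"
  then obtain xs where xs: "system_of_parameters R xs" "mpow l \<subseteq> Idl\<^bsub>R\<^esub> (set xs)"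
    unfolding max_ideal_R ideal_power_mpow by blast
  have "enat (length xs) = 1"
    using xs(1) by (simp only: system_of_parameters_def krull_dim_R)
  then have "length xs = 1" by (simp only: enat_1_iff)
  then obtain r where r: "xs = [r]" by (auto simp: length_Suc_conv)
  have "r \<in> carrier R" using xs(1) unfolding system_of_parameters_def r by simp
  then obtain w where "r = proj w" by (rule R_cases)
  then have w: "xs = [proj w]" using r by simp
  have "proj w \<in> radical R (Idl\<^bsub>R\<^esub> {proj w})"
    unfolding radical_def
  proof (intro CollectI conjI exI[of _ 1])
    show "proj w [^]\<^bsub>R\<^esub> (1::nat) \<in> Idl\<^bsub>R\<^esub> {proj w}"
      unfolding proj_power power_one_right
      by (rule ring.genideal_self'[OF cring.axioms(1)[OF cring_R] proj_carrier])
  qed simp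
  moreover have "radical R (Idl\<^bsub>R\<^esub> (set xs)) = mpow 1"
    using xs(1) unfolding system_of_parameters_def max_ideal_R by (elim conjE)
  moreover have "set xs = {proj w}" by (simp add: w)
  ultimately have "proj w \<in> mpow 1" by (simp only:)
  moreover have "1 \<le> d" using d_ge_2 by simp
  ultimately have w1: "w \<in> order_ideal 1" by (simp only: proj_in_mpow_iff)
  show "d \<le> l"
  proof (rule ccontr)
    assume "\<not> d \<le> l"
    then have "l \<le> d - 1" by simp
    have "\<exists>p. f dvd u - w * p" if u: "u \<in> order_ideal (d - 1)" for u
    proof -
      have "proj u \<in> mpow l" 
        by (rule proj_in_mpow[OF order_ideal_mono[OF u \<open>l \<le> d - 1\<close>]])
      with xs(2) have "proj u \<in> Idl\<^bsub>R\<^esub> (set xs)" by (rule subsetD)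
      then have "proj u \<in> Idl\<^bsub>R\<^esub> {proj w}" unfolding w by simp
      then show ?thesis unfolding Idl_proj_iff .
    qed
    then show False by (rule no_short_power[OF w1])
  qed
qed

end

lemma (in abelian_group) add_minus_cancel_left:
  assumes "x \<in> carrier G" "y \<in> carrier G"
  shows "(x \<oplus> y) \<ominus> x = y"
proof -
  have "(x \<oplus> y) \<ominus> x = y \<oplus> (x \<oplus> \<ominus> x)"
    unfolding a_minus_def a_comm[OF assms] using assms by (intro a_assoc) simp_all
  then show ?thesis using assms by (simp only: r_neg r_zero)
qed

lemma (in abelian_group) minus_add_minus:
  assumes "x \<in> carrier G" "y \<in> carrier G" "v \<in> carrier G" "w \<in> carrier G"
  shows "(v \<ominus> x) \<oplus> (w \<ominus> y) = (v \<oplus> w) \<ominus> (x \<oplus> y)"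
  unfolding a_minus_def using assms by (simp only: minus_add a_ac a_closed a_inv_closed)

lemma (in abelian_group) minus_minus_minus:
  assumes "x \<in> carrier G" "y \<in> carrier G" "v \<in> carrier G"
  shows "(v \<ominus> x) \<ominus> (v \<ominus> y) = y \<ominus> x"
proof -
  have "(v \<ominus> x) \<ominus> (v \<ominus> y) = (v \<oplus> \<ominus> v) \<oplus> (y \<oplus> \<ominus> x)"
    unfolding a_minus_def using assms by (simp only: minus_add minus_minus a_ac a_closed a_inv_closed)
  then show ?thesis using assms unfolding a_minus_def by (simp only: r_neg l_zero a_closed a_inv_closed)
qed

lemma (in abelian_group) minus_zero_imp_eq:
  assumes "x \<in> carrier G" "y \<in> carrier G" "x \<ominus> y = \<zero>"
  shows "x = y"
  using assms(3) assms(1,2) minus_equality[of x "\<ominus> y"] unfolding a_minus_def by simp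

section \<open>Linear maps and free summands\<close>

lemma linear_mapsI:
  assumes "\<And>v. v \<in> carrier M \<Longrightarrow> h v \<in> carrier N"
    and "\<And>v w. v \<in> carrier M \<Longrightarrow> w \<in> carrier M \<Longrightarrow> h (v \<oplus>\<^bsub>M\<^esub> w) = h v \<oplus>\<^bsub>N\<^esub> h w"
    and "\<And>r v. r \<in> carrier R \<Longrightarrow> v \<in> carrier M \<Longrightarrow> h (r \<odot>\<^bsub>M\<^esub> v) = r \<odot>\<^bsub>N\<^esub> h v"
  shows "h \<in> linear_maps R M N"
  using assms by (simp add: linear_maps_def)

lemma linear_mapsD:
  assumes "h \<in> linear_maps R M N"
  shows "v \<in> carrier M \<Longrightarrow> h v \<in> carrier N"
    and "v \<in> carrier M \<Longrightarrow> w \<in> carrier M \<Longrightarrow> h (v \<oplus>\<^bsub>M\<^esub> w) = h v \<oplus>\<^bsub>N\<^esub> h w"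
    and "r \<in> carrier R \<Longrightarrow> v \<in> carrier M \<Longrightarrow> h (r \<odot>\<^bsub>M\<^esub> v) = r \<odot>\<^bsub>N\<^esub> h v"
  using assms by (auto simp: linear_maps_def)

lemma regular_module_simps [simp]: "carrier (regular_module R) = carrier R"
  "\<zero>\<^bsub>regular_module R\<^esub> = \<zero>\<^bsub>R\<^esub>" "r \<oplus>\<^bsub>regular_module R\<^esub> s = r \<oplus>\<^bsub>R\<^esub> s"
  "r \<odot>\<^bsub>regular_module R\<^esub> s = r \<otimes>\<^bsub>R\<^esub> s"
  by (simp_all add: regular_module_def)

lemma free_module_simps [simp]: "carrier (free_module R n) = {..<n} \<rightarrow>\<^sub>E carrier R"
  "\<zero>\<^bsub>free_module R n\<^esub> = (\<lambda>i\<in>{..<n}. \<zero>\<^bsub>R\<^esub>)"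
  "v \<oplus>\<^bsub>free_module R n\<^esub> w = (\<lambda>i\<in>{..<n}. v i \<oplus>\<^bsub>R\<^esub> w i)"
  "r \<odot>\<^bsub>free_module R n\<^esub> v = (\<lambda>i\<in>{..<n}. r \<otimes>\<^bsub>R\<^esub> v i)"
  by (simp_all add: free_module_def)

lemma free_module_is_module:
  assumes "cring R"
  shows "Module.module R (free_module R n)"
proof -
  interpret R: cring R by (rule assms)
  have closed: "v i \<in> carrier R" if "v \<in> carrier (free_module R n)" "i \<in> {..<n}" for v i
    using that by (auto simp: PiE_iff)
  have ext: "v = w" if "v \<in> carrier (free_module R n)" "w \<in> carrier (free_module R n)"
    "\<And>i. i \<in> {..<n} \<Longrightarrow> v i = w i" for v w
    by (rule PiE_ext[of _ "{..<n}" "\<lambda>_. carrier R"]) (use that in simp_all)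
  have mem: "(\<lambda>i\<in>{..<n}. g i) \<in> carrier (free_module R n)" if "\<And>i. i \<in> {..<n} \<Longrightarrow> g i \<in> carrier R" for g
    using that by (auto simp only: free_module_simps restrict_PiE_iff)
  have add: "v \<oplus>\<^bsub>free_module R n\<^esub> w \<in> carrier (free_module R n)"
    if "v \<in> carrier (free_module R n)" "w \<in> carrier (free_module R n)" for v w
    unfolding free_module_simps(3) by (intro mem R.a_closed closed[OF that(1)] closed[OF that(2)])
  have smult: "r \<odot>\<^bsub>free_module R n\<^esub> v \<in> carrier (free_module R n)"
    if "r \<in> carrier R" "v \<in> carrier (free_module R n)" for r v
    unfolding free_module_simps(4) by (intro mem R.m_closed that(1) closed[OF that(2)])
  have zero: "\<zero>\<^bsub>free_module R n\<^esub> \<in> carrier (free_module R n)"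
    unfolding free_module_simps(2) by (intro mem R.zero_closed)
  note eval = free_module_simps(2-4) restrict_apply'
  show ?thesis
  proof (rule moduleI)
    show "abelian_group (free_module R n)"
    proof (rule abelian_groupI)
      fix v assume v: "v \<in> carrier (free_module R n)"
      let ?w = "\<lambda>i\<in>{..<n}. \<ominus>\<^bsub>R\<^esub> v i"
      have w: "?w \<in> carrier (free_module R n)" using closed[OF v] by (intro mem R.a_inv_closed)
      have "?w \<oplus>\<^bsub>free_module R n\<^esub> v = \<zero>\<^bsub>free_module R n\<^esub>"
        by (rule ext[OF add[OF w v] zero]) (simp only: eval R.l_neg closed[OF v])
      then show "\<exists>w\<in>carrier (free_module R n). w \<oplus>\<^bsub>free_module R n\<^esub> v = \<zero>\<^bsub>free_module R n\<^esub>"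
        using w by (rule bexI)
      show "\<zero>\<^bsub>free_module R n\<^esub> \<oplus>\<^bsub>free_module R n\<^esub> v = v"
        by (rule ext[OF add[OF zero v] v]) (simp only: eval R.l_zero closed[OF v])
      fix w assume w: "w \<in> carrier (free_module R n)"
      show "v \<oplus>\<^bsub>free_module R n\<^esub> w = w \<oplus>\<^bsub>free_module R n\<^esub> v"
        by (rule ext[OF add[OF v w] add[OF w v]]) (simp only: eval R.a_comm[OF closed[OF v] closed[OF w]])
      fix u assume u: "u \<in> carrier (free_module R n)"
      show "v \<oplus>\<^bsub>free_module R n\<^esub> w \<oplus>\<^bsub>free_module R n\<^esub> u = v \<oplus>\<^bsub>free_module R n\<^esub> (w \<oplus>\<^bsub>free_module R n\<^esub> u)"
        by (rule ext[OF add[OF add[OF v w] u] add[OF v add[OF w u]]])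
          (simp only: eval R.a_assoc[OF closed[OF v] closed[OF w] closed[OF u]])
    qed (fact zero add)+
    fix v assume v: "v \<in> carrier (free_module R n)"
    show "\<one>\<^bsub>R\<^esub> \<odot>\<^bsub>free_module R n\<^esub> v = v"
      by (rule ext[OF smult[OF R.one_closed v] v]) (simp only: eval R.l_one closed[OF v])
    fix r assume r: "r \<in> carrier R"
    show "r \<odot>\<^bsub>free_module R n\<^esub> v \<in> carrier (free_module R n)" by (rule smult[OF r v])
    show "r \<odot>\<^bsub>free_module R n\<^esub> (v \<oplus>\<^bsub>free_module R n\<^esub> w) =
        r \<odot>\<^bsub>free_module R n\<^esub> v \<oplus>\<^bsub>free_module R n\<^esub> r \<odot>\<^bsub>free_module R n\<^esub> w"
      if w: "w \<in> carrier (free_module R n)" for w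
      by (rule ext[OF smult[OF r add[OF v w]] add[OF smult[OF r v] smult[OF r w]]])
        (simp only: eval R.r_distr[OF closed[OF v] closed[OF w] r])
    fix s assume s: "s \<in> carrier R"
    show "(r \<oplus>\<^bsub>R\<^esub> s) \<odot>\<^bsub>free_module R n\<^esub> v = r \<odot>\<^bsub>free_module R n\<^esub> v \<oplus>\<^bsub>free_module R n\<^esub> s \<odot>\<^bsub>free_module R n\<^esub> v"
      by (rule ext[OF smult[OF R.a_closed[OF r s] v] add[OF smult[OF r v] smult[OF s v]]])
        (simp only: eval R.l_distr[OF r s closed[OF v]])
    show "(r \<otimes>\<^bsub>R\<^esub> s) \<odot>\<^bsub>free_module R n\<^esub> v = r \<odot>\<^bsub>free_module R n\<^esub> (s \<odot>\<^bsub>free_module R n\<^esub> v)"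
      by (rule ext[OF smult[OF R.m_closed[OF r s] v] smult[OF r smult[OF s v]]])
        (simp only: eval R.m_assoc[OF r s closed[OF v]])
  qed (rule assms)
qed

lemma regular_module_is_module:
  assumes "cring R"
  shows "Module.module R (regular_module R)"
proof -
  interpret R: cring R by (rule assms)
  show ?thesis
  proof (rule moduleI)
    show "abelian_group (regular_module R)"
    proof (rule abelian_groupI)
      fix x assume "x \<in> carrier (regular_module R)"
      then show "\<exists>y\<in>carrier (regular_module R). y \<oplus>\<^bsub>regular_module R\<^esub> x = \<zero>\<^bsub>regular_module R\<^esub>"
        by (intro bexI[of _ "\<ominus>\<^bsub>R\<^esub> x"]) (simp_all add: R.l_neg)
    next
      fix x y z assume "x \<in> carrier (regular_module R)" "y \<in> carrier (regular_module R)" "z \<in> carrier (regular_module R)"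
      then show "x \<oplus>\<^bsub>regular_module R\<^esub> y \<oplus>\<^bsub>regular_module R\<^esub> z = x \<oplus>\<^bsub>regular_module R\<^esub> (y \<oplus>\<^bsub>regular_module R\<^esub> z)"
        by (simp add: R.a_assoc)
    next
      fix x y assume "x \<in> carrier (regular_module R)" "y \<in> carrier (regular_module R)"
      then show "x \<oplus>\<^bsub>regular_module R\<^esub> y = y \<oplus>\<^bsub>regular_module R\<^esub> x"
        by (simp add: R.a_comm)
    qed simp_all
  qed (simp_all add: R.is_cring R.l_distr R.r_distr R.m_assoc)
qed

context plain_module
begin

lemma linear_maps_zero:
  assumes h: "h \<in> linear_maps R M N" and N: "Module.module R N"
  shows "h \<zero>\<^bsub>M\<^esub> = \<zero>\<^bsub>N\<^esub>"
proof -
  interpret N: Module.module R N by (rule N)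
  show ?thesis
    using linear_mapsD(3)[OF h, of \<zero> "\<zero>\<^bsub>M\<^esub>"] linear_mapsD(1)[OF h, of "\<zero>\<^bsub>M\<^esub>"] by simp
qed

lemma free_summand_of_functional:
  assumes phi: "\<phi> \<in> linear_maps R M (regular_module R)" and v1: "v1 \<in> carrier M" "\<phi> v1 = \<one>"
  shows "has_free_summand R M"
proof -
  have phiD1: "\<phi> v \<in> carrier R" if "v \<in> carrier M" for v
    using linear_mapsD(1)[OF phi that] by simp
  have phiD2: "\<phi> (v \<oplus>\<^bsub>M\<^esub> w) = \<phi> v \<oplus> \<phi> w" if "v \<in> carrier M" "w \<in> carrier M" for v w
    using linear_mapsD(2)[OF phi that] by simp
  have phiD3: "\<phi> (r \<odot>\<^bsub>M\<^esub> v) = r \<otimes> \<phi> v" if "r \<in> carrier R" "v \<in> carrier M" for r v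
    using linear_mapsD(3)[OF phi that] by simp
  let ?F = "(\<lambda>r. r \<odot>\<^bsub>M\<^esub> v1) ` carrier R"
  let ?N = "{v \<in> carrier M. \<phi> v = \<zero>}"
  let ?h = "\<lambda>g :: nat \<Rightarrow> 'a. g 0 \<odot>\<^bsub>M\<^esub> v1"
  have phi_F: "\<phi> (r \<odot>\<^bsub>M\<^esub> v1) = r" if "r \<in> carrier R" for r
    using phiD3[OF that v1(1)] that unfolding v1(2) by simp
  have zero: "\<phi> \<zero>\<^bsub>M\<^esub> = \<zero>"
    using phi_F[of \<zero>] v1(1) by simp
  have F: "submodule ?F R M"
  proof (rule submoduleI)
    show "?F \<subseteq> carrier M" using v1 by auto
    show "\<zero>\<^bsub>M\<^esub> \<in> ?F" using v1 by (intro image_eqI[of _ _ \<zero>]) simp_all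
    show "\<ominus>\<^bsub>M\<^esub> v \<in> ?F" if "v \<in> ?F" for v
      using that v1 by (auto simp flip: smult_l_minus)
    show "v \<oplus>\<^bsub>M\<^esub> w \<in> ?F" if "v \<in> ?F" "w \<in> ?F" for v w
      using that v1 by (auto simp flip: smult_l_distr)
    show "s \<odot>\<^bsub>M\<^esub> v \<in> ?F" if "s \<in> carrier R" "v \<in> ?F" for s v
      using that v1 by (auto simp flip: smult_assoc1)
  qed
  have N: "submodule ?N R M"
  proof (rule submoduleI)
    show "?N \<subseteq> carrier M" by blast
    show "\<zero>\<^bsub>M\<^esub> \<in> ?N" using zero by simp
    show "v \<oplus>\<^bsub>M\<^esub> w \<in> ?N" if "v \<in> ?N" "w \<in> ?N" for v w
      using that phiD2[of v w] by simp
    show smult: "r \<odot>\<^bsub>M\<^esub> v \<in> ?N" if "r \<in> carrier R" "v \<in> ?N" for r v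
      using that phiD3[of r v] by simp
    show "\<ominus>\<^bsub>M\<^esub> v \<in> ?N" if v: "v \<in> ?N" for v
    proof -
      have "(\<ominus> \<one>) \<odot>\<^bsub>M\<^esub> v = \<ominus>\<^bsub>M\<^esub> v" using v smult_l_minus[of \<one> v] by simp
      then show ?thesis using smult[of "\<ominus> \<one>" v] v by simp
    qed
  qed
  have inter: "?F \<inter> ?N = {\<zero>\<^bsub>M\<^esub>}"
  proof -
    have "v = \<zero>\<^bsub>M\<^esub>" if v: "v \<in> ?F" "v \<in> ?N" for v
    proof -
      obtain r where r: "r \<in> carrier R" "v = r \<odot>\<^bsub>M\<^esub> v1" using v(1) by blast
      then have "r = \<zero>" using phi_F[OF r(1)] v(2) by simp
      then show ?thesis using r v1 by simp
    qed
    then show ?thesis using submodule_zero[OF F] submodule_zero[OF N] by blast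
  qed
  have sum: "?F <+>\<^bsub>M\<^esub> ?N = carrier M"
  proof
    show "?F <+>\<^bsub>M\<^esub> ?N \<subseteq> carrier M" using v1 by (auto simp: set_add_def')
    show "carrier M \<subseteq> ?F <+>\<^bsub>M\<^esub> ?N"
    proof
      fix v assume v: "v \<in> carrier M"
      define w where "w = v \<oplus>\<^bsub>M\<^esub> (\<ominus> \<phi> v) \<odot>\<^bsub>M\<^esub> v1"
      have "\<phi> w = \<phi> v \<oplus> \<phi> ((\<ominus> \<phi> v) \<odot>\<^bsub>M\<^esub> v1)"
        unfolding w_def using v v1(1) phiD1[OF v] by (intro phiD2) simp_all
      also have "\<phi> ((\<ominus> \<phi> v) \<odot>\<^bsub>M\<^esub> v1) = \<ominus> \<phi> v" using phiD1[OF v] by (intro phi_F) simp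
      also have "\<phi> v \<oplus> \<ominus> \<phi> v = \<zero>" using phiD1[OF v] by (rule R.r_neg)
      finally have "w \<in> ?N" using v v1(1) phiD1[OF v] by (simp add: w_def)
      moreover have "v = \<phi> v \<odot>\<^bsub>M\<^esub> v1 \<oplus>\<^bsub>M\<^esub> w"
      proof -
        have "\<phi> v \<odot>\<^bsub>M\<^esub> v1 \<oplus>\<^bsub>M\<^esub> w = v \<oplus>\<^bsub>M\<^esub> (\<phi> v \<oplus> \<ominus> \<phi> v) \<odot>\<^bsub>M\<^esub> v1"
          unfolding w_def using v v1(1) phiD1[OF v] by (simp add: smult_l_distr M.a_lcomm)
        also have "\<phi> v \<oplus> \<ominus> \<phi> v = \<zero>" using phiD1[OF v] by (rule R.r_neg)
        finally show ?thesis using v v1(1) by simp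
      qed
      ultimately show "v \<in> ?F <+>\<^bsub>M\<^esub> ?N"
        using phiD1[OF v] unfolding set_add_def' by blast
    qed
  qed
  have lin: "?h \<in> linear_maps R (free_module R 1) (M\<lparr>carrier := ?F\<rparr>)"
    using v1 by (intro linear_mapsI) (auto simp: PiE_iff smult_l_distr smult_assoc1)
  have bij: "bij_betw ?h (carrier (free_module R 1)) ?F"
  proof (rule bij_betw_imageI)
    show "inj_on ?h (carrier (free_module R 1))"
    proof (rule inj_onI)
      fix g g' assume g: "g \<in> carrier (free_module R 1)" "g' \<in> carrier (free_module R 1)"
        and eq: "?h g = ?h g'"
      have g0: "g 0 \<in> carrier R" "g' 0 \<in> carrier R" using g by (auto simp: PiE_iff)
      have "\<phi> (?h g) = \<phi> (?h g')" using eq by (rule arg_cong)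
      then have "g 0 = g' 0" unfolding phi_F[OF g0(1)] phi_F[OF g0(2)] .
      then have "g i = g' i" if "i \<in> {..<1}" for i using that by simp
      with g show "g = g'" unfolding free_module_simps(1) by (rule PiE_ext)
    qed
    show "?h ` carrier (free_module R 1) = ?F"
    proof
      show "?h ` carrier (free_module R 1) \<subseteq> ?F" by (auto simp: PiE_iff)
      show "?F \<subseteq> ?h ` carrier (free_module R 1)"
      proof
        fix v assume "v \<in> ?F"
        then obtain r where r: "r \<in> carrier R" "v = r \<odot>\<^bsub>M\<^esub> v1" by blast
        have "v = ?h (\<lambda>i\<in>{..<1}. r)" unfolding r(2) by simp
        moreover have "(\<lambda>i\<in>{..<1}. r) \<in> carrier (free_module R 1)" using r(1) by simp
        ultimately show "v \<in> ?h ` carrier (free_module R 1)" by (rule image_eqI)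
      qed
    qed
  qed
  show ?thesis
    unfolding has_free_summand_def
  proof (intro exI conjI)
    show "submodule ?F R M" by (rule F)
    show "submodule ?N R M" by (rule N)
    show "?F \<inter> ?N = {\<zero>\<^bsub>M\<^esub>}" by (rule inter)
    show "?F <+>\<^bsub>M\<^esub> ?N = carrier M" by (rule sum)
    show "(1::nat) \<le> 1" by (rule order_refl)
    show "\<exists>h\<in>linear_maps R (free_module R 1) (M\<lparr>carrier := ?F\<rparr>). bij_betw h (carrier (free_module R 1)) ?F"
      using bij lin by (rule bexI)
  qed
qed

text \<open>The functional is the first coordinate of the projection onto the free summand.\<close>

lemma functional_of_free_summand:
  assumes "has_free_summand R M"
  obtains \<phi> v1 where "\<phi> \<in> linear_maps R M (regular_module R)" "v1 \<in> carrier M" "\<phi> v1 = \<one>"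
proof -
  obtain F N k h where F: "submodule F R M" and N: "submodule N R M"
    and FN: "F \<inter> N = {\<zero>\<^bsub>M\<^esub>}" "F <+>\<^bsub>M\<^esub> N = carrier M" and k: "k \<ge> 1"
    and h: "h \<in> linear_maps R (free_module R k) (M\<lparr>carrier := F\<rparr>)"
    and bij: "bij_betw h (carrier (free_module R k)) F"
    using assms unfolding has_free_summand_def by blast
  interpret C: plain_module R "free_module R k"
    unfolding plain_module_def by (rule free_module_is_module[OF R.is_cring])
  let ?C = "carrier (free_module R k)"
  have hD1: "h c \<in> F" if "c \<in> ?C" for c
    using linear_mapsD(1)[OF h that] by simp
  have hD2: "h (c \<oplus>\<^bsub>free_module R k\<^esub> c') = h c \<oplus>\<^bsub>M\<^esub> h c'" if "c \<in> ?C" "c' \<in> ?C" for c c'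
    using linear_mapsD(2)[OF h that] by simp
  have hD3: "h (r \<odot>\<^bsub>free_module R k\<^esub> c) = r \<odot>\<^bsub>M\<^esub> h c" if "r \<in> carrier R" "c \<in> ?C" for r c
    using linear_mapsD(3)[OF h that] by simp
  have FM: "F \<subseteq> carrier M" by (rule submoduleE(1)[OF F])
  have hM: "h c \<in> F" "h c \<in> carrier M" if "c \<in> ?C" for c
    using hD1[OF that] FM by auto
  define G where "G = (\<lambda>v c. c \<in> ?C \<and> v \<ominus>\<^bsub>M\<^esub> h c \<in> N)"
  have ex: "\<exists>c. G v c" if v: "v \<in> carrier M" for v
  proof -
    have "v \<in> F <+>\<^bsub>M\<^esub> N" using v FN(2) by simp
    then obtain x y where xy: "x \<in> F" "y \<in> N" "v = x \<oplus>\<^bsub>M\<^esub> y"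
      unfolding set_add_def' by blast
    obtain c where c: "c \<in> ?C" "h c = x" using bij xy(1) unfolding bij_betw_def by blast
    have "x \<in> carrier M" "y \<in> carrier M" using xy FM submoduleE(1)[OF N] by auto
    then have "v \<ominus>\<^bsub>M\<^esub> h c = y"
      unfolding c(2) xy(3) by (rule M.add_minus_cancel_left)
    then show ?thesis using c(1) xy(2) unfolding G_def by blast
  qed
  have un: "c = c'" if v: "v \<in> carrier M" and c: "G v c" "G v c'" for v c c'
  proof -
    have cc: "c \<in> ?C" "c' \<in> ?C" using c by (simp_all add: G_def)
    have "(v \<ominus>\<^bsub>M\<^esub> h c') \<ominus>\<^bsub>M\<^esub> (v \<ominus>\<^bsub>M\<^esub> h c) \<in> N"
      by (rule submodule_diff[OF N]) (use c in \<open>simp_all only: G_def\<close>)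
    also have "(v \<ominus>\<^bsub>M\<^esub> h c') \<ominus>\<^bsub>M\<^esub> (v \<ominus>\<^bsub>M\<^esub> h c) = h c \<ominus>\<^bsub>M\<^esub> h c'"
      by (rule M.minus_minus_minus[OF hM(2)[OF cc(2)] hM(2)[OF cc(1)] v])
    finally have "h c \<ominus>\<^bsub>M\<^esub> h c' \<in> F \<inter> N"
      using submodule_diff[OF F] hM(1) cc by blast
    then have "h c \<ominus>\<^bsub>M\<^esub> h c' = \<zero>\<^bsub>M\<^esub>" using FN(1) by blast
    then have "h c = h c'"
      by (rule M.minus_zero_imp_eq[OF hM(2)[OF cc(1)] hM(2)[OF cc(2)]])
    then show ?thesis using bij cc unfolding bij_betw_def inj_on_def by blast
  qed
  define g where "g = (\<lambda>v. THE c. G v c)"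
  have g: "G v (g v)" if v: "v \<in> carrier M" for v
  proof -
    obtain c where c: "G v c" using ex[OF v] by (rule exE)
    show ?thesis unfolding g_def by (rule theI[where P = "G v", OF c]) (rule un[OF v _ c])
  qed
  have g_eq: "g v = c" if "v \<in> carrier M" "G v c" for v c
    using un[OF that(1) g[OF that(1)] that(2)] .
  have gC: "g v \<in> ?C" if "v \<in> carrier M" for v using g[OF that] by (simp add: G_def)
  have g_add: "g (v \<oplus>\<^bsub>M\<^esub> w) = g v \<oplus>\<^bsub>free_module R k\<^esub> g w" if vw: "v \<in> carrier M" "w \<in> carrier M" for v w
  proof (rule g_eq)
    have "(v \<ominus>\<^bsub>M\<^esub> h (g v)) \<oplus>\<^bsub>M\<^esub> (w \<ominus>\<^bsub>M\<^esub> h (g w)) \<in> N"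
      using g[OF vw(1)] g[OF vw(2)] submoduleE(5)[OF N] by (simp add: G_def)
    also have "(v \<ominus>\<^bsub>M\<^esub> h (g v)) \<oplus>\<^bsub>M\<^esub> (w \<ominus>\<^bsub>M\<^esub> h (g w)) =
        (v \<oplus>\<^bsub>M\<^esub> w) \<ominus>\<^bsub>M\<^esub> (h (g v) \<oplus>\<^bsub>M\<^esub> h (g w))"
      by (rule M.minus_add_minus[OF hM(2)[OF gC[OF vw(1)]] hM(2)[OF gC[OF vw(2)]] vw])
    also have "h (g v) \<oplus>\<^bsub>M\<^esub> h (g w) = h (g v \<oplus>\<^bsub>free_module R k\<^esub> g w)"
      by (rule hD2[OF gC[OF vw(1)] gC[OF vw(2)], symmetric])
    finally show "G (v \<oplus>\<^bsub>M\<^esub> w) (g v \<oplus>\<^bsub>free_module R k\<^esub> g w)"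
      using C.M.a_closed[OF gC[OF vw(1)] gC[OF vw(2)]] by (simp add: G_def)
  qed (use vw in simp)
  have g_smult: "g (r \<odot>\<^bsub>M\<^esub> v) = r \<odot>\<^bsub>free_module R k\<^esub> g v" if r: "r \<in> carrier R" and v: "v \<in> carrier M" for r v
  proof (rule g_eq)
    have "r \<odot>\<^bsub>M\<^esub> (v \<ominus>\<^bsub>M\<^esub> h (g v)) \<in> N"
      using g[OF v] submoduleE(4)[OF N r] by (simp add: G_def)
    also have "r \<odot>\<^bsub>M\<^esub> (v \<ominus>\<^bsub>M\<^esub> h (g v)) = r \<odot>\<^bsub>M\<^esub> v \<ominus>\<^bsub>M\<^esub> r \<odot>\<^bsub>M\<^esub> h (g v)"
      using r v hM(2)[OF gC[OF v]] by (simp add: a_minus_def smult_r_distr smult_r_minus)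
    also have "r \<odot>\<^bsub>M\<^esub> h (g v) = h (r \<odot>\<^bsub>free_module R k\<^esub> g v)"
      by (rule hD3[OF r gC[OF v], symmetric])
    finally show "G (r \<odot>\<^bsub>M\<^esub> v) (r \<odot>\<^bsub>free_module R k\<^esub> g v)"
      using C.smult_closed[OF r gC[OF v]] by (simp add: G_def)
  qed (use r v in simp)
  define e0 where "e0 = (\<lambda>i\<in>{..<k}. if i = 0 then \<one> else \<zero>)"
  have e0: "e0 \<in> ?C" by (auto simp: e0_def)
  have "h e0 \<ominus>\<^bsub>M\<^esub> h e0 \<in> N"
    using hM(2)[OF e0] submodule_zero[OF N] by (simp add: a_minus_def M.r_neg)
  then have "g (h e0) = e0" using e0 hM(2)[OF e0] by (intro g_eq) (simp_all add: G_def)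
  moreover have "(\<lambda>v. g v 0) \<in> linear_maps R M (regular_module R)"
    using k gC by (intro linear_mapsI) (auto simp: g_add g_smult PiE_iff)
  ultimately show ?thesis
    using that[of "\<lambda>v. g v 0" "h e0"] hM(2)[OF e0] k by (simp add: e0_def)
qed

end

section \<open>The delta invariant of a cyclic module\<close>

lemma zero_module_not_free:
  fixes R :: "'a ring" and X :: "('a, 'b) module"
  assumes "Module.module R X" "carrier X = {\<zero>\<^bsub>X\<^esub>}" "\<one>\<^bsub>R\<^esub> \<noteq> \<zero>\<^bsub>R\<^esub>"
  shows "\<not> has_free_summand R X"
proof
  interpret X: plain_module R X unfolding plain_module_def by (rule assms(1))
  assume "has_free_summand R X"
  then obtain \<phi> v1 where phi: "\<phi> \<in> linear_maps R X (regular_module R)" "v1 \<in> carrier X" "\<phi> v1 = \<one>\<^bsub>R\<^esub>"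
    by (rule X.functional_of_free_summand)
  have "\<phi> \<zero>\<^bsub>X\<^esub> = \<zero>\<^bsub>R\<^esub>"
    using X.linear_maps_zero[OF phi(1) regular_module_is_module[OF X.R.is_cring]] by simp
  then show False using phi(2,3) assms(2,3) by simp
qed

text \<open>The condition that the delta invariant is 0, without the trivial summand \<open>R^0\<close>.\<close>

definition covered_without_free_summand :: "'a ring \<Rightarrow> ('a, 'b) module \<Rightarrow> bool"
  where "covered_without_free_summand R M \<longleftrightarrow>
    (\<exists>X :: ('a, (nat \<Rightarrow> 'a) set) module. maximal_cohen_macaulay R X \<and> \<not> has_free_summand R X \<and>
       (\<exists>h\<in>linear_maps R X M. h ` carrier X = carrier M))"

lemma module_sum_simps [simp]: "carrier (module_sum M N) = carrier M \<times> carrier N"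
  "\<zero>\<^bsub>module_sum M N\<^esub> = (\<zero>\<^bsub>M\<^esub>, \<zero>\<^bsub>N\<^esub>)"
  "p \<oplus>\<^bsub>module_sum M N\<^esub> q = (fst p \<oplus>\<^bsub>M\<^esub> fst q, snd p \<oplus>\<^bsub>N\<^esub> snd q)"
  "r \<odot>\<^bsub>module_sum M N\<^esub> p = (r \<odot>\<^bsub>M\<^esub> fst p, r \<odot>\<^bsub>N\<^esub> snd p)"
  by (simp_all add: module_sum_def case_prod_beta)

lemma covered_iff_delta_zero:
  fixes R :: "'a ring" and M :: "('a, 'b) module"
  shows "covered_without_free_summand R M \<longleftrightarrow>
    (\<exists>X :: ('a, (nat \<Rightarrow> 'a) set) module. maximal_cohen_macaulay R X \<and> \<not> has_free_summand R X \<and>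
       (\<exists>h\<in>linear_maps R (module_sum X (free_module R 0)) M.
          h ` carrier (module_sum X (free_module R 0)) = carrier M))"
proof -
  have sum: "carrier (module_sum X (free_module R 0)) = (\<lambda>v. (v, \<lambda>i. undefined)) ` carrier X"
    for X :: "('a, (nat \<Rightarrow> 'a) set) module"
    by auto
  have "(\<exists>h\<in>linear_maps R X M. h ` carrier X = carrier M) \<longleftrightarrow>
    (\<exists>h\<in>linear_maps R (module_sum X (free_module R 0)) M.
          h ` carrier (module_sum X (free_module R 0)) = carrier M)"
    for X :: "('a, (nat \<Rightarrow> 'a) set) module"
  proof
    assume "\<exists>h\<in>linear_maps R X M. h ` carrier X = carrier M"
    then obtain h where h: "h \<in> linear_maps R X M" "h ` carrier X = carrier M" by blast
    have "(h \<circ> fst) \<in> linear_maps R (module_sum X (free_module R 0)) M"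
      using linear_mapsD[OF h(1)] by (intro linear_mapsI) auto
    moreover have "(h \<circ> fst) ` carrier (module_sum X (free_module R 0)) = carrier M"
      unfolding sum image_image using h(2) by simp
    ultimately show "\<exists>h\<in>linear_maps R (module_sum X (free_module R 0)) M.
          h ` carrier (module_sum X (free_module R 0)) = carrier M" by blast
  next
    assume "\<exists>h\<in>linear_maps R (module_sum X (free_module R 0)) M.
          h ` carrier (module_sum X (free_module R 0)) = carrier M"
    then obtain h where h: "h \<in> linear_maps R (module_sum X (free_module R 0)) M"
      "h ` carrier (module_sum X (free_module R 0)) = carrier M" by blast
    let ?h = "\<lambda>v. h (v, \<lambda>i. undefined)"
    note hD = linear_mapsD[OF h(1)]
    have "?h \<in> linear_maps R X M"
    proof (rule linear_mapsI)
      show "?h (v \<oplus>\<^bsub>X\<^esub> w) = ?h v \<oplus>\<^bsub>M\<^esub> ?h w" if "v \<in> carrier X" "w \<in> carrier X" for v w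
        using hD(2)[of "(v, \<lambda>i. undefined)" "(w, \<lambda>i. undefined)"] that by (simp add: restrict_def)
      show "?h (r \<odot>\<^bsub>X\<^esub> v) = r \<odot>\<^bsub>M\<^esub> ?h v" if "r \<in> carrier R" "v \<in> carrier X" for r v
        using hD(3)[of r "(v, \<lambda>i. undefined)"] that by (simp add: restrict_def)
    qed (use hD(1) in simp)
    moreover have "?h ` carrier X = carrier M"
      using h(2) unfolding sum image_image .
    ultimately show "\<exists>h\<in>linear_maps R X M. h ` carrier X = carrier M" by blast
  qed
  then show ?thesis unfolding covered_without_free_summand_def by simp
qed

lemma ideal_submodule:
  fixes R :: "'a ring"
  assumes "cring R" "ideal J R"
  shows "submodule J R (regular_module R)"
proof -
  interpret R: cring R by (rule assms(1))
  interpret A: plain_module R "regular_module R"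
    unfolding plain_module_def by (rule regular_module_is_module[OF assms(1)])
  interpret J: ideal J R by (rule assms(2))
  show "submodule J R (regular_module R)"
  proof (rule A.submoduleI)
    show "\<ominus>\<^bsub>regular_module R\<^esub> r \<in> J" if r: "r \<in> J" for r
    proof -
      have "\<ominus>\<^bsub>regular_module R\<^esub> r = \<ominus>\<^bsub>R\<^esub> r"
        using r J.a_subset by (intro A.M.minus_equality) (auto simp: R.l_neg)
      then show ?thesis using r by simp
    qed
  next
    show "r \<odot>\<^bsub>regular_module R\<^esub> x \<in> J" if "r \<in> carrier R" "x \<in> J" for r x
      using J.I_l_closed[OF that(2,1)] by simp
  qed (simp_all add: J.a_subset)
qed

text \<open>Since R maps onto \<open>R / J\<close>, one copy of R together with \<open>X = 0\<close> suffices, so the invariant is 0 or 1.\<close>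

lemma delta_invariant_cyclic:
  fixes R :: "'a ring" and J :: "'a set"
  assumes "cring R" "\<one>\<^bsub>R\<^esub> \<noteq> \<zero>\<^bsub>R\<^esub>" "ideal J R"
  shows "delta_invariant R (quotient_module (regular_module R) J) = 1 \<longleftrightarrow>
    \<not> covered_without_free_summand R (quotient_module (regular_module R) J)"
proof -
  interpret R: cring R by (rule assms(1))
  interpret A: plain_module R "regular_module R"
    unfolding plain_module_def by (rule regular_module_is_module[OF assms(1)])
  have J: "submodule J R (regular_module R)" by (rule ideal_submodule[OF assms(1,3)])
  let ?M = "quotient_module (regular_module R) J"
  let ?Q = "\<lambda>n. \<exists>X :: ('a, (nat \<Rightarrow> 'a) set) module.
              maximal_cohen_macaulay R X \<and> \<not> has_free_summand R X \<and>
              (\<exists>h\<in>linear_maps R (module_sum X (free_module R n)) ?M.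
                 h ` carrier (module_sum X (free_module R n)) = carrier ?M)"
  have Q1: "?Q 1"
  proof -
    define X :: "('a, (nat \<Rightarrow> 'a) set) module" where
      "X = \<lparr>carrier = {{}}, mult = undefined, one = undefined, zero = {},
         add = (\<lambda>_ _. {}), smult = (\<lambda>_ _. {})\<rparr>"
    have X: "Module.module R X"
      by (intro moduleI abelian_groupI R.is_cring) (auto simp: X_def)
    interpret X: plain_module R X unfolding plain_module_def by (rule X)
    have "submodule_span R X {} = carrier X"
      unfolding X.span_empty by (simp add: X_def)
    then have mcm: "maximal_cohen_macaulay R X"
      unfolding maximal_cohen_macaulay_def finitely_generated_def
      using X by (intro conjI exI[of _ "{}"]) (simp_all add: X_def)
    have nofree: "\<not> has_free_summand R X"
      by (rule zero_module_not_free[OF X _ assms(2)]) (simp add: X_def)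
    have lin: "(\<lambda>p. J +>\<^bsub>regular_module R\<^esub> snd p 0) \<in> linear_maps R (module_sum X (free_module R 1)) ?M"
    proof (rule linear_mapsI)
      fix p assume p: "p \<in> carrier (module_sum X (free_module R 1))"
      have p0: "snd p 0 \<in> carrier (regular_module R)"
        using PiE_mem[of "snd p" "{..<1}" "\<lambda>_. carrier R" 0] p by (simp add: mem_Times_iff)
      then show "J +>\<^bsub>regular_module R\<^esub> snd p 0 \<in> carrier ?M"
        unfolding A.quotient_carrier by (rule imageI)
      show "J +>\<^bsub>regular_module R\<^esub> snd (r \<odot>\<^bsub>module_sum X (free_module R 1)\<^esub> p) 0 =
          r \<odot>\<^bsub>?M\<^esub> (J +>\<^bsub>regular_module R\<^esub> snd p 0)" if "r \<in> carrier R" for r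
        unfolding A.quotient_smult[OF J that p0] by simp
      fix q assume q: "q \<in> carrier (module_sum X (free_module R 1))"
      have q0: "snd q 0 \<in> carrier (regular_module R)"
        using PiE_mem[of "snd q" "{..<1}" "\<lambda>_. carrier R" 0] q by (simp add: mem_Times_iff)
      show "J +>\<^bsub>regular_module R\<^esub> snd (p \<oplus>\<^bsub>module_sum X (free_module R 1)\<^esub> q) 0 =
          (J +>\<^bsub>regular_module R\<^esub> snd p 0) \<oplus>\<^bsub>?M\<^esub> (J +>\<^bsub>regular_module R\<^esub> snd q 0)"
        unfolding A.quotient_add[OF J p0 q0] by simp
    qed
    have surj: "(\<lambda>p. J +>\<^bsub>regular_module R\<^esub> snd p 0) ` carrier (module_sum X (free_module R 1)) = carrier ?M"
    proof
      show "carrier ?M \<subseteq> (\<lambda>p. J +>\<^bsub>regular_module R\<^esub> snd p 0) ` carrier (module_sum X (free_module R 1))"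
      proof
        fix C assume "C \<in> carrier ?M"
        then obtain r where r: "r \<in> carrier R" "C = J +>\<^bsub>regular_module R\<^esub> r"
          unfolding A.quotient_carrier regular_module_simps(1) by (rule imageE)
        show "C \<in> (\<lambda>p. J +>\<^bsub>regular_module R\<^esub> snd p 0) ` carrier (module_sum X (free_module R 1))"
        proof (rule image_eqI[of _ _ "({}, \<lambda>i\<in>{..<1::nat}. r)"])
          show "C = J +>\<^bsub>regular_module R\<^esub> snd ({}, \<lambda>i\<in>{..<1::nat}. r) 0"
            using r(2) by simp
          show "({}, \<lambda>i\<in>{..<1::nat}. r) \<in> carrier (module_sum X (free_module R 1))"
            using r(1) by (simp add: X_def)
        qed
      qed
    next
      have "snd p 0 \<in> carrier R" if "p \<in> carrier (module_sum X (free_module R 1))" for p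
        using PiE_mem[of "snd p" "{..<1}" "\<lambda>_. carrier R" 0] that by (simp add: mem_Times_iff)
      then show "(\<lambda>p. J +>\<^bsub>regular_module R\<^esub> snd p 0) ` carrier (module_sum X (free_module R 1)) \<subseteq> carrier ?M"
        unfolding A.quotient_carrier regular_module_simps(1) by (intro image_subsetI imageI)
    qed
    show ?thesis
    proof (intro exI conjI)
      show "maximal_cohen_macaulay R X" by (rule mcm)
      show "\<not> has_free_summand R X" by (rule nofree)
      show "\<exists>h\<in>linear_maps R (module_sum X (free_module R 1)) ?M.
                 h ` carrier (module_sum X (free_module R 1)) = carrier ?M"
        using surj lin by (rule bexI)
    qed
  qed
  have delta: "delta_invariant R ?M = (LEAST n. ?Q n)" by (rule delta_invariant_def)
  show ?thesis
    unfolding covered_iff_delta_zero delta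
  proof
    assume L: "(LEAST n. ?Q n) = 1"
    show "\<not> ?Q 0"
    proof
      assume "?Q 0"
      then have "(LEAST n. ?Q n) \<le> 0" by (rule Least_le[of ?Q])
      then have "(1::nat) \<le> 0" unfolding L .
      then show False by simp
    qed
  next
    assume "\<not> ?Q 0"
    then show "(LEAST n. ?Q n) = 1"
    proof (intro Least_equality)
      show "?Q 1" by (rule Q1)
      show "1 \<le> k" if Qk: "?Q k" for k
      proof (cases k)
        case 0
        have "?Q 0" using Qk unfolding 0 .
        with \<open>\<not> ?Q 0\<close> show ?thesis by (rule notE)
      qed simp
    qed
  qed
qed

section \<open>Modules mapping onto the residue ring of order d\<close>

context hypersurface_ring
begin

lemma plain_module_R: "Module.module R X \<Longrightarrow> plain_module R X"
  for X :: "('k power_series2 set, 'b) module"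
  unfolding plain_module_def .

text \<open>In these coordinates z acts as x, and f acts as the series F to which Weierstrass division applies.\<close>

lemma action_series_module:
  fixes X :: "('k power_series2 set, 'b) module"
  assumes X: "Module.module R X"
  shows "series_module X (\<lambda>u v. proj (shear a u) \<odot>\<^bsub>X\<^esub> v)"
proof -
  interpret X: plain_module R X by (rule plain_module_R[OF X])
  show ?thesis
  proof (rule series_module.intro)
    show "abelian_group X" by (rule X.M.abelian_group_axioms)
    show "series_module_axioms X (\<lambda>u v. proj (shear a u) \<odot>\<^bsub>X\<^esub> v)"
    proof (rule series_module_axioms.intro)
      fix u u' v w assume v: "v \<in> carrier X"
      show "proj (shear a u) \<odot>\<^bsub>X\<^esub> v \<in> carrier X"
        by (rule X.smult_closed[OF proj_carrier v])
      show "proj (shear a (u + u')) \<odot>\<^bsub>X\<^esub> v =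
          proj (shear a u) \<odot>\<^bsub>X\<^esub> v \<oplus>\<^bsub>X\<^esub> proj (shear a u') \<odot>\<^bsub>X\<^esub> v"
        unfolding shear_add proj_simps(2)[symmetric] by (rule X.smult_l_distr[OF proj_carrier proj_carrier v])
      show "proj (shear a (u * u')) \<odot>\<^bsub>X\<^esub> v =
          proj (shear a u) \<odot>\<^bsub>X\<^esub> (proj (shear a u') \<odot>\<^bsub>X\<^esub> v)"
        unfolding shear_mult proj_simps(1)[symmetric] by (rule X.smult_assoc1[OF proj_carrier proj_carrier v])
      show "proj (shear a 1) \<odot>\<^bsub>X\<^esub> v = v"
        unfolding shear_1 proj_simps(3)[symmetric] by (rule X.smult_one[OF v])
      assume w: "w \<in> carrier X"
      show "proj (shear a u) \<odot>\<^bsub>X\<^esub> (v \<oplus>\<^bsub>X\<^esub> w) =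
          proj (shear a u) \<odot>\<^bsub>X\<^esub> v \<oplus>\<^bsub>X\<^esub> proj (shear a u) \<odot>\<^bsub>X\<^esub> w"
        by (rule X.smult_r_distr[OF proj_carrier v w])
    qed
  qed
qed

lemma action_weierstrass_module:
  fixes X :: "('k power_series2 set, 'b) module"
  assumes X: "Module.module R X"
    and reg: "\<And>v. v \<in> carrier X \<Longrightarrow> proj z \<odot>\<^bsub>X\<^esub> v = \<zero>\<^bsub>X\<^esub> \<Longrightarrow> v = \<zero>\<^bsub>X\<^esub>"
  shows "weierstrass_module X (\<lambda>u v. proj (shear a u) \<odot>\<^bsub>X\<^esub> v) F d"
proof -
  interpret X: plain_module R X by (rule plain_module_R[OF X])
  have "proj f = \<zero>\<^bsub>R\<^esub>" unfolding proj_simps(4) proj_eq_zero_iff by simp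
  then have "proj f \<odot>\<^bsub>X\<^esub> v = \<zero>\<^bsub>X\<^esub>" if "v \<in> carrier X" for v
    using X.smult_l_null[OF that] by (simp only:)
  then show ?thesis
    using reg form_F d_ge_2 lead action_series_module[OF X]
    by (intro weierstrass_module.intro series_module_regular.intro series_module_regular_axioms.intro
        weierstrass_module_axioms.intro) (simp_all only: shear_x shear_F, simp)
qed

text \<open>The socle of \<open>R / (z) = k[y] / (y^d)\<close> is generated by \<open>y^(d - 1)\<close>. If it does not annihilate \<open>v0\<close> modulo z,
  some \<open>k[[z]]\<close>-linear functional of the free \<open>k[[z]]\<close>-module X takes a unit value at \<open>y^(d - 1) v0\<close>,
  and the R-linear functional that corresponds to it by duality takes a unit value at \<open>v0\<close>.\<close>

lemma free_summand_criterion: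
  fixes X :: "('k power_series2 set, 'b) module"
  assumes X: "Module.module R X" and fg: "finitely_generated R X"
    and reg: "\<And>v. v \<in> carrier X \<Longrightarrow> proj z \<odot>\<^bsub>X\<^esub> v = \<zero>\<^bsub>X\<^esub> \<Longrightarrow> v = \<zero>\<^bsub>X\<^esub>"
    and v0: "v0 \<in> carrier X"
    and out: "\<And>w. w \<in> carrier X \<Longrightarrow> proj (var_y ^ (d - 1)) \<odot>\<^bsub>X\<^esub> v0 \<noteq> proj z \<odot>\<^bsub>X\<^esub> w"
  shows "has_free_summand R X"
proof -
  interpret X: plain_module R X by (rule plain_module_R[OF X])
  let ?act = "\<lambda>u v. proj (shear a u) \<odot>\<^bsub>X\<^esub> v"
  interpret W: weierstrass_module X ?act F d by (rule action_weierstrass_module[OF X reg])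
  obtain G where G: "finite G" "G \<subseteq> carrier X" "submodule_span R X G = carrier X"
    using fg unfolding finitely_generated_def by blast
  have gen: "N = carrier X" if N: "G \<subseteq> N" "N \<subseteq> carrier X" "\<zero>\<^bsub>X\<^esub> \<in> N"
    "\<And>v w. v \<in> N \<Longrightarrow> w \<in> N \<Longrightarrow> v \<oplus>\<^bsub>X\<^esub> w \<in> N" "\<And>u v. v \<in> N \<Longrightarrow> ?act u v \<in> N" for N
  proof
    have smult: "r \<odot>\<^bsub>X\<^esub> v \<in> N" if r: "r \<in> carrier R" and v: "v \<in> N" for r v
    proof -
      obtain u where u: "r = proj u" using r by (rule R_cases)
      show ?thesis using N(5)[OF v, of "shear (- a) u"] unfolding u shear_inverse .
    qed
    have "submodule N R X"
    proof (rule X.submoduleI)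
      show "\<ominus>\<^bsub>X\<^esub> v \<in> N" if v: "v \<in> N" for v
      proof -
        have vc: "v \<in> carrier X" using v N(2) by blast
        have "(\<ominus>\<^bsub>R\<^esub> \<one>\<^bsub>R\<^esub>) \<odot>\<^bsub>X\<^esub> v = \<ominus>\<^bsub>X\<^esub> v"
          unfolding X.smult_l_minus[OF X.R.one_closed vc] X.smult_one[OF vc] ..
        then show ?thesis using smult[OF X.R.a_inv_closed[OF X.R.one_closed] v] by (simp only:)
      qed
    qed (fact N smult)+
    then have "submodule_span R X G \<subseteq> N" using N(1) by (rule X.span_minimal)
    then show "carrier X \<subseteq> N" unfolding G(3) .
  qed (rule N(2))
  obtain B where B: "finite B" "B \<subseteq> carrier X" "W.spans B"
    by (rule W.finite_spanning_set[OF G(1,2) gen])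
  let ?s = "?act (var_y ^ (d - 1)) v0"
  have s: "?s \<in> carrier X" by (rule W.act_closed[OF v0])
  have "?s \<notin> ?act var_x ` carrier X"
  proof
    assume "?s \<in> ?act var_x ` carrier X"
    then obtain w where w: "w \<in> carrier X" "?s = ?act var_x w" by (rule imageE)
    show False using out[OF w(1)] w(2) unfolding shear_power shear_var_y shear_x by (rule notE)
  qed
  then obtain \<psi> where \<psi>: "\<And>v w. v \<in> carrier X \<Longrightarrow> w \<in> carrier X \<Longrightarrow> \<psi> (v \<oplus>\<^bsub>X\<^esub> w) = \<psi> v + \<psi> w"
    "\<And>t v. v \<in> carrier X \<Longrightarrow> \<psi> (?act (fps_const t) v) = t * \<psi> v"
    "\<psi> ?s $ 0 \<noteq> 0"
    by (rule W.coordinate_functional[OF B s]) blast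
  define \<phi> where "\<phi> = (\<lambda>v. \<Sum>i<d. fps_const (\<psi> (?act (W.horner i) v)) * var_y ^ i)"
  have phi1: "\<phi> (v \<oplus>\<^bsub>X\<^esub> w) = \<phi> v + \<phi> w" if "v \<in> carrier X" "w \<in> carrier X" for v w
    unfolding \<phi>_def by (rule W.linear_functional(1)) fact+
  have phi2: "F dvd \<phi> (?act u v) - u * \<phi> v" if "v \<in> carrier X" for u v
    unfolding \<phi>_def by (rule W.linear_functional(2)) fact+
  have phi3: "\<phi> v $ 0 $ 0 = F $ d $ 0 * \<psi> (?act (var_y ^ (d - 1)) v) $ 0" if "v \<in> carrier X" for v
    unfolding \<phi>_def by (rule W.linear_functional(3)) fact+
  let ?\<Phi> = "\<lambda>v. proj (shear a (\<phi> v))"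
  have lin: "?\<Phi> \<in> linear_maps R X (regular_module R)"
  proof (rule linear_mapsI)
    show "?\<Phi> (v \<oplus>\<^bsub>X\<^esub> w) = ?\<Phi> v \<oplus>\<^bsub>regular_module R\<^esub> ?\<Phi> w" if "v \<in> carrier X" "w \<in> carrier X" for v w
      unfolding phi1[OF that] shear_add regular_module_simps proj_simps ..
    show "?\<Phi> (r \<odot>\<^bsub>X\<^esub> v) = r \<odot>\<^bsub>regular_module R\<^esub> ?\<Phi> v" if r: "r \<in> carrier R" and v: "v \<in> carrier X" for r v
    proof -
      obtain u where u: "r = proj u" using r by (rule R_cases)
      obtain q where "\<phi> (?act (shear (- a) u) v) - shear (- a) u * \<phi> v = F * q"
        using phi2[OF v, of "shear (- a) u"] by (rule dvdE)
      from arg_cong[OF this, of "shear a"]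
      have "shear a (\<phi> (proj u \<odot>\<^bsub>X\<^esub> v)) - u * shear a (\<phi> v) = f * shear a q"
        by (simp only: shear_diff shear_mult shear_inverse)
      then have "f dvd shear a (\<phi> (proj u \<odot>\<^bsub>X\<^esub> v)) - u * shear a (\<phi> v)" by (rule dvdI)
      then show ?thesis
        unfolding u regular_module_simps proj_simps proj_eq_iff .
    qed
  qed simp
  have "\<phi> v0 $ 0 $ 0 \<noteq> 0"
    unfolding phi3[OF v0] using lead \<psi>(3) by simp
  have "shear a (\<phi> v0) \<notin> order_ideal 1"
  proof
    assume "shear a (\<phi> v0) \<in> order_ideal 1"
    then have "shear (- a) (shear a (\<phi> v0)) \<in> order_ideal 1" by (rule shear_in_order_ideal)
    then have "\<phi> v0 \<in> order_ideal 1" unfolding shear_inverse' .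
    then have "\<phi> v0 $ 0 $ 0 = 0" by (simp add: order_ideal_def)
    with \<open>\<phi> v0 $ 0 $ 0 \<noteq> 0\<close> show False by (rule notE)
  qed
  then have "shear a (\<phi> v0) dvd 1" by (rule unit_power_series2)
  then obtain e where e: "1 = shear a (\<phi> v0) * e" by (rule dvdE)
  have "?\<Phi> (proj e \<odot>\<^bsub>X\<^esub> v0) = proj e \<odot>\<^bsub>regular_module R\<^esub> ?\<Phi> v0"
    by (rule linear_mapsD(3)[OF lin proj_carrier v0])
  also have "\<dots> = \<one>\<^bsub>R\<^esub>"
    unfolding regular_module_simps proj_simps e by (simp only: mult.commute)
  finally show ?thesis
    by (rule X.free_summand_of_functional[OF lin X.smult_closed[OF proj_carrier v0]])
qed

lemma submodule_mpow: "submodule (mpow k) R (regular_module R)"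
  by (rule ideal_submodule[OF cring_R ideal_mpow])

lemma coset_mpow_eq_iff:
  "mpow k +>\<^bsub>regular_module R\<^esub> proj u = mpow k +>\<^bsub>regular_module R\<^esub> proj v \<longleftrightarrow> proj (u - v) \<in> mpow k"
proof -
  interpret A: plain_module R "regular_module R"
    by (rule plain_module_R[OF regular_module_is_module[OF cring_R]])
  have "proj u \<ominus>\<^bsub>regular_module R\<^esub> proj v = proj (u - v)"
  proof -
    have "\<ominus>\<^bsub>regular_module R\<^esub> proj v = proj (- v)"
      by (rule A.M.minus_equality) (simp_all add: proj_simps)
    then show ?thesis by (simp add: a_minus_def proj_simps)
  qed
  then show ?thesis
    using A.coset_eq_iff[OF submodule_mpow, of "proj u" "proj v"] by simp
qed

text \<open>Let \<open>v0\<close> be mapped to 1. As \<open>y^(d - 1)\<close> is not in \<open>(z) + m^d\<close>, the element \<open>y^(d - 1) v0\<close> is not in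
  \<open>z X\<close>, so X has a free summand. That z is regular on X follows from depth 1: the d-th power of
  an element of the maximal ideal is a multiple of z.\<close>

lemma not_covered_mpow_d:
  "\<not> covered_without_free_summand R (quotient_module (regular_module R) (mpow d))"
proof
  let ?M = "quotient_module (regular_module R) (mpow d)"
  let ?c = "\<lambda>u. mpow d +>\<^bsub>regular_module R\<^esub> proj u"
  interpret A: plain_module R "regular_module R"
    by (rule plain_module_R[OF regular_module_is_module[OF cring_R]])
  have c_smult: "proj u \<odot>\<^bsub>?M\<^esub> ?c v = ?c (u * v)" for u v
    using A.quotient_smult[OF submodule_mpow, of "proj u" "proj v" d] by (simp add: proj_simps)
  have c_carrier: "?c u \<in> carrier ?M" for u
    unfolding A.quotient_carrier by simp
  have c_cases: "\<exists>u. C = ?c u" if C: "C \<in> carrier ?M" for C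
  proof -
    obtain r where r: "r \<in> carrier R" "C = mpow d +>\<^bsub>regular_module R\<^esub> r"
      using C unfolding A.quotient_carrier by auto
    obtain u where "r = proj u" using r(1) by (rule R_cases)
    then show ?thesis using r(2) by blast
  qed
  assume "covered_without_free_summand R ?M"
  then obtain X :: "('k power_series2 set, (nat \<Rightarrow> 'k power_series2 set) set) module" and h
    where mcm: "maximal_cohen_macaulay R X" and nofree: "\<not> has_free_summand R X"
      and h: "h \<in> linear_maps R X ?M" "h ` carrier X = carrier ?M"
    unfolding covered_without_free_summand_def by blast
  have X: "Module.module R X" and fg: "finitely_generated R X"
    using mcm unfolding maximal_cohen_macaulay_def by blast+
  interpret X: plain_module R X by (rule plain_module_R[OF X])
  have "?c 1 \<in> h ` carrier X" unfolding h(2) by (rule c_carrier)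
  then obtain v0 where v0: "?c 1 = h v0" "v0 \<in> carrier X" by (rule imageE)
  have "carrier X \<noteq> {\<zero>\<^bsub>X\<^esub>}"
  proof
    assume zero: "carrier X = {\<zero>\<^bsub>X\<^esub>}"
    have "?c 0 \<in> h ` carrier X" unfolding h(2) by (rule c_carrier)
    then have "?c 1 = ?c 0" using v0 unfolding zero by auto
    then have "proj (1 - 0) \<in> mpow d" unfolding coset_mpow_eq_iff .
    then have "(1 :: 'k power_series2) \<in> order_ideal d" using proj_in_mpow_iff[of d 1] by simp
    then have "(1 :: 'k power_series2) \<in> order_ideal 1" by (rule order_ideal_mono) (use d_ge_2 in simp)
    then show False by (simp add: order_ideal_def)
  qed
  then have depth: "depth R X = 1"
    using mcm krull_dim_R unfolding maximal_cohen_macaulay_def by simp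
  have max: "max_ideal R \<subseteq> carrier R" unfolding max_ideal_R by (rule mpow_subset)
  obtain t where t: "t \<in> max_ideal R" "\<And>v. v \<in> carrier X \<Longrightarrow> t \<odot>\<^bsub>X\<^esub> v = \<zero>\<^bsub>X\<^esub> \<Longrightarrow> v = \<zero>\<^bsub>X\<^esub>"
    by (rule X.depth_eq_1D[OF max depth]) blast
  obtain u where u: "t = proj u" "u \<in> order_ideal 1"
    using t(1) unfolding max_ideal_R mpow_def by blast
  have inj_power: "v = \<zero>\<^bsub>X\<^esub>" if "v \<in> carrier X" "proj (u ^ k) \<odot>\<^bsub>X\<^esub> v = \<zero>\<^bsub>X\<^esub>" for v k
    using that
  proof (induction k)
    case 0
    then show ?case using X.smult_one[of v] by (simp add: proj_simps)
  next
    case (Suc k)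
    have "t \<odot>\<^bsub>X\<^esub> (proj (u ^ k) \<odot>\<^bsub>X\<^esub> v) = \<zero>\<^bsub>X\<^esub>"
      using Suc.prems X.smult_assoc1[OF proj_carrier proj_carrier Suc.prems(1), of u "u ^ k"]
      by (simp add: proj_simps u(1))
    then have "proj (u ^ k) \<odot>\<^bsub>X\<^esub> v = \<zero>\<^bsub>X\<^esub>"
      by (rule t(2)[OF X.smult_closed[OF proj_carrier Suc.prems(1)]])
    with Suc.prems(1) show ?case by (rule Suc.IH)
  qed
  obtain p where p: "f dvd u ^ d - z * p" using u(2) by (rule power_multiple_of_z)
  have reg: "v = \<zero>\<^bsub>X\<^esub>" if v: "v \<in> carrier X" "proj z \<odot>\<^bsub>X\<^esub> v = \<zero>\<^bsub>X\<^esub>" for v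
  proof -
    have "proj (u ^ d) = proj p \<otimes>\<^bsub>R\<^esub> proj z"
      using p unfolding proj_simps proj_eq_iff by (simp only: mult.commute)
    then have "proj (u ^ d) \<odot>\<^bsub>X\<^esub> v = proj p \<odot>\<^bsub>X\<^esub> (proj z \<odot>\<^bsub>X\<^esub> v)"
      using X.smult_assoc1[OF proj_carrier proj_carrier v(1), of p z] by (simp only:)
    also have "\<dots> = \<zero>\<^bsub>X\<^esub>" unfolding v(2) by (rule X.smult_r_null[OF proj_carrier])
    finally show ?thesis by (rule inj_power[OF v(1)])
  qed
  have out: "proj (var_y ^ (d - 1)) \<odot>\<^bsub>X\<^esub> v0 \<noteq> proj z \<odot>\<^bsub>X\<^esub> w" if w: "w \<in> carrier X" for w
  proof
    assume eq: "proj (var_y ^ (d - 1)) \<odot>\<^bsub>X\<^esub> v0 = proj z \<odot>\<^bsub>X\<^esub> w"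
    obtain q where q: "h w = ?c q" using c_cases[OF linear_mapsD(1)[OF h(1) w]] by (rule exE)
    have "?c (var_y ^ (d - 1) * 1) = h (proj (var_y ^ (d - 1)) \<odot>\<^bsub>X\<^esub> v0)"
      unfolding linear_mapsD(3)[OF h(1) proj_carrier v0(2)] v0(1)[symmetric] c_smult ..
    also have "\<dots> = ?c (z * q)"
      unfolding eq linear_mapsD(3)[OF h(1) proj_carrier w] q c_smult ..
    finally have "proj (var_y ^ (d - 1) * 1 - z * q) \<in> mpow d" unfolding coset_mpow_eq_iff .
    then have "var_y ^ (d - 1) - z * q \<in> order_ideal d"
      using proj_in_mpow_iff[of d] by simp
    then show False using y_power_not_in_ideal[of "var_y ^ (d - 1) - z * q" q] by simp
  qed
  show False
    using nofree free_summand_criterion[OF X fg reg v0(2) out] by (rule notE)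
qed

text \<open>For u regular on X, the relation \<open>u^i (z^N + u r) = 0\<close> shows \<open>z^N X \<subseteq> u X\<close>. A power of w is a
  multiple of \<open>z^N\<close>, so w can be injective on \<open>X / u X\<close> only if \<open>X = u X\<close>.\<close>

lemma no_long_regular_sequence:
  fixes X :: "('k power_series2 set, 'b) module"
  assumes X: "Module.module R X" and sub: "set (t # s # xs) \<subseteq> mpow 1"
  shows "\<not> regular_sequence R X (t # s # xs)"
proof
  interpret X: plain_module R X by (rule plain_module_R[OF X])
  assume reg: "regular_sequence R X (t # s # xs)"
  have carr: "set (t # s # xs) \<subseteq> carrier R" using sub mpow_subset by blast
  obtain u where u: "t = proj u" using sub unfolding mpow_def by auto
  obtain w where w: "s = proj w" "w \<in> order_ideal 1" using sub unfolding mpow_def by auto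
  have inj: "v = \<zero>\<^bsub>X\<^esub>" if "v \<in> carrier X" "proj u \<odot>\<^bsub>X\<^esub> v = \<zero>\<^bsub>X\<^esub>" for v
    using X.regular_sequence_ConsD(1)[OF reg carr that(1)] that(2) unfolding u by blast
  have inj_power: "v = \<zero>\<^bsub>X\<^esub>" if "v \<in> carrier X" "proj (u ^ k) \<odot>\<^bsub>X\<^esub> v = \<zero>\<^bsub>X\<^esub>" for v k
    using that
  proof (induction k)
    case 0
    then show ?case using X.smult_one[of v] by (simp add: proj_simps)
  next
    case (Suc k)
    have "proj u \<odot>\<^bsub>X\<^esub> (proj (u ^ k) \<odot>\<^bsub>X\<^esub> v) = \<zero>\<^bsub>X\<^esub>"
      using Suc.prems X.smult_assoc1[OF proj_carrier proj_carrier Suc.prems(1), of u "u ^ k"]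
      by (simp add: proj_simps)
    then have "proj (u ^ k) \<odot>\<^bsub>X\<^esub> v = \<zero>\<^bsub>X\<^esub>"
      by (rule inj[OF X.smult_closed[OF proj_carrier Suc.prems(1)]])
    with Suc.prems(1) show ?case by (rule Suc.IH)
  qed
  have scaled: "submodule (X.scaled t) R X" by (rule X.scaled_submodule) (simp add: u)
  have divisible: "v \<in> X.scaled t" if v: "v \<in> carrier X" "proj (w ^ k) \<odot>\<^bsub>X\<^esub> v \<in> X.scaled t" for v k
    using v
  proof (induction k)
    case 0
    then show ?case using X.smult_one[of v] by (simp add: proj_simps)
  next
    case (Suc k)
    have "s \<odot>\<^bsub>X\<^esub> (proj (w ^ k) \<odot>\<^bsub>X\<^esub> v) \<in> X.scaled t"
      using Suc.prems X.smult_assoc1[OF proj_carrier proj_carrier Suc.prems(1), of w "w ^ k"]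
      by (simp add: proj_simps w(1))
    then have "proj (w ^ k) \<odot>\<^bsub>X\<^esub> v \<in> X.scaled t"
      by (rule X.regular_sequence_Cons_ConsD[OF reg carr X.smult_closed[OF proj_carrier Suc.prems(1)]])
    with Suc.prems(1) show ?case by (rule Suc.IH)
  qed
  obtain i N r where K: "f dvd u ^ i * (z ^ N + u * r)" using z_power_relation[of u] by blast
  obtain p where p: "f dvd w ^ d - z * p" using w(2) by (rule power_multiple_of_z)
  have "v \<in> X.scaled t" if v: "v \<in> carrier X" for v
  proof -
    have "proj (u ^ i) \<odot>\<^bsub>X\<^esub> (proj (z ^ N + u * r) \<odot>\<^bsub>X\<^esub> v) = \<zero>\<^bsub>R\<^esub> \<odot>\<^bsub>X\<^esub> v"
      unfolding X.smult_assoc1[OF proj_carrier proj_carrier v, symmetric] proj_simps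
      using K proj_eq_zero_iff[of "u ^ i * (z ^ N + u * r)"] by simp
    also have "\<dots> = \<zero>\<^bsub>X\<^esub>" by (rule X.smult_l_null[OF v])
    finally have zero: "proj (z ^ N + u * r) \<odot>\<^bsub>X\<^esub> v = \<zero>\<^bsub>X\<^esub>"
      by (rule inj_power[OF X.smult_closed[OF proj_carrier v]])
    have "proj (z ^ N) = proj (z ^ N + u * r) \<oplus>\<^bsub>R\<^esub> proj u \<otimes>\<^bsub>R\<^esub> proj (- r)"
      unfolding proj_simps by simp
    then have "proj (z ^ N) \<odot>\<^bsub>X\<^esub> v = proj (z ^ N + u * r) \<odot>\<^bsub>X\<^esub> v \<oplus>\<^bsub>X\<^esub> (proj u \<otimes>\<^bsub>R\<^esub> proj (- r)) \<odot>\<^bsub>X\<^esub> v"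
      using X.smult_l_distr[OF proj_carrier proj_carrier v, of "z ^ N + u * r" "u * - r"]
      unfolding proj_simps by (simp only:)
    also have "\<dots> = t \<odot>\<^bsub>X\<^esub> (proj (- r) \<odot>\<^bsub>X\<^esub> v)"
      unfolding zero u X.smult_assoc1[OF proj_carrier proj_carrier v]
      by (rule X.M.l_zero) (simp add: v)
    finally have zN: "proj (z ^ N) \<odot>\<^bsub>X\<^esub> v \<in> X.scaled t"
      using v by (simp add: X.scaled_def)
    have "proj (w ^ d) = proj (z * p)" using p unfolding proj_eq_iff .
    then have "proj (w ^ d) [^]\<^bsub>R\<^esub> N = proj (z * p) [^]\<^bsub>R\<^esub> N" by (simp only:)
    then have "proj (w ^ (d * N)) = proj (p ^ N) \<otimes>\<^bsub>R\<^esub> proj (z ^ N)"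
      unfolding proj_power proj_simps power_mult power_mult_distrib by (simp only: mult.commute)
    then have "proj (w ^ (d * N)) \<odot>\<^bsub>X\<^esub> v = proj (p ^ N) \<odot>\<^bsub>X\<^esub> (proj (z ^ N) \<odot>\<^bsub>X\<^esub> v)"
      using X.smult_assoc1[OF proj_carrier proj_carrier v, of "p ^ N" "z ^ N"] by (simp only:)
    also have "\<dots> \<in> X.scaled t"
      by (rule X.submoduleE(4)[OF scaled proj_carrier zN])
    finally show ?thesis by (rule divisible[OF v])
  qed
  then have "X.scaled t = carrier X" using X.submoduleE(1)[OF scaled] by blast
  then show False using X.regular_sequence_ConsD(2)[OF reg carr] by contradiction
qed

end

section \<open>The module of a matrix factorization\<close>

context hypersurface_ring
begin

definition vec :: "'k power_series2 \<Rightarrow> 'k power_series2 \<Rightarrow> nat \<Rightarrow> 'k power_series2 set"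
  where "vec p q = (\<lambda>i\<in>{..<2}. if i = 0 then proj p else proj q)"

lemma vec_nth: "vec p q 0 = proj p" "vec p q (Suc 0) = proj q"
  by (simp_all add: vec_def)

lemma less_2_cases': "i \<in> {..<2::nat} \<Longrightarrow> i = 0 \<or> i = Suc 0" by auto

lemma vec_carrier: "vec p q \<in> carrier (free_module R 2)"
  unfolding free_module_simps vec_def restrict_PiE_iff by simp

lemma vec_cases:
  assumes "v \<in> carrier (free_module R 2)"
  obtains p q where "v = vec p q"
proof -
  have "v 0 \<in> carrier R" "v (Suc 0) \<in> carrier R"
    using PiE_mem[OF assms[unfolded free_module_simps(1)]] by simp_all
  then obtain p q where pq: "v 0 = proj p" "v (Suc 0) = proj q" by (auto elim!: R_cases)
  have "v = vec p q"
  proof (rule PiE_ext[OF assms[unfolded free_module_simps(1)] vec_carrier[unfolded free_module_simps(1)]])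
    fix i :: nat assume "i \<in> {..<2}"
    then show "v i = vec p q i" using less_2_cases'[of i] pq by (auto simp: vec_nth)
  qed
  then show ?thesis by (rule that)
qed

lemma vec_add: "vec p q \<oplus>\<^bsub>free_module R 2\<^esub> vec p' q' = vec (p + p') (q + q')"
  unfolding free_module_simps by (rule HOL.ext) (simp add: vec_def proj_simps)

lemma vec_smult: "proj u \<odot>\<^bsub>free_module R 2\<^esub> vec p q = vec (u * p) (u * q)"
  unfolding free_module_simps by (rule HOL.ext) (simp add: vec_def proj_simps)

lemma vec_zero: "\<zero>\<^bsub>free_module R 2\<^esub> = vec 0 0"
  unfolding free_module_simps by (rule HOL.ext) (simp add: vec_def proj_simps)

lemma vec_eqD:
  assumes "vec p q = vec p' q'"
  shows "f dvd p - p' \<and> f dvd q - q'"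
proof -
  have "proj p = proj p'" using fun_cong[OF assms, of 0] unfolding vec_nth .
  moreover have "proj q = proj q'" using fun_cong[OF assms, of "Suc 0"] unfolding vec_nth .
  ultimately show ?thesis unfolding proj_eq_iff by (rule conjI)
qed

end

text \<open>For \<open>f = x g + y h\<close> the matrix with rows \<open>(x, -h)\<close> and \<open>(y, g)\<close> has determinant f, and its product with the
  adjugate matrix, which has rows \<open>(g, h)\<close> and \<open>(-y, x)\<close>, is f times the identity. The module to be
  constructed is the quotient of \<open>R^2\<close> by the kernel of the first matrix, which is the cokernel of the
  second.\<close>

locale matrix_factorization = hypersurface_ring f d a for f :: "'k::field power_series2" and d a +
  fixes g h :: "'k power_series2"
  assumes g: "g \<in> order_ideal (d - 1)" and h: "h \<in> order_ideal (d - 1)"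
    and f_eq: "f = var_x * g + var_y * h"
begin

definition relation :: "'k power_series2 \<Rightarrow> 'k power_series2 \<Rightarrow> bool"
  where "relation p q \<longleftrightarrow> f dvd var_x * p - h * q \<and> f dvd var_y * p + g * q"

lemma relation_add: "relation p q \<Longrightarrow> relation p' q' \<Longrightarrow> relation (p + p') (q + q')"
  using dvd_add[of f "var_x * p - h * q" "var_x * p' - h * q'"]
    dvd_add[of f "var_y * p + g * q" "var_y * p' + g * q'"]
  by (simp add: relation_def algebra_simps)

lemma relation_mult: "relation p q \<Longrightarrow> relation (u * p) (u * q)"
  using dvd_mult[of f "var_x * p - h * q" u] dvd_mult[of f "var_y * p + g * q" u]
  by (simp add: relation_def algebra_simps)

lemma relation_multiples: "f dvd p \<Longrightarrow> f dvd q \<Longrightarrow> relation p q"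
  unfolding relation_def by (intro conjI dvd_diff dvd_add dvd_mult)

lemma relation_z: "relation (z * p) (z * q) \<Longrightarrow> relation p q"
  using z_regular[of "var_x * p - h * q"] z_regular[of "var_y * p + g * q"]
  by (simp add: relation_def algebra_simps)

text \<open>Multiplication by the adjugate matrix puts \<open>f p\<close> into \<open>f (g, h)\<close>.\<close>

lemma relation_order:
  assumes "relation p q"
  shows "p \<in> order_ideal (d - 1)"
proof -
  obtain s where s: "var_x * p - h * q = f * s" using assms unfolding relation_def by (auto elim: dvdE)
  obtain t where t: "var_y * p + g * q = f * t" using assms unfolding relation_def by (auto elim: dvdE)
  have "f * p = g * (var_x * p - h * q) + h * (var_y * p + g * q)"
    by (subst f_eq) (simp add: algebra_simps)
  also have "\<dots> = f * (g * s + h * t)" unfolding s t by (simp add: algebra_simps)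
  finally have "p = g * s + h * t" using f_nonzero by simp
  then show ?thesis using g h by (simp add: order_ideal_add order_ideal_rmult)
qed

definition kernel :: "(nat \<Rightarrow> 'k power_series2 set) set"
  where "kernel = {vec p q |p q. relation p q}"

lemma vec_in_kernel: "vec p q \<in> kernel \<longleftrightarrow> relation p q"
proof
  assume "vec p q \<in> kernel"
  then obtain p' q' where pq: "vec p q = vec p' q'" "relation p' q'" unfolding kernel_def by blast
  have "relation (p - p') (q - q')" using vec_eqD[OF pq(1)] by (intro relation_multiples) simp_all
  from relation_add[OF this pq(2)] show "relation p q" by simp
qed (auto simp: kernel_def)

lemma module_F2: "Module.module R (free_module R 2)"
  by (rule free_module_is_module[OF cring_R])

lemma kernel_submodule: "submodule kernel R (free_module R 2)"
proof -
  interpret M: plain_module R "free_module R 2" by (rule plain_module_R[OF module_F2])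
  have smult: "r \<odot>\<^bsub>free_module R 2\<^esub> v \<in> kernel" if r: "r \<in> carrier R" and v: "v \<in> kernel" for r v
  proof -
    obtain u where u: "r = proj u" using r by (rule R_cases)
    obtain p q where pq: "v = vec p q" "relation p q" using v unfolding kernel_def by blast
    show ?thesis unfolding u pq(1) vec_smult vec_in_kernel by (rule relation_mult[OF pq(2)])
  qed
  show ?thesis
  proof (rule M.submoduleI)
    show sub: "kernel \<subseteq> carrier (free_module R 2)"
      unfolding kernel_def using vec_carrier by blast
    show "\<zero>\<^bsub>free_module R 2\<^esub> \<in> kernel"
      unfolding vec_zero vec_in_kernel by (rule relation_multiples) simp_all
    show "v \<oplus>\<^bsub>free_module R 2\<^esub> w \<in> kernel" if v: "v \<in> kernel" and w: "w \<in> kernel" for v w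
    proof -
      obtain p q where pq: "v = vec p q" "relation p q" using v unfolding kernel_def by blast
      obtain p' q' where pq': "w = vec p' q'" "relation p' q'" using w unfolding kernel_def by blast
      show ?thesis unfolding pq(1) pq'(1) vec_add vec_in_kernel by (rule relation_add[OF pq(2) pq'(2)])
    qed
    show "\<ominus>\<^bsub>free_module R 2\<^esub> v \<in> kernel" if v: "v \<in> kernel" for v
    proof -
      have vc: "v \<in> carrier (free_module R 2)" using v sub by blast
      have "(\<ominus>\<^bsub>R\<^esub> \<one>\<^bsub>R\<^esub>) \<odot>\<^bsub>free_module R 2\<^esub> v = \<ominus>\<^bsub>free_module R 2\<^esub> v"
        unfolding M.smult_l_minus[OF M.R.one_closed vc] M.smult_one[OF vc] ..
      then show ?thesis using smult[OF M.R.a_inv_closed[OF M.R.one_closed] v] by (simp only:)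
    qed
  qed (fact smult)
qed

definition covering :: "('k power_series2 set, (nat \<Rightarrow> 'k power_series2 set) set) module"
  where "covering = quotient_module (free_module R 2) kernel"

definition elt :: "'k power_series2 \<Rightarrow> 'k power_series2 \<Rightarrow> (nat \<Rightarrow> 'k power_series2 set) set"
  where "elt p q = kernel +>\<^bsub>free_module R 2\<^esub> vec p q"

lemma module_covering: "Module.module R covering"
  unfolding covering_def
  by (rule plain_module.quotient_is_module[OF plain_module_R[OF module_F2] kernel_submodule])

lemma elt_carrier: "elt p q \<in> carrier covering"
  unfolding covering_def elt_def plain_module.quotient_carrier[OF plain_module_R[OF module_F2]]
  by (rule imageI[OF vec_carrier])

lemma elt_cases:
  assumes "v \<in> carrier covering"
  obtains p q where "v = elt p q"
proof -
  obtain w where w: "v = kernel +>\<^bsub>free_module R 2\<^esub> w" "w \<in> carrier (free_module R 2)"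
    using assms
    unfolding covering_def plain_module.quotient_carrier[OF plain_module_R[OF module_F2]] by (rule imageE)
  obtain p q where "w = vec p q" using w(2) by (rule vec_cases)
  then show ?thesis using that w(1) unfolding elt_def by blast
qed

lemma elt_add: "elt p q \<oplus>\<^bsub>covering\<^esub> elt p' q' = elt (p + p') (q + q')"
  unfolding covering_def elt_def
    plain_module.quotient_add[OF plain_module_R[OF module_F2] kernel_submodule vec_carrier vec_carrier] vec_add ..

lemma elt_smult: "proj u \<odot>\<^bsub>covering\<^esub> elt p q = elt (u * p) (u * q)"
  unfolding covering_def elt_def
    plain_module.quotient_smult[OF plain_module_R[OF module_F2] kernel_submodule proj_carrier vec_carrier] vec_smult ..

lemma elt_eq_zero_iff: "elt p q = \<zero>\<^bsub>covering\<^esub> \<longleftrightarrow> relation p q"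
  unfolding covering_def elt_def plain_module.quotient_zero[OF plain_module_R[OF module_F2]]
    plain_module.coset_eq_self_iff[OF plain_module_R[OF module_F2] kernel_submodule vec_carrier] vec_in_kernel ..

lemma elt_eqD:
  assumes "elt p q = elt p' q'"
  shows "relation (p - p') (q - q')"
proof -
  interpret X: plain_module R covering by (rule plain_module_R[OF module_covering])
  have "elt (p - p') (q - q') \<oplus>\<^bsub>covering\<^esub> elt p' q' = elt p' q'"
    unfolding elt_add using assms by simp
  then have "elt (p - p') (q - q') = \<zero>\<^bsub>covering\<^esub>"
    using X.M.add.r_cancel_one'[OF elt_carrier elt_carrier] X.M.add.r_cancel_one[OF elt_carrier elt_carrier] by metis
  then show ?thesis unfolding elt_eq_zero_iff .
qed

lemma covering_finitely_generated: "finitely_generated R covering"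
proof -
  interpret X: plain_module R covering by (rule plain_module_R[OF module_covering])
  let ?G = "{elt 1 0, elt 0 1}"
  have G: "?G \<subseteq> carrier covering" using elt_carrier by blast
  have sub: "submodule (submodule_span R covering ?G) R covering" by (rule X.span_submodule[OF G])
  have gen: "elt 1 0 \<in> submodule_span R covering ?G" "elt 0 1 \<in> submodule_span R covering ?G"
    using X.span_superset[of ?G] by blast+
  have "carrier covering \<subseteq> submodule_span R covering ?G"
  proof
    fix v assume "v \<in> carrier covering"
    then obtain p q where v: "v = elt p q" by (rule elt_cases)
    have "v = proj p \<odot>\<^bsub>covering\<^esub> elt 1 0 \<oplus>\<^bsub>covering\<^esub> proj q \<odot>\<^bsub>covering\<^esub> elt 0 1"
      unfolding elt_smult elt_add v by simp
    also have "\<dots> \<in> submodule_span R covering ?G"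
      by (rule X.submoduleE(5)[OF sub X.submoduleE(4)[OF sub proj_carrier gen(1)] X.submoduleE(4)[OF sub proj_carrier gen(2)]])
    finally show "v \<in> submodule_span R covering ?G" .
  qed
  then have "submodule_span R covering ?G = carrier covering"
    using X.submoduleE(1)[OF sub] by (intro equalityI)
  then show ?thesis
    unfolding finitely_generated_def using G by (intro exI[of _ ?G] conjI) simp_all
qed

lemma covering_mcm: "maximal_cohen_macaulay R covering"
proof -
  interpret X: plain_module R covering by (rule plain_module_R[OF module_covering])
  have "depth R covering = 1"
  proof (rule X.depth_eq_1I)
    show "max_ideal R \<subseteq> carrier R" unfolding max_ideal_R by (rule mpow_subset)
    show "proj z \<in> max_ideal R" unfolding max_ideal_R by (rule proj_in_mpow[OF z_in_order_ideal])
    show "v = \<zero>\<^bsub>covering\<^esub>" if v: "v \<in> carrier covering" "proj z \<odot>\<^bsub>covering\<^esub> v = \<zero>\<^bsub>covering\<^esub>" for v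
    proof -
      obtain p q where pq: "v = elt p q" using v(1) by (rule elt_cases)
      have "relation (z * p) (z * q)" using v(2) unfolding pq elt_smult elt_eq_zero_iff .
      then show ?thesis unfolding pq elt_eq_zero_iff by (rule relation_z)
    qed
    show "X.scaled (proj z) \<noteq> carrier covering"
    proof
      assume "X.scaled (proj z) = carrier covering"
      then have "elt 1 0 \<in> X.scaled (proj z)" using elt_carrier by simp
      then obtain v where v: "elt 1 0 = proj z \<odot>\<^bsub>covering\<^esub> v" "v \<in> carrier covering"
        unfolding X.scaled_def by (rule imageE)
      obtain p q where pq: "v = elt p q" using v(2) by (rule elt_cases)
      have "relation (1 - z * p) (0 - z * q)"
        using v(1) unfolding pq elt_smult by (rule elt_eqD)
      then have "1 - z * p \<in> order_ideal (d - 1)" by (rule relation_order)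
      then have "1 - z * p \<in> order_ideal 1" by (rule order_ideal_mono) (use d_ge_2 in simp)
      from order_ideal_add[OF this order_ideal_rmult[OF z_in_order_ideal, of p]]
      have "(1 :: 'k power_series2) \<in> order_ideal 1" by simp
      then show False by (simp add: order_ideal_def)
    qed
    show "\<not> regular_sequence R covering (t # s # xs)" if "set (t # s # xs) \<subseteq> max_ideal R" for t s xs
      using that unfolding max_ideal_R by (rule no_long_regular_sequence[OF module_covering])
  qed
  then show ?thesis
    unfolding maximal_cohen_macaulay_def krull_dim_R
    using module_covering covering_finitely_generated by blast
qed

text \<open>The values P and Q of a functional on the two generators satisfy \<open>g P = y Q\<close> and \<open>h P = - x Q\<close> modulo
  f. Multiplication by x and y gives \<open>f P = f (x s + y t)\<close>, so P is not a unit; then \<open>y Q\<close> lies in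
  \<open>(x, y)^2\<close>, and Q is not a unit either.\<close>

lemma covering_no_free_summand: "\<not> has_free_summand R covering"
proof
  interpret X: plain_module R covering by (rule plain_module_R[OF module_covering])
  assume "has_free_summand R covering"
  then obtain \<phi> v1 where phi: "\<phi> \<in> linear_maps R covering (regular_module R)"
    and v1: "v1 \<in> carrier covering" "\<phi> v1 = \<one>\<^bsub>R\<^esub>"
    by (rule X.functional_of_free_summand)
  have "\<phi> (elt 1 0) \<in> carrier R" "\<phi> (elt 0 1) \<in> carrier R"
    using linear_mapsD(1)[OF phi elt_carrier] by simp_all
  then obtain P Q where PQ: "\<phi> (elt 1 0) = proj P" "\<phi> (elt 0 1) = proj Q" by (auto elim!: R_cases)
  have phi_elt: "\<phi> (elt p q) = proj (p * P + q * Q)" for p q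
  proof -
    have "elt p q = proj p \<odot>\<^bsub>covering\<^esub> elt 1 0 \<oplus>\<^bsub>covering\<^esub> proj q \<odot>\<^bsub>covering\<^esub> elt 0 1"
      unfolding elt_smult elt_add by simp
    then have "\<phi> (elt p q) = \<phi> (proj p \<odot>\<^bsub>covering\<^esub> elt 1 0 \<oplus>\<^bsub>covering\<^esub> proj q \<odot>\<^bsub>covering\<^esub> elt 0 1)"
      by (rule arg_cong)
    also have "\<dots> = \<phi> (proj p \<odot>\<^bsub>covering\<^esub> elt 1 0) \<oplus>\<^bsub>R\<^esub> \<phi> (proj q \<odot>\<^bsub>covering\<^esub> elt 0 1)"
      using linear_mapsD(2)[OF phi X.smult_closed[OF proj_carrier elt_carrier] X.smult_closed[OF proj_carrier elt_carrier]]
      unfolding regular_module_simps .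
    also have "\<dots> = proj p \<otimes>\<^bsub>R\<^esub> proj P \<oplus>\<^bsub>R\<^esub> proj q \<otimes>\<^bsub>R\<^esub> proj Q"
      unfolding linear_mapsD(3)[OF phi proj_carrier elt_carrier] PQ regular_module_simps ..
    finally show ?thesis unfolding proj_simps .
  qed
  have zero: "f dvd p * P + q * Q" if rel: "relation p q" for p q
  proof -
    have "relation 0 0" by (rule relation_multiples) simp_all
    then have "elt 0 0 = \<zero>\<^bsub>covering\<^esub>" unfolding elt_eq_zero_iff .
    moreover have "elt p q = \<zero>\<^bsub>covering\<^esub>" using rel unfolding elt_eq_zero_iff .
    ultimately have "\<phi> (elt p q) = \<phi> (elt 0 0)" by (simp only:)
    then show ?thesis unfolding phi_elt by (simp add: proj_eq_zero_iff)
  qed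
  have "relation g (- var_y)"
    unfolding relation_def by (subst (1) f_eq) (simp add: mult.commute)
  from zero[OF this] obtain s where s: "g * P + - var_y * Q = f * s" by (rule dvdE)
  have "relation h var_x"
    unfolding relation_def by (subst (2) f_eq) (simp add: mult.commute add.commute)
  from zero[OF this] obtain t where t: "h * P + var_x * Q = f * t" by (rule dvdE)
  have "f * P = var_x * (g * P + - var_y * Q) + var_y * (h * P + var_x * Q)"
    by (subst f_eq) (simp add: algebra_simps)
  also have "\<dots> = f * (var_x * s + var_y * t)" unfolding s t by (simp add: algebra_simps)
  finally have P_eq: "P = var_x * s + var_y * t" using f_nonzero by simp
  have P: "P \<in> order_ideal 1"
    unfolding P_eq by (intro order_ideal_add order_ideal_rmult var_x_in_order_ideal var_y_in_order_ideal)
  have "g * P \<in> order_ideal (d - 1 + 1)" by (rule order_ideal_mult[OF g P])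
  then have gP: "g * P \<in> order_ideal 2" by (rule order_ideal_mono) (use d_ge_2 in simp)
  have fs: "f * s \<in> order_ideal 2"
    by (rule order_ideal_rmult[OF order_ideal_mono[OF f_in_order_ideal d_ge_2]])
  have "var_y * Q = g * P - f * s" unfolding s[symmetric] by simp
  then have "var_y * Q \<in> order_ideal 2" using order_ideal_diff[OF gP fs] by (simp only:)
  moreover have "v $ 1 $ 0 = 0" if "v \<in> order_ideal 2" for v :: "'k power_series2"
    using that by (simp add: order_ideal_def)
  ultimately have "(var_y * Q) $ 1 $ 0 = 0" by blast
  then have Q: "Q \<in> order_ideal 1" by (simp add: var_y_mult_nth order_ideal_def)
  obtain p q where pq: "v1 = elt p q" using v1(1) by (rule elt_cases)
  have "f dvd (p * P + q * Q) - 1" using v1(2) unfolding pq phi_elt proj_simps proj_eq_iff .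
  then obtain k where "(p * P + q * Q) - 1 = f * k" by (rule dvdE)
  then have "1 = p * P + q * Q - f * k" by (simp add: algebra_simps)
  moreover have "p * P + q * Q - f * k \<in> order_ideal 1"
    by (intro order_ideal_diff order_ideal_add order_ideal_lmult P Q order_ideal_rmult
        order_ideal_mono[OF f_in_order_ideal]) (use d_ge_2 in simp)
  ultimately have "(1 :: 'k power_series2) \<in> order_ideal 1" by simp
  then show False by (simp add: order_ideal_def)
qed

text \<open>The first coordinate of a relation lies in \<open>(g, h)\<close>, hence in \<open>(x, y)^(d - 1)\<close>. Therefore it is well
  defined on the module modulo \<open>m^i\<close>.\<close>

lemma covered_mpow:
  assumes "i \<le> d - 1"
  shows "covered_without_free_summand R (quotient_module (regular_module R) (mpow i))"
proof -
  let ?M = "quotient_module (regular_module R) (mpow i)"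
  let ?c = "\<lambda>u. mpow i +>\<^bsub>regular_module R\<^esub> proj u"
  interpret A: plain_module R "regular_module R"
    by (rule plain_module_R[OF regular_module_is_module[OF cring_R]])
  have c_smult: "proj u \<odot>\<^bsub>?M\<^esub> ?c v = ?c (u * v)" for u v
    using A.quotient_smult[OF submodule_mpow, of "proj u" "proj v" i] by (simp add: proj_simps)
  have c_add: "?c u \<oplus>\<^bsub>?M\<^esub> ?c v = ?c (u + v)" for u v
    using A.quotient_add[OF submodule_mpow, of "proj u" "proj v" i] by (simp add: proj_simps)
  have c_carrier: "?c u \<in> carrier ?M" for u
    unfolding A.quotient_carrier by simp
  define \<pi> where "\<pi> = (\<lambda>v. ?c (SOME p. \<exists>q. v = elt p q))"
  have pi_elt: "\<pi> (elt p q) = ?c p" for p q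
  proof -
    have "\<exists>q'. elt p q = elt (SOME p'. \<exists>q'. elt p q = elt p' q') q'"
      by (rule someI[of "\<lambda>p'. \<exists>q'. elt p q = elt p' q'" p]) blast
    then obtain q' where "elt p q = elt (SOME p'. \<exists>q'. elt p q = elt p' q') q'" by (rule exE)
    then have "elt (SOME p'. \<exists>q'. elt p q = elt p' q') q' = elt p q" by (rule sym)
    then have "(SOME p'. \<exists>q'. elt p q = elt p' q') - p \<in> order_ideal (d - 1)"
      by (rule relation_order[OF elt_eqD])
    then have "(SOME p'. \<exists>q'. elt p q = elt p' q') - p \<in> order_ideal i"
      using assms by (rule order_ideal_mono)
    then have "proj ((SOME p'. \<exists>q'. elt p q = elt p' q') - p) \<in> mpow i" by (rule proj_in_mpow)
    then show ?thesis unfolding \<pi>_def coset_mpow_eq_iff .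
  qed
  have lin: "\<pi> \<in> linear_maps R covering ?M"
  proof (rule linear_mapsI)
    fix v assume "v \<in> carrier covering"
    then obtain p q where v: "v = elt p q" by (rule elt_cases)
    show "\<pi> v \<in> carrier ?M" unfolding v pi_elt by (rule c_carrier)
    show "\<pi> (v \<oplus>\<^bsub>covering\<^esub> w) = \<pi> v \<oplus>\<^bsub>?M\<^esub> \<pi> w" if w: "w \<in> carrier covering" for w
    proof -
      obtain p' q' where w: "w = elt p' q'" using w by (rule elt_cases)
      show ?thesis unfolding v w elt_add pi_elt c_add ..
    qed
    show "\<pi> (r \<odot>\<^bsub>covering\<^esub> v) = r \<odot>\<^bsub>?M\<^esub> \<pi> v" if r: "r \<in> carrier R" for r
    proof -
      obtain u where u: "r = proj u" using r by (rule R_cases)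
      show ?thesis unfolding u v elt_smult pi_elt c_smult ..
    qed
  qed
  have surj: "\<pi> ` carrier covering = carrier ?M"
  proof
    show "\<pi> ` carrier covering \<subseteq> carrier ?M"
      using linear_mapsD(1)[OF lin] by (rule image_subsetI)
    show "carrier ?M \<subseteq> \<pi> ` carrier covering"
    proof
      fix C assume "C \<in> carrier ?M"
      then obtain r where r: "C = mpow i +>\<^bsub>regular_module R\<^esub> r" "r \<in> carrier R"
        unfolding A.quotient_carrier regular_module_simps(1) by (rule imageE)
      obtain u where u: "r = proj u" using r(2) by (rule R_cases)
      have "C = \<pi> (elt u 0)" unfolding r(1) u pi_elt ..
      then show "C \<in> \<pi> ` carrier covering" using elt_carrier by (rule image_eqI)
    qed
  qed
  show ?thesis
    unfolding covered_without_free_summand_def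
  proof (intro exI conjI)
    show "maximal_cohen_macaulay R covering" by (rule covering_mcm)
    show "\<not> has_free_summand R covering" by (rule covering_no_free_summand)
    show "\<exists>h\<in>linear_maps R covering ?M. h ` carrier covering = carrier ?M"
      using surj lin by (rule bexI)
  qed
qed

end

section \<open>The index\<close>

theorem (in hypersurface_ring) index_R: "index R = enat d"
proof -
  obtain g h where gh: "g \<in> order_ideal (d - 1)" "h \<in> order_ideal (d - 1)" "f = var_x * g + var_y * h"
    by (rule partials)
  interpret matrix_factorization f d a g h
    by unfold_locales (fact gh)+
  let ?M = "\<lambda>i. quotient_module (regular_module R) (mpow i)"
  have one_neq_zero: "\<one>\<^bsub>R\<^esub> \<noteq> \<zero>\<^bsub>R\<^esub>"
  proof
    assume "\<one>\<^bsub>R\<^esub> = \<zero>\<^bsub>R\<^esub>"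
    moreover have "\<zero>\<^bsub>R\<^esub> \<in> mpow 1" unfolding proj_simps by (rule proj_in_mpow) simp
    ultimately show False using one_notin_mpow by simp
  qed
  have delta: "delta_invariant R (?M i) = 1 \<longleftrightarrow> \<not> covered_without_free_summand R (?M i)" for i
    by (rule delta_invariant_cyclic[OF cring_R one_neq_zero ideal_mpow])
  let ?D = "{enat i |i. i \<ge> 1 \<and>
      delta_invariant R (quotient_module (regular_module R) (ideal_power R (max_ideal R) i)) = 1}"
  have "Inf ?D = enat d"
  proof (rule Inf_eqI)
    fix e assume "e \<in> ?D"
    then obtain i where i: "e = enat i" "delta_invariant R (?M i) = 1"
      unfolding max_ideal_R ideal_power_mpow by blast
    have "\<not> i \<le> d - 1"
    proof
      assume "i \<le> d - 1"
      then have "covered_without_free_summand R (?M i)" by (rule covered_mpow)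
      then show False using i(2) unfolding delta by contradiction
    qed
    then have "d \<le> i" by linarith
    then show "enat d \<le> e" unfolding i(1) enat_ord_simps(1) .
  next
    fix b assume b: "\<And>e. e \<in> ?D \<Longrightarrow> b \<le> e"
    have "delta_invariant R (?M d) = 1" unfolding delta by (rule not_covered_mpow_d)
    moreover have "1 \<le> d" using d_ge_2 by simp
    ultimately have "enat d \<in> ?D" unfolding max_ideal_R ideal_power_mpow by blast
    then show "b \<le> enat d" by (rule b)
  qed
  then show ?thesis by (rule trans[OF index_def])
qed

theorem proposition3p7:
  fixes n :: nat
    and S :: "'k::field power_series2 ring"
    and I :: "'k power_series2 set"
    and R :: "'k power_series2 set ring"
    and m :: "'k power_series2 set set"
  assumes "n \<ge> 1"
    and "CHAR('k) \<noteq> 2"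
    and "\<not> int CHAR('k) dvd 1 + (-2) ^ n"
    and "S = cring_class_ops"
    and "I = PIdl\<^bsub>S\<^esub> (var_x * var_y * (var_x ^ n + var_y ^ n))"
    and "R = S Quot I"
    and "m = Idl\<^bsub>R\<^esub> {I +>\<^bsub>S\<^esub> var_x, I +>\<^bsub>S\<^esub> var_y}"
  shows "ideal_power R m (n + 2) =
           ideal_prod R (PIdl\<^bsub>R\<^esub> (I +>\<^bsub>S\<^esub> (var_x + 2 * var_y))) (ideal_power R m (n + 1)) \<and>
         generalized_loewy_length R = n + 2 \<and>
         index R = enat (n + 2)"
proof -
  define f :: "'k power_series2" where "f = var_x * var_y * (var_x ^ n + var_y ^ n)"
  have "form (1 + 1 + n) f"
    unfolding f_def by (intro form_mult form_add form_power form_var_x form_var_y)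
  then have form: "form (n + 2) f" by (simp add: add.commute)
  have "(2 :: 'k) \<noteq> 0"
  proof
    assume "(2 :: 'k) = 0"
    then have "of_nat 2 = (0 :: 'k)" by simp
    then have "CHAR('k) dvd 2" by (simp only: of_nat_eq_0_iff_char_dvd)
    then have "CHAR('k) \<le> 2" by (rule dvd_imp_le) simp
    moreover have "CHAR('k) \<noteq> 0"
    proof
      assume "CHAR('k) = 0"
      with \<open>CHAR('k) dvd 2\<close> show False by simp
    qed
    moreover have "CHAR('k) \<noteq> 1" by simp
    ultimately show False using assms(2) by linarith
  qed
  have "1 + (- 2) ^ n \<noteq> (0 :: 'k)"
  proof
    assume "1 + (- 2) ^ n = (0 :: 'k)"
    then have "of_int (1 + (- 2) ^ n) = (0 :: 'k)" by simp
    then show False using assms(3) by (simp only: of_int_eq_0_iff_char_dvd)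
  qed
  with \<open>(2 :: 'k) \<noteq> 0\<close> have unit: "(- 2 :: 'k) * (1 + (- 2) ^ n) \<noteq> 0"
    by (simp only: mult_eq_0_iff neg_equal_0_iff_equal) simp
  have mod_x: "mod_x (shear (- 2) f) = fps_const (- 2 * (1 + (- 2) ^ n)) * fps_X ^ (n + 2)"
  proof -
    have "mod_x (shear (- 2) f) = fps_const (- 2) * fps_X * fps_X * ((fps_const (- 2) * fps_X) ^ n + fps_X ^ n)"
      unfolding f_def shear_mult shear_add shear_power shear_var_x shear_var_y mod_x_mult mod_x_add mod_x_power
        mod_x_var_x mod_x_var_y mod_x_scalar by simp
    also have "\<dots> = fps_const (- 2) * (fps_const (- 2) ^ n + 1) * fps_X ^ (n + 2)"
      by (simp only: power_mult_distrib power_add power2_eq_square) (simp only: algebra_simps mult_1_left)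
    also have "fps_const (- 2 :: 'k) ^ n + 1 = fps_const (1 + (- 2) ^ n)"
      by (simp only: fps_const_power fps_const_1_eq_1[symmetric] fps_const_add add.commute)
    finally show ?thesis by (simp only: fps_const_mult)
  qed
  have coeff: "(fps_const c * fps_X ^ (n + 2)) $ (n + 2) = c" for c :: 'k
    by simp
  (* This coefficient is f(-2, 1); its two factors are units by the conditions on the characteristic. *)
  have lead: "shear (- 2) f $ (n + 2) $ 0 \<noteq> 0"
    unfolding mod_x_nth[symmetric] mod_x coeff by (rule unit)
  interpret H: hypersurface_ring f "n + 2" 2
  proof unfold_locales
    show "form (n + 2) f" by (rule form)
    show "2 \<le> n + 2" by simp
    show "shear (- 2) f $ (n + 2) $ 0 \<noteq> 0" by (rule lead)
    show "var_x dvd f" unfolding f_def mult.assoc by (rule dvd_triv_left)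
  qed
  have S: "S = H.S" unfolding assms(4) H.S_def ..
  have I: "I = H.I" unfolding H.I_def S[symmetric] using assms(5) f_def by (simp only:)
  have R: "R = H.R" unfolding assms(6) H.R_def S I ..
  have proj: "I +>\<^bsub>S\<^esub> u = H.proj u" for u unfolding S I H.proj_def ..
  have m: "m = H.mpow 1" unfolding assms(7) proj R H.mpow_1_eq ..
  have "scalar 2 = (2 :: 'k power_series2)"
    by (simp add: scalar_def numeral_fps_const)
  then have z: "var_x + 2 * var_y = H.z" unfolding H.z_def by (simp only:)
  have "ideal_power R m (n + 2) =
           ideal_prod R (PIdl\<^bsub>R\<^esub> (I +>\<^bsub>S\<^esub> (var_x + 2 * var_y))) (ideal_power R m (n + 1))"
    unfolding proj z m unfolding R H.ideal_power_mpow using H.mpow_d by simp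
  then show ?thesis
    using H.generalized_loewy_length_R H.index_R unfolding R by blast
qed

end
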